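(* Let $\mathbb{K}$ be a field of characteristic neither $2$ nor $3$, $\overline{\mathbb{K}}$ an algebraic closure, and $n\geq 1$. Let $\mathcal{V}$ be a linear subspace of $M_n(\mathbb{K})$ of dimension $\binom{n}{2}+1$ such that every $M\in\mathcal{V}$ has at most one nonzero eigenvalue in $\overline{\mathbb{K}}$. Then there is a unique non-empty subset $I$ of $\{1,\dots,n\}$ such that $\mathcal{V}$ is similar to $\mathcal{V}^{(1^\star)}_I$.
   Context: $\mathrm{NT}_n(\mathbb{K})$ is the space of strictly upper-triangular $n\times n$ matrices. For non-empty $I\subset\{1,\dots,n\}$, $D_I$ is the diagonal matrix with $(i,i)$ entry $1$ for $i\in I$ and $0$ otherwise, and $\mathcal{V}^{(1^\star)}_I:=\mathbb{K}D_I\oplus\mathrm{NT}_n(\mathbb{K})$. Similar means conjugate by a single invertible matrix in $GL_n(\mathbb{K})$. *)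

theory Defs
  imports Jordan_Normal_Form.VS_Connect Jordan_Normal_Form.Char_Poly "HOL-Algebra.Algebraic_Closure_Type"
begin

definition mat_subspace :: "nat \<Rightarrow> 'a :: field mat set \<Rightarrow> bool" where
  "mat_subspace n V \<longleftrightarrow> VectorSpace.subspace class_ring V (module_mat TYPE('a) n n)"

definition mat_subspace_dim :: "nat \<Rightarrow> 'a :: field mat set \<Rightarrow> nat" where
  "mat_subspace_dim n V =
     vectorspace.dim class_ring ((module_mat TYPE('a) n n)\<lparr>carrier := V\<rparr>)"

definition NT :: "nat \<Rightarrow> 'a :: field mat set" where
  "NT n = {A \<in> carrier_mat n n. \<forall>i<n. \<forall>j<n. j \<le> i \<longrightarrow> A $$ (i, j) = 0}"

definition D_mat :: "nat \<Rightarrow> nat set \<Rightarrow> 'a :: field mat" where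
  "D_mat n I = mat n n (\<lambda>(i, j). if i = j \<and> i \<in> I then 1 else 0)"

definition V1star :: "nat \<Rightarrow> nat set \<Rightarrow> 'a :: field mat set" where
  "V1star n I = {c \<cdot>\<^sub>m D_mat n I + N | c N. N \<in> NT n}"

definition similar_mat_sets :: "nat \<Rightarrow> 'a :: field mat set \<Rightarrow> 'a mat set \<Rightarrow> bool" where
  "similar_mat_sets n V W \<longleftrightarrow>
     (\<exists>P Q. P \<in> carrier_mat n n \<and> Q \<in> carrier_mat n n \<and> P * Q = 1\<^sub>m n \<and> Q * P = 1\<^sub>m n
        \<and> W = (\<lambda>A. P * A * Q) ` V)"

definition at_most_one_nonzero_eigenvalue :: "'a :: field mat \<Rightarrow> bool" where
  "at_most_one_nonzero_eigenvalue M \<longleftrightarrow>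
     (\<forall>a b. eigenvalue (map_mat to_ac M) a \<longrightarrow> eigenvalue (map_mat to_ac M) b
        \<longrightarrow> a \<noteq> 0 \<longrightarrow> b \<noteq> 0 \<longrightarrow> a = b)"

end

theory Submission
  imports Defs
begin

text \<open>
  A matrix \<open>M \<in> V\<close> has power sums \<open>tr M\<^sup>k = b \<lambda>\<^sup>k\<close>. Comparing these for \<open>M\<close> and \<open>M + t A\<close>, where
  \<open>A \<in> V\<close> has trace zero, gives \<open>tr (A M) = 0\<close> and \<open>tr (A (M N + N M)) = 0\<close> for all \<open>M, N \<in> V\<close>; only
  \<open>2 \<noteq> 0\<close> and \<open>3 \<noteq> 0\<close> are needed, so that small finite fields cause no trouble.

  Orthogonality yields an adapted vector: some \<open>x \<noteq> 0\<close> such that \<open>V\<close> contains no nonzero trace-zero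
  matrix with image in \<open>K x\<close>. Take \<open>x\<close> to be the last basis vector. The matrices of \<open>V\<close> having \<open>x\<close>
  as an eigenvector form a subspace of codimension at most \<open>n - 1\<close>; their top left blocks form
  either a space of the same kind in size \<open>n - 1\<close>, or a nilpotent one, which becomes of the same kind
  after adding the scalar matrices. Induction gives the bound \<open>dim V \<le> (n choose 2) + 1\<close>. In the case of
  equality, all of \<open>NT\<close> occurs among the blocks (after conjugation) and the last column is arbitrary.
  The cubic identity then determines the last rows: up to a transvection \<open>V\<close> contains the matrix
  units above the diagonal of the block, hence is triangular except for a \<open>2 \<times> 2\<close> block at
  the end, whose possible values have a common eigenvector. So \<open>V\<close> is triangularizable, and a
  triangular space of this dimension is some \<open>V1star n I\<close>.

  For uniqueness, \<open>NT n\<close> is the set of nilpotent elements of \<open>V1star n I\<close>. A matrix conjugating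
  \<open>V1star n I\<close> to \<open>V1star n J\<close> therefore normalizes \<open>NT n\<close>, hence is upper triangular and preserves diagonals.
\<close>

section \<open>Dimension of matrix subspaces\<close>

text \<open>Rectangular shapes are covered because single columns and 1 x 1 matrices occur as
  targets of the linear maps below.\<close>

definition msub :: "nat \<Rightarrow> nat \<Rightarrow> 'a :: field mat set \<Rightarrow> bool" where
  "msub n k V \<longleftrightarrow> V \<subseteq> carrier_mat n k \<and> 0\<^sub>m n k \<in> V \<and> (\<forall>A\<in>V. \<forall>B\<in>V. A + B \<in> V)
     \<and> (\<forall>c. \<forall>A\<in>V. c \<cdot>\<^sub>m A \<in> V)"

definition mdim :: "nat \<Rightarrow> nat \<Rightarrow> 'a :: field mat set \<Rightarrow> nat" where
  "mdim n k V = vectorspace.dim class_ring ((module_mat TYPE('a) n k)\<lparr>carrier := V\<rparr>)"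

lemma msub_iff_subspace:
  "msub n k V \<longleftrightarrow> VectorSpace.subspace class_ring V (module_mat TYPE('a :: field) n k)"
proof -
  have "Module.module class_ring (module_mat TYPE('a) n k)"
    using matrix_vs[where 'a = 'a, of n k] by (simp add: vectorspace_def)
  then show ?thesis
    using matrix_vs[where 'a = 'a, of n k] 
    by (auto simp: msub_def VectorSpace.subspace_def submodule_def module_mat_simps)
qed

text \<open>Reading a vector of length \<open>n * k\<close> row by row as a matrix is a linear
  surjection, so rank-nullity transfers finite dimension and the bound from vectors to
  matrices.\<close>

lemma mat_vs_fin_dim:
  shows "vectorspace.fin_dim class_ring (module_mat TYPE('a :: field) n k)"
    and "vectorspace.dim class_ring (module_mat TYPE('a :: field) n k) \<le> n * k"
proof -
  interpret M: vectorspace class_ring "module_mat TYPE('a) n k" by (rule matrix_vs)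
  interpret U: vec_space "TYPE('a)" "n * k" .
  define T :: "'a vec \<Rightarrow> 'a mat" where "T v = mat n k (\<lambda>(i, j). v $ (i * k + j))" for v
  have bd: "i * k + j < n * k" if "i < n" "j < k" for i j
  proof -
    have "i * k + j < Suc i * k" using that by simp
    also have "\<dots> \<le> n * k" using that by (intro mult_le_mono1) simp
    finally show ?thesis .
  qed
  have UV: "vectorspace class_ring (module_vec TYPE('a) (n * k))"
    by (rule U.vectorspace_axioms)
  interpret L: linear_map class_ring "module_vec TYPE('a) (n * k)" "module_mat TYPE('a) n k" T
    apply (rule linear_map.intro[OF UV M.vectorspace_axioms])
    apply (rule mod_hom.intro)
    using UV apply (simp add: vectorspace_def)
    using M.vectorspace_axioms apply (simp add: vectorspace_def)
    apply (rule mod_hom_axioms.intro)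
    apply (auto simp: LinearCombinations.module_hom_def T_def module_mat_simps module_vec_simps intro!: eq_matI)
     apply (simp_all add: bd)
    done
  have surj: "T ` carrier (module_vec TYPE('a) (n * k)) = carrier (module_mat TYPE('a) n k)"
  proof (intro equalityI subsetI)
    fix A assume "A \<in> carrier (module_mat TYPE('a) n k)"
    then have A: "A \<in> carrier_mat n k" by (simp add: module_mat_simps)
    define v where "v = vec (n * k) (\<lambda>l. A $$ (l div k, l mod k))"
    have "T v = A"
      by (rule eq_matI) (use A in \<open>auto simp: T_def v_def bd\<close>)
    moreover have "v \<in> carrier (module_vec TYPE('a) (n * k))" by (simp add: v_def module_vec_simps)
    ultimately show "A \<in> T ` carrier (module_vec TYPE('a) (n * k))" by blast
  qed (auto simp: T_def module_mat_simps)
  show "M.fin_dim" by (rule L.rank_nullity_main(2)[OF U.fin_dim surj])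
  have im: "L.imT = carrier (module_mat TYPE('a) n k)" using surj by (simp add: L.im_def)
  show "M.dim \<le> n * k"
    using L.rank_nullity[OF U.fin_dim] unfolding im U.dim_is_n by simp
qed

text \<open>Independent subsets of \<open>V\<close> stay independent in the full matrix space, so
  their size is bounded; a maximal one exists and is a finite basis.\<close>

lemma msub_vs:
  assumes "msub n k (V :: 'a :: field mat set)"
  shows "vectorspace class_ring ((module_mat TYPE('a) n k)\<lparr>carrier := V\<rparr>)"
    and "vectorspace.fin_dim class_ring ((module_mat TYPE('a) n k)\<lparr>carrier := V\<rparr>)"
proof -
  interpret M: vectorspace class_ring "module_mat TYPE('a) n k" by (rule matrix_vs)
  have sub: "VectorSpace.subspace class_ring V (module_mat TYPE('a) n k)"
    using assms by (simp add: msub_iff_subspace)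
  then show vs: "vectorspace class_ring ((module_mat TYPE('a) n k)\<lparr>carrier := V\<rparr>)"
    by (rule M.subspace_is_vs)
  interpret W: vectorspace class_ring "(module_mat TYPE('a) n k)\<lparr>carrier := V\<rparr>" by (rule vs)
  have sm: "submodule class_ring V (module_mat TYPE('a) n k)"
    using sub by (simp add: VectorSpace.subspace_def)
  have VC: "V \<subseteq> carrier (module_mat TYPE('a) n k)" using sm by (simp add: submodule_def)
  have small: "finite A \<and> card A \<le> M.dim" if "A \<subseteq> V" "W.lin_indpt A" for A
  proof -
    have "M.lin_indpt A" using M.span_li_not_depend(2)[OF that(1) sm] that(2) by simp
    then show ?thesis using M.li_le_dim[OF mat_vs_fin_dim(1)] that(1) VC by blast
  qed
  have "\<exists>A. finite A \<and> maximal A (\<lambda>S. S \<subseteq> carrier ((module_mat TYPE('a) n k)\<lparr>carrier := V\<rparr>) \<and> W.lin_indpt S)"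
    by (rule maximal_exists[where N = "M.dim" and B = "{}"])
       (use small in \<open>auto simp: W.lin_dep_def\<close>)
  then obtain A where A: "finite A" "maximal A (\<lambda>S. S \<subseteq> carrier ((module_mat TYPE('a) n k)\<lparr>carrier := V\<rparr>) \<and> W.lin_indpt S)"
    by blast
  have "W.basis A" by (rule W.max_li_is_basis[OF A(2)])
  then show "W.fin_dim" using A(1) by (auto simp: W.basis_def W.fin_dim_def)
qed

text \<open>A basis of \<open>V\<close> is independent in \<open>W\<close>. If its size is the
  dimension of \<open>W\<close>, it is a basis of \<open>W\<close> too, and the spans
  coincide.\<close>

lemma mdim_mono_eq:
  assumes V: "msub n k V" and W: "msub n k W" and VW: "V \<subseteq> W"
  shows mdim_mono: "mdim n k V \<le> mdim n k W"
    and mdim_eqD: "mdim n k V = mdim n k W \<Longrightarrow> V = W"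
proof -
  let ?V = "(module_mat TYPE('a) n k)\<lparr>carrier := V\<rparr>" and ?W = "(module_mat TYPE('a) n k)\<lparr>carrier := W\<rparr>"
  interpret V: vectorspace class_ring ?V by (rule msub_vs[OF V])
  interpret W: vectorspace class_ring ?W by (rule msub_vs[OF W])
  have sm: "submodule class_ring V ?W"
    using V VW W.vectorspace_axioms by (auto simp: submodule_def msub_def module_mat_simps vectorspace_def)
  have eq: "?W\<lparr>carrier := V\<rparr> = ?V" by simp
  obtain B where B: "finite B" "V.basis B"
    using V.finite_basis_exists[OF msub_vs(2)[OF V]] by blast
  have BV: "B \<subseteq> V" using B(2) by (simp add: V.basis_def)
  have cV: "mdim n k V = card B" unfolding mdim_def by (rule V.dim_basis[OF B])
  have li: "W.lin_indpt B"
    using W.span_li_not_depend(2)[OF BV sm] B(2) unfolding eq V.basis_def by simp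
  have BW: "B \<subseteq> carrier ?W" using BV VW by simp
  show "mdim n k V \<le> mdim n k W"
    unfolding cV unfolding mdim_def by (rule W.li_le_dim(2)[OF msub_vs(2)[OF W] BW li])
  assume "mdim n k V = mdim n k W"
  then have "card B \<ge> W.dim" unfolding cV unfolding mdim_def by simp
  then have "W.basis B" by (rule W.dim_li_is_basis[OF msub_vs(2)[OF W] B(1) BW li])
  then have "W.span B = W" by (simp add: W.basis_def)
  moreover have "V.span B = V" using B(2) by (simp add: V.basis_def)
  ultimately show "V = W" using W.span_li_not_depend(1)[OF BV sm] unfolding eq by simp
qed

lemma msub_carrier: "msub n k (carrier_mat n k)"
  by (auto simp: msub_def)

lemma mdim_carrier_le: "mdim n k (carrier_mat n k :: 'a :: field mat set) \<le> n * k"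
proof -
  have "(module_mat TYPE('a) n k)\<lparr>carrier := carrier_mat n k\<rparr> = module_mat TYPE('a) n k"
    by (simp add: module_mat_def)
  then show ?thesis unfolding mdim_def using mat_vs_fin_dim(2)[where 'a = 'a, of n k] by simp
qed

lemma mdim_le: "msub n k V \<Longrightarrow> mdim n k V \<le> n * k"
  using mdim_mono[OF _ msub_carrier, of n k V] mdim_carrier_le[of n k]
  by (metis le_trans msub_def)

lemma msub_zero: "msub n k {0\<^sub>m n k}"
  by (auto simp: msub_def)

text \<open>Linearity is asked on \<open>V\<close> only: extracting entries is additive just for
  matrices of the right size.\<close>

definition mlin :: "nat \<Rightarrow> nat \<Rightarrow> nat \<Rightarrow> nat \<Rightarrow> 'a :: field mat set \<Rightarrow> ('a mat \<Rightarrow> 'a mat) \<Rightarrow> bool" where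
  "mlin n k n' k' V f \<longleftrightarrow> (\<forall>A\<in>V. f A \<in> carrier_mat n' k') \<and> (\<forall>A\<in>V. \<forall>B\<in>V. f (A + B) = f A + f B)
     \<and> (\<forall>c. \<forall>A\<in>V. f (c \<cdot>\<^sub>m A) = c \<cdot>\<^sub>m f A)"

lemma mlin_rank_nullity:
  assumes V: "msub n k V" and f: "mlin n k n' k' V f"
  shows mlin_image: "msub n' k' (f ` V)" and mlin_ker: "msub n k {A \<in> V. f A = 0\<^sub>m n' k'}"
    and rank_nullity: "mdim n k V = mdim n' k' (f ` V) + mdim n k {A \<in> V. f A = 0\<^sub>m n' k'}"
proof -
  let ?V = "(module_mat TYPE('a) n k)\<lparr>carrier := V\<rparr>"
  interpret V: vectorspace class_ring ?V by (rule msub_vs[OF V])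
  interpret W: vectorspace class_ring "module_mat TYPE('a) n' k'" by (rule matrix_vs)
  interpret L: linear_map class_ring ?V "module_mat TYPE('a) n' k'" f
    apply (rule linear_map.intro[OF V.vectorspace_axioms W.vectorspace_axioms])
    apply (rule mod_hom.intro)
    using V.vectorspace_axioms apply (simp add: vectorspace_def)
    using W.vectorspace_axioms apply (simp add: vectorspace_def)
    apply (rule mod_hom_axioms.intro)
    using f apply (auto simp: LinearCombinations.module_hom_def mlin_def module_mat_simps)
    done
  have im: "L.imT = f ` V" by (simp add: L.im_def)
  have ker: "L.kerT = {A \<in> V. f A = 0\<^sub>m n' k'}" by (simp add: L.ker_def module_mat_simps)
  show "msub n' k' (f ` V)" using L.imT_is_subspace unfolding im msub_iff_subspace .
  have "VectorSpace.subspace class_ring {A \<in> V. f A = 0\<^sub>m n' k'} ?V"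
    using L.kerT_is_subspace unfolding ker .
  then show "msub n k {A \<in> V. f A = 0\<^sub>m n' k'}"
    using V by (auto simp: VectorSpace.subspace_def submodule_def msub_def module_mat_simps)
  show "mdim n k V = mdim n' k' (f ` V) + mdim n k {A \<in> V. f A = 0\<^sub>m n' k'}"
    using L.rank_nullity[OF msub_vs(2)[OF V]] unfolding im ker mdim_def by simp
qed

lemma mdim_zero: "mdim n k {0\<^sub>m n k :: 'a :: field mat} = 0"
proof -
  let ?Z = "{0\<^sub>m n k :: 'a mat}"
  interpret Z: vectorspace class_ring "(module_mat TYPE('a) n k)\<lparr>carrier := ?Z\<rparr>"
    by (rule msub_vs[OF msub_zero])
  have "Z.gen_set {}" using Z.span_empty by (simp add: module_mat_simps)
  then show ?thesis unfolding mdim_def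
    using Z.gen_ge_dim[of "{}"] by simp
qed

lemma mdim_inj:
  assumes V: "msub n k V" and f: "mlin n k n' k' V f" and inj: "\<And>A. A \<in> V \<Longrightarrow> f A = 0\<^sub>m n' k' \<Longrightarrow> A = 0\<^sub>m n k"
  shows "mdim n' k' (f ` V) = mdim n k V"
proof -
  have z: "0\<^sub>m n k \<in> V" using V by (simp add: msub_def)
  have "f (0 \<cdot>\<^sub>m 0\<^sub>m n k) = 0 \<cdot>\<^sub>m f (0\<^sub>m n k)" "f (0\<^sub>m n k) \<in> carrier_mat n' k'" 
    using f z unfolding mlin_def by blast+
  moreover from this(2) have "0 \<cdot>\<^sub>m f (0\<^sub>m n k) = 0\<^sub>m n' k'" by (intro eq_matI) auto
  ultimately have "f (0\<^sub>m n k) = 0\<^sub>m n' k'" by simp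
  then have "{A \<in> V. f A = 0\<^sub>m n' k'} = {0\<^sub>m n k}" using inj V by (auto simp: msub_def)
  then show ?thesis using rank_nullity[OF V f] by (simp add: mdim_zero)
qed

section \<open>Conjugation, blocks and traces\<close>

text \<open>Used to expand products on request; the simp rule through scalar products is switched
  off below in its favour.\<close>

lemma index_mult_mat_sum:
  assumes "A \<in> carrier_mat n k" "B \<in> carrier_mat k l" "i < n" "j < l"
  shows "(A * B) $$ (i, j) = (\<Sum>s<k. A $$ (i, s) * B $$ (s, j))"
  using assms by (auto simp: scalar_prod_def lessThan_atLeast0)

declare index_mult_mat(1) [simp del]

lemma mult_carrier_square [simp]:
  "A \<in> carrier_mat n n \<Longrightarrow> B \<in> carrier_mat n n \<Longrightarrow> A * B \<in> carrier_mat n n"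
  by (rule mult_carrier_mat)

definition inv_pair :: "nat \<Rightarrow> 'a :: field mat \<Rightarrow> 'a mat \<Rightarrow> bool" where
  "inv_pair n P Q \<longleftrightarrow> P \<in> carrier_mat n n \<and> Q \<in> carrier_mat n n \<and> P * Q = 1\<^sub>m n \<and> Q * P = 1\<^sub>m n"

lemma inv_pair_sym: "inv_pair n P Q \<Longrightarrow> inv_pair n Q P"
  by (auto simp: inv_pair_def)

lemma inv_pair_one: "inv_pair n (1\<^sub>m n) (1\<^sub>m n)"
  by (auto simp: inv_pair_def)

lemma conj_conj:
  assumes "inv_pair n P Q" "inv_pair n P' Q'" "A \<in> carrier_mat n n"
  shows "P' * (P * A * Q) * Q' = (P' * P) * A * (Q * Q')"
proof -
  note c = assms[unfolded inv_pair_def]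
  have "P' * (P * A * Q) * Q' = P' * (P * A * Q * Q')"
    using c by (intro assoc_mult_mat[of _ n n _ n _ n]) auto
  also have "P * A * Q * Q' = P * A * (Q * Q')"
    using c by (intro assoc_mult_mat[of _ n n _ n _ n]) auto
  also have "\<dots> = P * (A * (Q * Q'))"
    using c by (intro assoc_mult_mat[of _ n n _ n _ n]) auto
  also have "P' * (P * (A * (Q * Q'))) = P' * P * (A * (Q * Q'))"
    using c by (intro assoc_mult_mat[of _ n n _ n _ n, symmetric]) auto
  also have "\<dots> = P' * P * A * (Q * Q')"
    using c by (intro assoc_mult_mat[of _ n n _ n _ n, symmetric]) auto
  finally show ?thesis .
qed

lemma inv_pair_mult:
  assumes "inv_pair n P Q" "inv_pair n P' Q'"
  shows "inv_pair n (P' * P) (Q * Q')"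
proof -
  note c = assms[unfolded inv_pair_def]
  have "P' * P * (Q * Q') = P' * (P * (Q * Q'))"
    using c by (intro assoc_mult_mat[of _ n n _ n _ n]) auto
  also have "P * (Q * Q') = P * Q * Q'"
    using c by (intro assoc_mult_mat[of _ n n _ n _ n, symmetric]) auto
  finally have 1: "P' * P * (Q * Q') = 1\<^sub>m n" using c left_mult_one_mat[of Q' n n] by simp
  have "Q * Q' * (P' * P) = Q * (Q' * (P' * P))"
    using c by (intro assoc_mult_mat[of _ n n _ n _ n]) auto
  also have "Q' * (P' * P) = Q' * P' * P"
    using c by (intro assoc_mult_mat[of _ n n _ n _ n, symmetric]) auto
  finally have 2: "Q * Q' * (P' * P) = 1\<^sub>m n" using c left_mult_one_mat[of P n n] by simp
  show ?thesis using 1 2 c by (auto simp: inv_pair_def)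
qed

lemma conj_cancel:
  assumes "inv_pair n P Q" "A \<in> carrier_mat n n"
  shows "Q * (P * A * Q) * P = A"
  using conj_conj[OF assms(1) inv_pair_sym[OF assms(1)] assms(2)] assms by (auto simp: inv_pair_def)

lemma conj_mult:
  assumes "inv_pair n P Q" "A \<in> carrier_mat n n" "B \<in> carrier_mat n n"
  shows "(P * A * Q) * (P * B * Q) = P * (A * B) * Q"
proof -
  note c = assms[unfolded inv_pair_def]
  have "(P * A * Q) * (P * B * Q) = P * A * (Q * (P * B * Q))"
    using c by (intro assoc_mult_mat[of _ n n _ n _ n]) auto
  also have "Q * (P * B * Q) = Q * (P * (B * Q))"
    using c by (subst assoc_mult_mat[of P n n _ n _ n]) auto
  also have "\<dots> = Q * P * (B * Q)"
    using c by (intro assoc_mult_mat[of _ n n _ n _ n, symmetric]) auto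
  also have "\<dots> = B * Q" using c by simp
  also have "P * A * (B * Q) = P * A * B * Q"
    using c by (intro assoc_mult_mat[of _ n n _ n _ n, symmetric]) auto
  also have "P * A * B = P * (A * B)"
    using c by (intro assoc_mult_mat[of _ n n _ n _ n]) auto
  finally show ?thesis .
qed

lemma inv_pair_of_injective:
  fixes P :: "'a :: field mat"
  assumes P: "P \<in> carrier_mat n n" and inj: "\<And>v. v \<in> carrier_vec n \<Longrightarrow> P *\<^sub>v v = 0\<^sub>v n \<Longrightarrow> v = 0\<^sub>v n"
  shows "\<exists>Q. inv_pair n P Q"
proof -
  have "det P \<noteq> 0" using det_0_iff_vec_prod_zero[OF P] inj by blast
  from det_non_zero_imp_unit[OF P this] show ?thesis
    using P by (auto simp: Units_def ring_mat_def inv_pair_def)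
qed

text \<open>Basis exchange: a unit vector at a position \<open>k\<close> with
  \<open>x $ k \<noteq> 0\<close> is replaced by \<open>x\<close>. The vector \<open>x\<close>
  becomes the last column, and for \<open>k \<noteq> m\<close> column \<open>k\<close> takes over
  the last unit vector.\<close>

lemma ex_inv_pair_last_col:
  fixes x :: "'a :: field vec"
  assumes x: "x \<in> carrier_vec (Suc m)" and x0: "x \<noteq> 0\<^sub>v (Suc m)"
  shows "\<exists>P Q. inv_pair (Suc m) P Q \<and> col P m = x"
proof -
  let ?n = "Suc m"
  obtain k where k: "k < ?n" "x $ k \<noteq> 0"
    using x x0 by (metis carrier_vecD eq_vecI index_zero_vec(1) index_zero_vec(2))
  define P where "P = mat ?n ?n (\<lambda>(i, j). if j = m then x $ i else if j = k then (if i = m then 1 else 0)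
     else if i = j then 1 else 0)"
  have P: "P \<in> carrier_mat ?n ?n" by (simp add: P_def)
  have "\<exists>Q. inv_pair ?n P Q"
  proof (rule inv_pair_of_injective[OF P])
    fix v :: "'a vec" assume v: "v \<in> carrier_vec ?n" and Pv: "P *\<^sub>v v = 0\<^sub>v ?n"
    have e: "(\<Sum>j<?n. P $$ (i, j) * v $ j) = 0" if "i < ?n" for i
      using arg_cong[OF Pv, of "\<lambda>w :: 'a vec. w $ i"] that P v
      by (simp add: scalar_prod_def lessThan_atLeast0)
    have e': "(\<Sum>j<m. P $$ (i, j) * v $ j) + x $ i * v $ m = 0" if "i < ?n" for i
      using e[OF that] that by (simp add: P_def)
    \<comment> \<open>Row \<open>k\<close> of \<open>P\<close> has the pivot \<open>x $ k\<close> in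
      the last column as its only nonzero entry.\<close>
    have vm: "v $ m = 0"
    proof -
      have "(\<Sum>j<m. P $$ (k, j) * v $ j) = 0"
        by (rule sum.neutral) (use k in \<open>auto simp: P_def\<close>)
      then show ?thesis using e'[OF k(1)] k(2) by simp
    qed
    have vi: "v $ i = 0" if "i < m" for i
    proof (cases "i = k")
      case True
      have "(\<Sum>j<m. P $$ (m, j) * v $ j) = (\<Sum>j<m. if j = k then v $ j else 0)"
        by (rule sum.cong) (auto simp: P_def)
      then show ?thesis using e'[of m] vm that True by simp
    next
      case False
      have "(\<Sum>j<m. P $$ (i, j) * v $ j) = (\<Sum>j<m. if j = i then v $ j else 0)"
        by (rule sum.cong) (use False that in \<open>auto simp: P_def\<close>)
      then show ?thesis using e'[of i] vm that by simp
    qed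
    show "v = 0\<^sub>v ?n"
      using v vm vi by (intro eq_vecI) (auto simp: less_Suc_eq)
  qed
  moreover have "col P m = x" using x by (intro eq_vecI) (auto simp: P_def)
  ultimately show ?thesis by blast
qed

section \<open>Blocks and bordered matrices\<close>

definition topleft :: "nat \<Rightarrow> 'a mat \<Rightarrow> 'a mat" where
  "topleft m M = mat m m (\<lambda>(i, j). M $$ (i, j))"

definition botright :: "nat \<Rightarrow> nat \<Rightarrow> 'a mat \<Rightarrow> 'a mat" where
  "botright k l M = mat l l (\<lambda>(i, j). M $$ (k + i, k + j))"

lemma topleft_carrier [simp]: "topleft m M \<in> carrier_mat m m"
  by (simp add: topleft_def)

lemma botright_carrier [simp]: "botright k l M \<in> carrier_mat l l"
  by (simp add: botright_def)

text \<open>The block diagonal matrix with blocks \<open>P\<close> and 1: a change of basis that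
  fixes the last basis vector.\<close>

definition ext :: "nat \<Rightarrow> 'a :: field mat \<Rightarrow> 'a mat" where
  "ext m P = mat (Suc m) (Suc m) (\<lambda>(i, j). if i < m \<and> j < m then P $$ (i, j) else if i = j then 1 else 0)"

lemma ext_carrier [simp]: "ext m P \<in> carrier_mat (Suc m) (Suc m)"
  by (simp add: ext_def)

lemma ext_mult_index:
  assumes M: "M \<in> carrier_mat (Suc m) (Suc m)" and j: "j < Suc m"
  shows "i < m \<Longrightarrow> (ext m P * M) $$ (i, j) = (\<Sum>s<m. P $$ (i, s) * M $$ (s, j))"
    and "(ext m P * M) $$ (m, j) = M $$ (m, j)"
    and "i < m \<Longrightarrow> (M * ext m P) $$ (j, i) = (\<Sum>s<m. M $$ (j, s) * P $$ (s, i))"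
    and "(M * ext m P) $$ (j, m) = M $$ (j, m)"
proof -
  note * = index_mult_mat_sum[OF ext_carrier M _ j] index_mult_mat_sum[OF M ext_carrier j]
  show "i < m \<Longrightarrow> (ext m P * M) $$ (i, j) = (\<Sum>s<m. P $$ (i, s) * M $$ (s, j))"
    by (subst *) (auto simp: ext_def)
  show "(ext m P * M) $$ (m, j) = M $$ (m, j)"
    by (subst *) (auto simp: ext_def)
  show "i < m \<Longrightarrow> (M * ext m P) $$ (j, i) = (\<Sum>s<m. M $$ (j, s) * P $$ (s, i))"
    by (subst *) (auto simp: ext_def)
  show "(M * ext m P) $$ (j, m) = M $$ (j, m)"
    by (subst *) (auto simp: ext_def)
qed

lemma ext_conj_index:
  assumes M: "M \<in> carrier_mat (Suc m) (Suc m)" and P: "P \<in> carrier_mat m m" and Q: "Q \<in> carrier_mat m m"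
  shows "i < m \<Longrightarrow> j < m \<Longrightarrow> (ext m P * M * ext m Q) $$ (i, j) = (P * topleft m M * Q) $$ (i, j)"
    and "i < m \<Longrightarrow> (ext m P * M * ext m Q) $$ (i, m) = (\<Sum>s<m. P $$ (i, s) * M $$ (s, m))"
    and "j < m \<Longrightarrow> (ext m P * M * ext m Q) $$ (m, j) = (\<Sum>s<m. M $$ (m, s) * Q $$ (s, j))"
    and "(ext m P * M * ext m Q) $$ (m, m) = M $$ (m, m)"
proof -
  have c: "ext m P * M \<in> carrier_mat (Suc m) (Suc m)" using M by auto
  have PM: "P * topleft m M \<in> carrier_mat m m" using P by auto
  show "(ext m P * M * ext m Q) $$ (i, j) = (P * topleft m M * Q) $$ (i, j)" if "i < m" "j < m"
  proof -
    have "(ext m P * M * ext m Q) $$ (i, j) = (\<Sum>s<m. (\<Sum>t<m. P $$ (i, t) * M $$ (t, s)) * Q $$ (s, j))"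
      using that by (subst ext_mult_index(3)[OF c]) (auto intro!: sum.cong simp: ext_mult_index(1)[OF M])
    also have "\<dots> = (\<Sum>s<m. (P * topleft m M) $$ (i, s) * Q $$ (s, j))"
      using that by (intro sum.cong refl, subst index_mult_mat_sum[OF P topleft_carrier]) (simp_all add: topleft_def)
    also have "\<dots> = (P * topleft m M * Q) $$ (i, j)"
      using that by (simp add: index_mult_mat_sum[OF PM Q])
    finally show ?thesis .
  qed
  show "i < m \<Longrightarrow> (ext m P * M * ext m Q) $$ (i, m) = (\<Sum>s<m. P $$ (i, s) * M $$ (s, m))"
    by (simp add: ext_mult_index(4)[OF c] ext_mult_index(1)[OF M])
  show "j < m \<Longrightarrow> (ext m P * M * ext m Q) $$ (m, j) = (\<Sum>s<m. M $$ (m, s) * Q $$ (s, j))"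
    by (subst ext_mult_index(3)[OF c]) (auto intro!: sum.cong simp: ext_mult_index(2)[OF M])
  show "(ext m P * M * ext m Q) $$ (m, m) = M $$ (m, m)"
    by (simp add: ext_mult_index(4)[OF c] ext_mult_index(2)[OF M])
qed

lemma inv_pair_ext:
  assumes "inv_pair m P Q"
  shows "inv_pair (Suc m) (ext m P) (ext m Q)"
proof -
  have *: "ext m P * ext m Q = 1\<^sub>m (Suc m)" if "inv_pair m P Q" for P Q :: "'a mat"
  proof (rule eq_matI)
    note c = that[unfolded inv_pair_def]
    have PQ: "(\<Sum>s<m. P $$ (i, s) * Q $$ (s, j)) = (if i = j then 1 else 0)" if "i < m" "j < m" for i j
      using that c index_mult_mat_sum[of P m m Q m i j] by simp
    fix i j assume "i < dim_row (1\<^sub>m (Suc m))" "j < dim_col (1\<^sub>m (Suc m))"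
    then have ij: "i < Suc m" "j < Suc m" by auto
    show "(ext m P * ext m Q) $$ (i, j) = 1\<^sub>m (Suc m) $$ (i, j)"
    proof (cases "i < m")
      case True
      have "(ext m P * ext m Q) $$ (i, j) = (\<Sum>s<m. P $$ (i, s) * ext m Q $$ (s, j))"
        by (rule ext_mult_index(1)[OF ext_carrier ij(2) True])
      also have "\<dots> = (if i = j then 1 else 0)"
      proof (cases "j < m")
        case True
        then show ?thesis using PQ[of i j] \<open>i < m\<close> by (simp add: ext_def)
      next
        case False
        then show ?thesis using \<open>i < m\<close> ij by (simp add: ext_def)
      qed
      finally show ?thesis using ij by simp
    next
      case False
      then have "i = m" using ij by simp
      then show ?thesis using ij by (simp add: ext_mult_index(2)[OF ext_carrier]) (simp add: ext_def)
    qed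
  qed (auto simp: ext_def)
  show ?thesis using *[OF assms] *[OF inv_pair_sym[OF assms]] by (simp add: inv_pair_def)
qed

text \<open>Induction on the size: an eigenvector, available over an algebraically closed field,
  becomes the last basis vector, and the top left block is treated recursively. Placing the
  eigenvector last is what makes the form lower triangular.\<close>

lemma lower_triangularization:
  fixes A :: "'a :: alg_closed_field mat"
  assumes "A \<in> carrier_mat n n"
  shows "\<exists>P Q. inv_pair n P Q \<and> (\<forall>i j. i < j \<longrightarrow> j < n \<longrightarrow> (P * A * Q) $$ (i, j) = 0)"
  using assms
proof (induction n arbitrary: A)
  case 0
  then show ?case using inv_pair_one[of 0] by auto
next
  case (Suc m)
  let ?n = "Suc m"
  have A: "A \<in> carrier_mat ?n ?n" by fact
  have "Polynomial.degree (char_poly A) > 0" using degree_monic_char_poly[OF A] by simp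
  then obtain a where "poly (char_poly A) a = 0" using alg_closed_imp_poly_has_root by blast
  then have "eigenvalue A a" using eigenvalue_root_char_poly[OF A] by simp
  then obtain x where x: "x \<in> carrier_vec ?n" "x \<noteq> 0\<^sub>v ?n" "A *\<^sub>v x = a \<cdot>\<^sub>v x"
    using A by (auto simp: eigenvalue_def eigenvector_def)
  obtain P Q where PQ: "inv_pair ?n P Q" "col P m = x" using ex_inv_pair_last_col[OF x(1,2)] by blast
  note c = PQ(1)[unfolded inv_pair_def]
  define B where "B = Q * A * P"
  have B: "B \<in> carrier_mat ?n ?n" using c A by (auto simp: B_def)
  \<comment> \<open>The last column of \<open>B\<close> is \<open>a\<close> times the last unit
    vector, because \<open>P\<close> carries that unit vector to the eigenvector
    \<open>x\<close>.\<close>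
  have Bm: "B $$ (i, m) = 0" if "i < m" for i
  proof -
    have "col B m = Q * A *\<^sub>v col P m" unfolding B_def
      using c A by (intro col_mult2) auto
    also have "\<dots> = Q *\<^sub>v (A *\<^sub>v x)" unfolding PQ(2)
      using c A x by (intro assoc_mult_mat_vec) auto
    also have "\<dots> = a \<cdot>\<^sub>v (Q *\<^sub>v x)" unfolding x(3) using c x(1) by (intro mult_mat_vec) auto
    also have "Q *\<^sub>v x = col (Q * P) m" unfolding PQ(2)[symmetric]
      using c by (intro col_mult2[symmetric]) auto
    also have "\<dots> = unit_vec ?n m" using c by simp
    finally have "col B m $ i = 0" using that by simp
    then show ?thesis using B that by simp
  qed
  obtain P' Q' where PQ': "inv_pair m P' Q'" 
    "\<And>i j. i < j \<Longrightarrow> j < m \<Longrightarrow> (P' * topleft m B * Q') $$ (i, j) = 0"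
    using Suc.IH[OF topleft_carrier] by blast
  have c': "P' \<in> carrier_mat m m" "Q' \<in> carrier_mat m m" using PQ'(1) by (auto simp: inv_pair_def)
  have "(ext m P' * B * ext m Q') $$ (i, j) = 0" if "i < j" "j < ?n" for i j
  proof (cases "j < m")
    case True
    then show ?thesis using PQ'(2)[of i j] that by (simp add: ext_conj_index(1)[OF B c'])
  next
    case False
    then have "j = m" "i < m" using that by auto
    then show ?thesis using Bm by (simp add: ext_conj_index(2)[OF B c'])
  qed
  moreover have "ext m P' * B * ext m Q' = (ext m P' * Q) * A * (P * ext m Q')"
    unfolding B_def by (rule conj_conj[OF inv_pair_sym[OF PQ(1)] inv_pair_ext[OF PQ'(1)] A])
  moreover have "inv_pair ?n (ext m P' * Q) (P * ext m Q')"
    by (rule inv_pair_mult[OF inv_pair_sym[OF PQ(1)] inv_pair_ext[OF PQ'(1)]])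
  ultimately show ?case by metis
qed

section \<open>Traces and eigenvalues\<close>

definition mtr :: "nat \<Rightarrow> 'a :: field mat \<Rightarrow> 'a" where
  "mtr n A = (\<Sum>i<n. A $$ (i, i))"

lemma mtr_mult:
  assumes "A \<in> carrier_mat n n" "B \<in> carrier_mat n n"
  shows "mtr n (A * B) = (\<Sum>i<n. \<Sum>j<n. A $$ (i, j) * B $$ (j, i))"
  using assms by (simp add: mtr_def index_mult_mat_sum)

lemma mtr_comm:
  assumes "A \<in> carrier_mat n n" "B \<in> carrier_mat n n"
  shows "mtr n (A * B) = mtr n (B * A)"
  unfolding mtr_mult[OF assms] mtr_mult[OF assms(2,1)]
  by (subst sum.swap) (simp add: mult.commute)

lemma mtr_add: "A \<in> carrier_mat n n \<Longrightarrow> B \<in> carrier_mat n n \<Longrightarrow> mtr n (A + B) = mtr n A + mtr n B"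
  by (auto simp: mtr_def sum.distrib)

lemma mtr_smult: "A \<in> carrier_mat n n \<Longrightarrow> mtr n (c \<cdot>\<^sub>m A) = c * mtr n A"
  by (auto simp: mtr_def sum_distrib_left)

lemma mtr_conj:
  assumes "inv_pair n P Q" "A \<in> carrier_mat n n"
  shows "mtr n (P * A * Q) = mtr n A"
proof -
  note c = assms[unfolded inv_pair_def]
  have "mtr n (P * A * Q) = mtr n (Q * (P * A))" using c by (intro mtr_comm) auto
  also have "Q * (P * A) = Q * P * A" using c by (intro assoc_mult_mat[symmetric]) auto
  finally show ?thesis using c by simp
qed

lemma eigenvalue_conj:
  assumes "inv_pair n P Q" "A \<in> carrier_mat n n"
  shows "eigenvalue (P * A * Q) k \<longleftrightarrow> eigenvalue A k"
proof -
  note c = assms[unfolded inv_pair_def]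
  have "similar_mat (P * A * Q) A"
    using similar_mat_witI[of P Q n "P * A * Q" A] c by (auto simp: similar_mat_def)
  then show ?thesis
    using c by (subst (1 2) eigenvalue_root_char_poly[of _ n]) (auto simp: char_poly_similar)
qed

lemma eigenvalue_lower_triangular:
  fixes A :: "'a :: field mat"
  assumes A: "A \<in> carrier_mat n n" and lt: "\<And>i j. i < j \<Longrightarrow> j < n \<Longrightarrow> A $$ (i, j) = 0"
  shows "eigenvalue A k \<longleftrightarrow> (\<exists>i<n. A $$ (i, i) = k)"
proof -
  have "det (char_matrix A k) = prod_list (diag_mat (char_matrix A k))"
    by (rule det_lower_triangular[of n]) (use A lt in \<open>auto simp: char_matrix_def\<close>)
  also have "\<dots> = 0 \<longleftrightarrow> (\<exists>i<n. A $$ (i, i) = k)"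
    using A by (auto simp: prod_list_zero_iff diag_mat_def char_matrix_def image_iff)
  finally show ?thesis by (simp add: eigenvalue_det[OF A])
qed

lemma eigenvalue_upper_triangular:
  fixes A :: "'a :: field mat"
  assumes A: "A \<in> carrier_mat n n" and lt: "\<And>i j. j < i \<Longrightarrow> i < n \<Longrightarrow> A $$ (i, j) = 0"
  shows "eigenvalue A k \<longleftrightarrow> (\<exists>i<n. A $$ (i, i) = k)"
proof -
  have ut: "upper_triangular (char_matrix A k)"
    using A lt by (auto simp: upper_triangular_def char_matrix_def)
  have "det (char_matrix A k) = prod_list (diag_mat (char_matrix A k))"
    by (rule det_upper_triangular[OF ut, of n]) (use A in \<open>auto simp: char_matrix_def\<close>)
  also have "\<dots> = 0 \<longleftrightarrow> (\<exists>i<n. A $$ (i, i) = k)"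
    using A by (auto simp: prod_list_zero_iff diag_mat_def char_matrix_def image_iff)
  finally show ?thesis by (simp add: eigenvalue_det[OF A])
qed

lemma eigenvalue_block_lower:
  fixes M :: "'a :: field mat"
  assumes M: "M \<in> carrier_mat (k + l) (k + l)" 
    and z: "\<And>i j. i < k \<Longrightarrow> k \<le> j \<Longrightarrow> j < k + l \<Longrightarrow> M $$ (i, j) = 0"
  shows "eigenvalue M x \<longleftrightarrow> eigenvalue (topleft k M) x \<or> eigenvalue (botright k l M) x"
proof -
  have eq: "char_matrix M x = four_block_mat (char_matrix (topleft k M) x) (0\<^sub>m k l)
       (mat l k (\<lambda>(i, j). M $$ (k + i, j))) (char_matrix (botright k l M) x)"
    using M z by (intro eq_matI) (auto simp: char_matrix_def topleft_def botright_def)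
  have "det (char_matrix M x) = det (char_matrix (topleft k M) x) * det (char_matrix (botright k l M) x)"
    unfolding eq by (rule det_four_block_mat_upper_right_zero) auto
  then show ?thesis
    by (simp add: eigenvalue_det[OF M] eigenvalue_det[OF topleft_carrier] eigenvalue_det[OF botright_carrier])
qed

text \<open>In triangular form the diagonal entries of the powers are the powers of the diagonal
  entries. The nonzero ones are eigenvalues, hence share a value \<open>l\<close>, and
  \<open>b\<close> is their number.\<close>

lemma power_traces:
  fixes A :: "'a :: alg_closed_field mat"
  assumes A: "A \<in> carrier_mat n n"
    and one: "\<And>a b. eigenvalue A a \<Longrightarrow> eigenvalue A b \<Longrightarrow> a \<noteq> 0 \<Longrightarrow> b \<noteq> 0 \<Longrightarrow> a = b"
  shows "\<exists>b\<le>n. \<exists>l. mtr n A = of_nat b * l \<and> mtr n (A * A) = of_nat b * l ^ 2 \<and> mtr n (A * A * A) = of_nat b * l ^ 3"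
proof -
  obtain P Q where PQ: "inv_pair n P Q" and lt: "\<And>i j. i < j \<Longrightarrow> j < n \<Longrightarrow> (P * A * Q) $$ (i, j) = 0"
    using lower_triangularization[OF A] by blast
  define C where "C = P * A * Q"
  have C: "C \<in> carrier_mat n n" using PQ A by (auto simp: C_def inv_pair_def)
  have CC: "C * C = P * (A * A) * Q" unfolding C_def by (rule conj_mult[OF PQ A A])
  have CCC: "C * C * C = P * (A * A * A) * Q" unfolding CC unfolding C_def 
    by (rule conj_mult[OF PQ _ A]) (use A in auto)
  have lt: "C $$ (i, j) = 0" if "i < j" "j < n" for i j using lt[OF that] by (simp add: C_def)
  have lt2: "(C * C) $$ (i, j) = 0" if "i < j" "j < n" for i j
  proof -
    have "C $$ (i, s) * C $$ (s, j) = 0" if "s < n" for s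
      using lt[of i s] lt[of s j] \<open>i < j\<close> \<open>j < n\<close> that by (cases "i < s") auto
    then have "(\<Sum>s<n. C $$ (i, s) * C $$ (s, j)) = 0" by (intro sum.neutral) auto
    then show ?thesis using that C by (simp add: index_mult_mat_sum)
  qed
  have d2: "(C * C) $$ (i, i) = C $$ (i, i) ^ 2" if "i < n" for i
  proof -
    have "C $$ (i, s) * C $$ (s, i) = (if s = i then C $$ (i, i) ^ 2 else 0)" if "s < n" for s
      using lt[of i s] lt[of s i] \<open>i < n\<close> that by (cases "i < s") (auto simp: power2_eq_square)
    then show ?thesis using that C by (simp add: index_mult_mat_sum)
  qed
  have d3: "(C * C * C) $$ (i, i) = C $$ (i, i) ^ 3" if "i < n" for i
  proof -
    have "(C * C) $$ (i, s) * C $$ (s, i) = (if s = i then C $$ (i, i) ^ 3 else 0)" if "s < n" for s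
      using lt2[of i s] lt[of s i] \<open>i < n\<close> that d2[OF that]
      by (cases "i < s"; cases "s < i") (auto simp: power2_eq_square power3_eq_cube)
    then show ?thesis using that C by (subst index_mult_mat_sum[of "C * C" n n C n]) auto
  qed
  have ev: "eigenvalue A (C $$ (i, i))" if "i < n" for i
    using eigenvalue_lower_triangular[OF C lt] that eigenvalue_conj[OF PQ A] unfolding C_def by blast
  define S where "S = {i. i < n \<and> C $$ (i, i) \<noteq> 0}"
  have S: "S \<subseteq> {..<n}" by (auto simp: S_def)
  \<comment> \<open>If no diagonal entry is nonzero, any \<open>l\<close> will do, since it is then
    multiplied by zero.\<close>
  obtain l where l: "C $$ (i, i) = l" if "i \<in> S" for i
    using ev one unfolding S_def by (cases "S = {}") (auto simp: S_def, metis)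
  have sm: "(\<Sum>i<n. C $$ (i, i) ^ k) = of_nat (card S) * l ^ k" if "k > 0" for k
  proof -
    have "(\<Sum>i<n. C $$ (i, i) ^ k) = (\<Sum>i\<in>S. C $$ (i, i) ^ k)"
      using that by (intro sum.mono_neutral_right) (auto simp: S_def)
    also have "\<dots> = of_nat (card S) * l ^ k" using l by simp
    finally show ?thesis .
  qed
  have "card S \<le> n" using card_mono[OF _ S] by simp
  moreover have "mtr n A = of_nat (card S) * l"
    using sm[of 1] mtr_conj[OF PQ A] by (simp add: mtr_def C_def)
  moreover have "mtr n (A * A) = of_nat (card S) * l ^ 2"
    using sm[of 2] mtr_conj[OF PQ, of "A * A"] A d2 by (simp add: mtr_def CC[symmetric])
  moreover have "mtr n (A * A * A) = of_nat (card S) * l ^ 3"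
  proof -
    have "mtr n (A * A * A) = mtr n (C * C * C)" unfolding CCC
      by (rule mtr_conj[OF PQ, symmetric]) (use A in auto)
    then show ?thesis using sm[of 3] d3 unfolding mtr_def by simp
  qed
  ultimately show ?thesis by blast
qed

section \<open>Trace identities\<close>

abbreviation (input) amo :: "'a :: field mat \<Rightarrow> bool" where
  "amo \<equiv> at_most_one_nonzero_eigenvalue"

interpretation to_ac_hom: comm_ring_hom "to_ac :: 'a :: field \<Rightarrow> 'a alg_closure"
  by unfold_locales auto

lemma mtr_map_to_ac:
  "A \<in> carrier_mat n n \<Longrightarrow> mtr n (map_mat to_ac A) = to_ac (mtr n A)"
  by (auto simp: mtr_def to_ac_sum)

text \<open>\<open>b\<close> is a natural number, but \<open>l\<close> is only found in the
  algebraic closure, so the identities are stated there.\<close>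

lemma amo_power_traces:
  fixes A :: "'a :: field mat"
  assumes A: "A \<in> carrier_mat n n" and "amo A"
  shows "\<exists>b\<le>n. \<exists>l :: 'a alg_closure. to_ac (mtr n A) = of_nat b * l \<and> to_ac (mtr n (A * A)) = of_nat b * l ^ 2
    \<and> to_ac (mtr n (A * A * A)) = of_nat b * l ^ 3"
proof -
  let ?A = "map_mat to_ac A"
  have A': "?A \<in> carrier_mat n n" using A by simp
  have 2: "?A * ?A = map_mat to_ac (A * A)" using to_ac_hom.mat_hom_mult[OF A A] by simp
  have 3: "?A * ?A * ?A = map_mat to_ac (A * A * A)" unfolding 2 
    using to_ac_hom.mat_hom_mult[of "A * A" n n A n] A by simp
  have "\<exists>b\<le>n. \<exists>l. mtr n ?A = of_nat b * l \<and> mtr n (?A * ?A) = of_nat b * l ^ 2 \<and> mtr n (?A * ?A * ?A) = of_nat b * l ^ 3"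
    by (rule power_traces[OF A']) (use assms(2) in \<open>unfold at_most_one_nonzero_eigenvalue_def, blast\<close>)
  then show ?thesis unfolding 3 unfolding 2 using A
    by (simp add: mtr_map_to_ac)
qed

text \<open>All four facts are read off from \<open>b l\<close>, \<open>b l^2\<close>,
  \<open>b l^3\<close>. In positive characteristic \<open>b\<close> itself may vanish in the field,
  but each of the three power sums vanishes exactly when \<open>b\<close> or \<open>l\<close>
  does.\<close>

lemma amo_traces:
  fixes A :: "'a :: field mat"
  assumes A: "A \<in> carrier_mat n n" and "amo A"
  shows amo_traces_relation: "mtr n A * mtr n (A * A * A) = mtr n (A * A) ^ 2"
    and amo_trace0: "mtr n A = 0 \<Longrightarrow> mtr n (A * A) = 0" "mtr n A = 0 \<Longrightarrow> mtr n (A * A * A) = 0"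
    and amo_trace2_0: "mtr n (A * A) = 0 \<Longrightarrow> mtr n A = 0"
proof -
  obtain b and l :: "'a alg_closure" where
    1: "to_ac (mtr n A) = of_nat b * l" and 2: "to_ac (mtr n (A * A)) = of_nat b * l ^ 2" and
    3: "to_ac (mtr n (A * A * A)) = of_nat b * l ^ 3"
    using amo_power_traces[OF assms] by blast
  have "to_ac (mtr n A * mtr n (A * A * A)) = to_ac (mtr n (A * A) ^ 2)"
    unfolding to_ac_mult to_ac_power 1 2 3 by (simp add: algebra_simps power2_eq_square power3_eq_cube)
  then show "mtr n A * mtr n (A * A * A) = mtr n (A * A) ^ 2" by (simp only: to_ac_eq_iff)
  have e: "mtr n A = 0 \<longleftrightarrow> of_nat b * l = 0" "mtr n (A * A) = 0 \<longleftrightarrow> of_nat b * l ^ 2 = 0"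
      "mtr n (A * A * A) = 0 \<longleftrightarrow> of_nat b * l ^ 3 = 0"
    unfolding 1[symmetric] 2[symmetric] 3[symmetric] by (simp_all only: to_ac_eq_0_iff)
  show "mtr n A = 0 \<Longrightarrow> mtr n (A * A) = 0" "mtr n A = 0 \<Longrightarrow> mtr n (A * A * A) = 0"
    "mtr n (A * A) = 0 \<Longrightarrow> mtr n A = 0"
    unfolding e by auto
qed

text \<open>Either an eigenvalue is zero, so the determinant vanishes, or both are equal, so the
  discriminant vanishes. The count \<open>b \<le> 2\<close> separates the cases.\<close>

lemma amo_2x2:
  fixes Z :: "'a :: field mat"
  assumes Z: "Z \<in> carrier_mat 2 2" and "amo Z" and two: "(2 :: 'a) \<noteq> 0"
  defines "d \<equiv> Z $$ (0, 0) * Z $$ (1, 1) - Z $$ (0, 1) * Z $$ (1, 0)"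
  shows "d = 0 \<or> (Z $$ (0, 0) + Z $$ (1, 1)) ^ 2 = 4 * d"
proof -
  obtain b and l :: "'a alg_closure" where b: "b \<le> 2" and
    1: "to_ac (mtr 2 Z) = of_nat b * l" and 2: "to_ac (mtr 2 (Z * Z)) = of_nat b * l ^ 2"
    using amo_power_traces[OF assms(1,2)] by blast
  have t: "mtr 2 Z = Z $$ (0, 0) + Z $$ (1, 1)" by (simp add: mtr_def numeral_2_eq_2)
  have t2: "mtr 2 (Z * Z) = mtr 2 Z ^ 2 - 2 * d"
    using Z by (simp add: mtr_mult t) (simp add: numeral_2_eq_2 d_def algebra_simps)
  have two': "(2 :: 'a alg_closure) \<noteq> 0" using two by (metis to_ac_eq_0_iff to_ac_numeral)
  \<comment> \<open>Newton's identity: twice the determinant is the squared trace minus the trace of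
    the square.\<close>
  have "2 * to_ac d = to_ac (mtr 2 Z) ^ 2 - to_ac (mtr 2 (Z * Z))"
    unfolding t2 to_ac_diff to_ac_mult to_ac_power by simp
  then have td: "2 * to_ac d = (of_nat b * l) ^ 2 - of_nat b * l ^ 2" unfolding 1 2 .
  consider "b = 0" | "b = 1" | "b = 2" using b by linarith
  then show ?thesis
  proof cases
    case 3
    then have "2 * to_ac d = 2 * l ^ 2" using td by (simp add: power2_eq_square algebra_simps)
    then have "to_ac d = l ^ 2" using two' by simp
    then have "to_ac (mtr 2 Z ^ 2) = to_ac (4 * d)" using 3 by (simp add: 1 power2_eq_square)
    then show ?thesis unfolding to_ac_eq_iff t by blast
  qed (use td two' in \<open>auto\<close>)
qed

lemma inv_pair_map_to_ac:
  assumes "inv_pair n P Q"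
  shows "inv_pair n (map_mat to_ac P) (map_mat to_ac Q)"
  using assms to_ac_hom.mat_hom_mult[of P n n Q n] to_ac_hom.mat_hom_mult[of Q n n P n]
  by (auto simp: inv_pair_def to_ac_hom.mat_hom_one)

lemma eigenvalue_map_conj:
  assumes PQ: "inv_pair n P Q" and A: "A \<in> carrier_mat n n"
  shows "eigenvalue (map_mat to_ac (P * A * Q)) x \<longleftrightarrow> eigenvalue (map_mat to_ac A) x"
proof -
  have c: "P \<in> carrier_mat n n" "Q \<in> carrier_mat n n" using PQ by (auto simp: inv_pair_def)
  have "map_mat to_ac (P * A * Q) = map_mat to_ac P * map_mat to_ac A * map_mat to_ac Q"
    using c A to_ac_hom.mat_hom_mult[of "P * A" n n Q n] to_ac_hom.mat_hom_mult[of P n n A n] by simp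
  then show ?thesis
    using eigenvalue_conj[OF inv_pair_map_to_ac[OF PQ], of "map_mat to_ac A"] A by simp
qed

lemma amo_conj:
  "inv_pair n P Q \<Longrightarrow> A \<in> carrier_mat n n \<Longrightarrow> amo (P * A * Q) \<longleftrightarrow> amo A"
  by (simp only: at_most_one_nonzero_eigenvalue_def eigenvalue_map_conj)

definition spec_space :: "nat \<Rightarrow> 'a :: field mat set \<Rightarrow> bool" where
  "spec_space n V \<longleftrightarrow> msub n n V \<and> (\<forall>M\<in>V. amo M)"

lemma spec_spaceD:
  assumes "spec_space n V"
  shows "A \<in> V \<Longrightarrow> A \<in> carrier_mat n n" "A \<in> V \<Longrightarrow> amo A" "A \<in> V \<Longrightarrow> B \<in> V \<Longrightarrow> A + B \<in> V"
    "A \<in> V \<Longrightarrow> c \<cdot>\<^sub>m A \<in> V" "0\<^sub>m n n \<in> V" "msub n n V"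
  using assms by (auto simp: spec_space_def msub_def)

section \<open>Quadratic and cubic trace identities\<close>

lemma mtr_expand2:
  assumes "A \<in> carrier_mat n n" "B \<in> carrier_mat n n"
  shows "mtr n ((A + B) * (A + B)) = mtr n (A * A) + 2 * mtr n (A * B) + mtr n (B * B)"
proof -
  have "(A + B) * (A + B) = A * A + B * A + (A * B + B * B)"
    using assms by (simp add: add_mult_distrib_mat[of _ n n] mult_add_distrib_mat[of _ n n])
  then show ?thesis using assms mtr_comm[of A n B] by (simp add: mtr_add)
qed

lemma mtr_mult_add:
  assumes "A \<in> carrier_mat n n" "B \<in> carrier_mat n n" "C \<in> carrier_mat n n"
  shows "mtr n ((A + B) * C) = mtr n (A * C) + mtr n (B * C)" "mtr n (C * (A + B)) = mtr n (C * A) + mtr n (C * B)"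
  using assms by (simp_all add: add_mult_distrib_mat[of _ n n] mult_add_distrib_mat[of _ n n] mtr_add)

lemma mtr_mult_smult:
  assumes "A \<in> carrier_mat n n" "C \<in> carrier_mat n n"
  shows "mtr n ((c \<cdot>\<^sub>m A) * C) = c * mtr n (A * C)" "mtr n (C * (c \<cdot>\<^sub>m A)) = c * mtr n (C * A)"
  using assms by (simp_all add: mtr_smult mult_smult_assoc_mat[of _ n n] mult_smult_distrib[of _ n n])

text \<open>If \<open>tr M \<noteq> 0\<close>, the trace of the square of \<open>M + t A\<close> never vanishes; being affine in \<open>t\<close>,
  it is constant.\<close>

lemma trace_orthogonal:
  fixes A M :: "'a :: field mat"
  assumes V: "spec_space n V" and two: "(2 :: 'a) \<noteq> 0" and A: "A \<in> V" and M: "M \<in> V" and tA: "mtr n A = 0"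
  shows "mtr n (A * M) = 0"
proof (rule ccontr)
  assume ne: "mtr n (A * M) \<noteq> 0"
  note D = spec_spaceD[OF V]
  note Ac = D(1)[OF A] and Mc = D(1)[OF M]
  have ne': "mtr n (M * A) \<noteq> 0" using ne mtr_comm[OF Ac Mc] by simp
  \<comment> \<open>\<open>t\<close> is chosen to make the trace of the square of
    \<open>M + t A\<close> equal to \<open>- e\<close>. For \<open>tr M = 0\<close> this value is
    nonzero although the trace is zero; for \<open>tr M \<noteq> 0\<close> it is zero although the
    trace is not. Both are excluded.\<close>
  define e :: 'a where "e = (if mtr n M = 0 then 1 else 0)"
  define u where "u = 2 * mtr n (M * A)"
  define t where "t = - (mtr n (M * M) + e) * inverse u"
  have "u \<noteq> 0" using ne' two by (simp add: u_def)
  then have tu: "t * u = - (mtr n (M * M) + e)" by (simp add: t_def mult.assoc)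
  have tAc: "t \<cdot>\<^sub>m A \<in> carrier_mat n n" using Ac by simp
  define Y where "Y = M + t \<cdot>\<^sub>m A"
  have Y: "Y \<in> V" using A M D by (simp add: Y_def)
  have AA: "mtr n (A * A) = 0" using amo_trace0(1)[OF Ac D(2)[OF A] tA] .
  have "mtr n (Y * Y) = mtr n (M * M) + 2 * mtr n (M * (t \<cdot>\<^sub>m A)) + mtr n ((t \<cdot>\<^sub>m A) * (t \<cdot>\<^sub>m A))"
    unfolding Y_def by (rule mtr_expand2[OF Mc tAc])
  also have "\<dots> = mtr n (M * M) + t * u"
    using Ac Mc AA by (simp add: mtr_mult_smult u_def)
  also have "\<dots> = - e" unfolding tu by simp
  finally have XX: "mtr n (Y * Y) = - e" .
  have tY: "mtr n Y = mtr n M" using Ac Mc tA by (simp add: Y_def mtr_add mtr_smult)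
  show False
  proof (cases "mtr n M = 0")
    case True
    then show ?thesis using amo_trace0(1)[OF D(1)[OF Y] D(2)[OF Y]] XX tY by (simp add: e_def)
  next
    case False
    then show ?thesis using amo_trace2_0[OF D(1)[OF Y] D(2)[OF Y]] XX tY by (simp add: e_def)
  qed
qed

lemma mtr_expand3:
  assumes A: "A \<in> carrier_mat n n" and M: "M \<in> carrier_mat n n"
  shows "mtr n ((M + A) * (M + A) * (M + A)) = mtr n (M * M * M) + 3 * mtr n (M * M * A)
     + 3 * mtr n (M * A * A) + mtr n (A * A * A)"
proof -
  have e: "(M + A) * (M + A) = M * M + A * M + (M * A + A * A)"
    using assms by (simp add: add_mult_distrib_mat[of _ n n] mult_add_distrib_mat[of _ n n])
  have c: "mtr n (A * M * M) = mtr n (M * M * A)" "mtr n (M * A * M) = mtr n (M * M * A)"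
    "mtr n (A * A * M) = mtr n (M * A * A)" "mtr n (A * M * A) = mtr n (M * A * A)"
    using A M mtr_comm[of A n "M * M"] mtr_comm[of "M * A" n M] mtr_comm[of "A * A" n M] mtr_comm[of A n "M * A"]
    by simp_all
  show ?thesis unfolding e using A M c by (simp add: mtr_mult_add)
qed

text \<open>Likewise the power sums \<open>p\<^sub>1, p\<^sub>2\<close> agree at \<open>M\<close> and \<open>M \<plusminus> A\<close>, and \<open>p\<^sub>1 p\<^sub>3 = p\<^sub>2\<^sup>2\<close>
  then forces \<open>p\<^sub>3\<close> to agree as well.\<close>

lemma trace_cubic_square:
  fixes A M :: "'a :: field mat"
  assumes V: "spec_space n V" and two: "(2 :: 'a) \<noteq> 0" and three: "(3 :: 'a) \<noteq> 0"
    and A: "A \<in> V" and M: "M \<in> V" and tA: "mtr n A = 0"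
  shows "mtr n (M * M * A) = 0"
proof -
  note D = spec_spaceD[OF V]
  have *: "mtr n (M * M * A) + mtr n (M * A * A) = 0" if A: "A \<in> V" and tA: "mtr n A = 0" for A
  proof -
    note Ac = D(1)[OF A] and Mc = D(1)[OF M]
    have X: "M + A \<in> V" using A M D by simp
    note X' = D(1)[OF X] D(2)[OF X]
    have A2: "mtr n (A * A) = 0" "mtr n (A * A * A) = 0" using amo_trace0[OF Ac D(2)[OF A] tA] by auto
    have MA: "mtr n (M * A) = 0" using trace_orthogonal[OF V two A M tA] mtr_comm[OF Ac Mc] by simp
    have 1: "mtr n (M + A) = mtr n M" using Ac Mc tA by (simp add: mtr_add)
    have 2: "mtr n ((M + A) * (M + A)) = mtr n (M * M)" using mtr_expand2[OF Mc Ac] A2 MA by simp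
    have 3: "mtr n ((M + A) * (M + A) * (M + A)) = mtr n (M * M * M)"
    proof (cases "mtr n M = 0")
      case True
      then show ?thesis using amo_trace0(2)[OF X'] amo_trace0(2)[OF Mc D(2)[OF M]] 1 by simp
    next
      case False
      have "mtr n M * mtr n ((M + A) * (M + A) * (M + A)) = mtr n M * mtr n (M * M * M)"
        using amo_traces_relation[OF X', unfolded 1 2] amo_traces_relation[OF Mc D(2)[OF M]] by (rule trans[OF _ sym])
      then show ?thesis unfolding mult_left_cancel[OF False] .
    qed
    have "3 * (mtr n (M * M * A) + mtr n (M * A * A)) = 0"
      using mtr_expand3[OF Ac Mc] unfolding 3 A2 by (simp add: algebra_simps)
    then show ?thesis using three by (metis mult_eq_0_iff)
  qed
  note Ac = D(1)[OF A] and Mc = D(1)[OF M]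
  \<comment> \<open>Replacing \<open>A\<close> by \<open>- A\<close> reverses only the term linear
    in \<open>A\<close>, so the two instances of \<open>*\<close> separate the linear from the
    quadratic term.\<close>
  have "mtr n (M * M * ((-1) \<cdot>\<^sub>m A)) + mtr n (M * ((-1) \<cdot>\<^sub>m A) * ((-1) \<cdot>\<^sub>m A)) = 0"
    by (rule *) (use D A Ac tA in \<open>auto simp: mtr_smult\<close>)
  moreover have "(-1) \<cdot>\<^sub>m ((-1) \<cdot>\<^sub>m B) = B" for B :: "'a mat" by (intro eq_matI) auto
  then have "M * ((-1) \<cdot>\<^sub>m A) * ((-1) \<cdot>\<^sub>m A) = M * A * A"
    using Ac Mc by (simp add: mult_smult_assoc_mat[of _ n n] mult_smult_distrib[of _ n n])
  ultimately have "- mtr n (M * M * A) + mtr n (M * A * A) = 0"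
    using Ac Mc by (simp add: mtr_mult_smult)
  with *[OF A tA] have "2 * mtr n (M * M * A) = 0" by (simp add: algebra_simps)
  then show ?thesis using two by simp
qed

text \<open>Polarization of \<open>trace_cubic_square\<close>: the quadratic form vanishes at
  \<open>M\<close>, \<open>N\<close> and \<open>M + N\<close>.\<close>

lemma trace_cubic:
  fixes A M N :: "'a :: field mat"
  assumes V: "spec_space n V" and two: "(2 :: 'a) \<noteq> 0" and three: "(3 :: 'a) \<noteq> 0"
    and A: "A \<in> V" and M: "M \<in> V" and N: "N \<in> V" and tA: "mtr n A = 0"
  shows "mtr n (A * (M * N)) + mtr n (A * (N * M)) = 0"
proof -
  note D = spec_spaceD[OF V]
  note sq = trace_cubic_square[OF V two three A _ tA]
  note c = D(1)[OF A] D(1)[OF M] D(1)[OF N]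
  have "M + N \<in> V" using D M N by simp
  have "(M + N) * (M + N) * A = M * M * A + N * M * A + (M * N * A + N * N * A)"
    using c by (simp add: add_mult_distrib_mat[of _ n n] mult_add_distrib_mat[of _ n n])
  then have "mtr n (N * M * A) + mtr n (M * N * A) = 0"
    using sq[OF \<open>M + N \<in> V\<close>] sq[OF M] sq[OF N] c by (simp add: mtr_add)
  then show ?thesis
    using mtr_comm[of A n "M * N"] mtr_comm[of A n "N * M"] c by (simp add: add.commute)
qed

section \<open>Adapted vectors\<close>

text \<open>The rank-one endomorphism sending \<open>v\<close> to \<open>f \<bullet> v\<close> times
  \<open>x\<close>; linear forms are represented by vectors through the dot product.\<close>

definition outer :: "nat \<Rightarrow> 'a :: field vec \<Rightarrow> 'a vec \<Rightarrow> 'a mat" where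
  "outer n x f = mat n n (\<lambda>(i, j). x $ i * f $ j)"

lemma mtr_outer_mult:
  assumes "x \<in> carrier_vec n" "f \<in> carrier_vec n" "y \<in> carrier_vec n" "g \<in> carrier_vec n"
  shows "mtr n (outer n x f * outer n y g) = (f \<bullet> y) * (g \<bullet> x)"
proof -
  have "mtr n (outer n x f * outer n y g) = (\<Sum>i<n. \<Sum>j<n. (f $ j * y $ j) * (g $ i * x $ i))"
    by (subst mtr_mult) (auto simp: outer_def mult_ac intro!: sum.cong)
  also have "\<dots> = (\<Sum>j<n. f $ j * y $ j) * (\<Sum>i<n. g $ i * x $ i)"
    by (subst sum.swap) (simp add: sum_product)
  finally show ?thesis using assms by (simp add: scalar_prod_def lessThan_atLeast0)
qed

lemma mtr_outer:
  assumes "x \<in> carrier_vec n" "f \<in> carrier_vec n"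
  shows "mtr n (outer n x f) = f \<bullet> x"
  using assms by (simp add: mtr_def outer_def scalar_prod_def lessThan_atLeast0 mult.commute)

text \<open>Otherwise choose \<open>f\<^sub>y \<noteq> 0\<close> with \<open>f\<^sub>y(y) = 0\<close> and \<open>y \<otimes> f\<^sub>y \<in> V\<close> for every \<open>y \<noteq> 0\<close>. Trace
  orthogonality gives \<open>f\<^sub>x(y) f\<^sub>y(x) = 0\<close>, so one finds arbitrarily long sequences of vectors
  \<open>y\<^sub>i\<close> for which the matrix of all \<open>f\<^bsub>y\<^sub>i\<^esub>(y\<^sub>j)\<close> is strictly upper triangular with
  entries 1 above the diagonal; but its rank is at most \<open>n\<close>.\<close>

lemma ex_adapted_vector:
  fixes V :: "'a :: field mat set"
  assumes V: "spec_space n V" and two: "(2 :: 'a) \<noteq> 0" and n: "n > 0"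
  shows "\<exists>x\<in>carrier_vec n. x \<noteq> 0\<^sub>v n \<and> (\<forall>f\<in>carrier_vec n. f \<bullet> x = 0 \<longrightarrow> outer n x f \<in> V \<longrightarrow> f = 0\<^sub>v n)"
proof (rule ccontr)
  assume "\<not> ?thesis"
  then have "\<forall>x. \<exists>f. x \<in> carrier_vec n \<longrightarrow> x \<noteq> 0\<^sub>v n \<longrightarrow>
      f \<in> carrier_vec n \<and> f \<bullet> x = 0 \<and> outer n x f \<in> V \<and> f \<noteq> 0\<^sub>v n" by blast
  then obtain F where F: "\<And>x. x \<in> carrier_vec n \<Longrightarrow> x \<noteq> 0\<^sub>v n \<Longrightarrow>
      F x \<in> carrier_vec n \<and> F x \<bullet> x = 0 \<and> outer n x (F x) \<in> V \<and> F x \<noteq> 0\<^sub>v n"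
    by metis
  have prod0: "(F x \<bullet> y) * (F y \<bullet> x) = 0" 
    if "x \<in> carrier_vec n" "x \<noteq> 0\<^sub>v n" "y \<in> carrier_vec n" "y \<noteq> 0\<^sub>v n" for x y
  proof -
    note Fx = F[OF that(1,2)] and Fy = F[OF that(3,4)]
    have "mtr n (outer n x (F x) * outer n y (F y)) = 0"
      by (rule trace_orthogonal[OF V two]) (use Fx Fy that in \<open>auto simp: mtr_outer\<close>)
    then show ?thesis using Fx Fy that by (simp add: mtr_outer_mult)
  qed
  have "\<exists>y. (\<forall>i<k. y i \<in> carrier_vec n \<and> y i \<noteq> 0\<^sub>v n) \<and> (\<forall>i j. i < j \<longrightarrow> j < k \<longrightarrow> F (y i) \<bullet> y j = 1)" for k :: nat
  proof (induction k)
    case 0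
    show ?case by simp
  next
    case (Suc k)
    then obtain y where y: "\<And>i. i < k \<Longrightarrow> y i \<in> carrier_vec n" "\<And>i. i < k \<Longrightarrow> y i \<noteq> 0\<^sub>v n"
      and y1: "\<And>i j. i < j \<Longrightarrow> j < k \<Longrightarrow> F (y i) \<bullet> y j = 1" by blast
    \<comment> \<open>For \<open>i < j\<close> the other factor in \<open>prod0\<close> is 1; for
      \<open>i = j\<close> this is the choice of \<open>F\<close>.\<close>
    have y0: "F (y j) \<bullet> y i = 0" if "i \<le> j" "j < k" for i j
      using that y1[of i j] prod0[of "y i" "y j"] y[of i] y[of j] F[of "y i"] by (cases "i = j") auto
    \<comment> \<open>The values are corrected from the last index downwards. Adding a multiple of
      \<open>y (Suc p)\<close> adjusts the value at \<open>p\<close> and keeps those at larger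
      indices, by \<open>y0\<close>. The last index has no successor in the sequence, so there a
      scaled unit vector is taken.\<close>
    have "\<exists>z\<in>carrier_vec n. \<forall>i. k - l \<le> i \<longrightarrow> i < k \<longrightarrow> F (y i) \<bullet> z = 1" if "l \<le> k" for l
      using that
    proof (induction l)
      case 0
      show ?case by (intro bexI[of _ "0\<^sub>v n"]) auto
    next
      case (Suc l)
      define p where "p = k - Suc l"
      have p: "p < k" "Suc p = k - l" using Suc.prems by (auto simp: p_def)
      obtain z where z: "z \<in> carrier_vec n" "\<And>i. k - l \<le> i \<Longrightarrow> i < k \<Longrightarrow> F (y i) \<bullet> z = 1"
        using Suc by auto
      note Fp = F[OF y[OF p(1)]]
      show ?case
      proof (cases "l = 0")
        case True
        obtain s where s: "s < n" "F (y p) $ s \<noteq> 0"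
          using Fp by (metis carrier_vecD eq_vecI index_zero_vec(1) index_zero_vec(2))
        have "F (y p) \<bullet> (inverse (F (y p) $ s) \<cdot>\<^sub>v unit_vec n s) = 1"
          using s Fp by simp
        moreover have "i = p" if "k - Suc l \<le> i" "i < k" for i using that True p by auto
        ultimately show ?thesis by (intro bexI[of _ "inverse (F (y p) $ s) \<cdot>\<^sub>v unit_vec n s"]) auto
      next
        case False
        then have q: "Suc p < k" using p Suc.prems by simp
        define c where "c = 1 - F (y p) \<bullet> z"
        define z' where "z' = z + c \<cdot>\<^sub>v y (Suc p)"
        note yq = y(1)[OF q]
        have z': "z' \<in> carrier_vec n" using z(1) yq by (simp add: z'_def)
        have e: "f \<bullet> z' = f \<bullet> z + c * (f \<bullet> y (Suc p))" if "f \<in> carrier_vec n" for f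
          using that z(1) yq by (simp add: z'_def scalar_prod_add_distrib[of _ n])
        have "F (y i) \<bullet> z' = 1" if "k - Suc l \<le> i" "i < k" for i
        proof (cases "i = p")
          case True
          then show ?thesis using e[of "F (y p)"] Fp y1[of p "Suc p"] q by (simp add: c_def)
        next
          case False
          then have "Suc p \<le> i" using that p by (auto simp: p_def)
          then show ?thesis using e[of "F (y i)"] F[OF y[OF that(2)]] y0[of "Suc p" i] z(2)[of i] p that by simp
        qed
        then show ?thesis using z' by blast
      qed
    qed
    from this[of k] obtain z where z: "z \<in> carrier_vec n" "\<And>i. i < k \<Longrightarrow> F (y i) \<bullet> z = 1" by auto
    \<comment> \<open>For \<open>k = 0\<close> the vector \<open>z\<close> may be zero, so a unit
      vector starts the sequence.\<close>
    obtain w where w: "w \<in> carrier_vec n" "w \<noteq> 0\<^sub>v n" "\<And>i. i < k \<Longrightarrow> F (y i) \<bullet> w = 1"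
    proof (cases "k = 0")
      case True
      have "unit_vec n 0 \<noteq> (0\<^sub>v n :: 'a vec)" using n by simp
      then show ?thesis using that[of "unit_vec n 0"] True by simp
    next
      case False
      then have "z \<noteq> 0\<^sub>v n" using z(2)[of 0] F[OF y[of 0]] by auto
      then show ?thesis using that z by blast
    qed
    show ?case
    proof (intro exI[of _ "y(k := w)"] conjI allI impI)
      show "(y(k := w)) i \<in> carrier_vec n" if "i < Suc k" for i using that y w by (cases "i = k") auto
      show "(y(k := w)) i \<noteq> 0\<^sub>v n" if "i < Suc k" for i using that y w by (cases "i = k") auto
      show "F ((y(k := w)) i) \<bullet> (y(k := w)) j = 1" if "i < j" "j < Suc k" for i j
        using that y1 w(3) by (cases "j = k") auto
    qed
  qed
  from this[of "n + 2"] obtain y where y: "\<And>i. i < n + 2 \<Longrightarrow> y i \<in> carrier_vec n" "\<And>i. i < n + 2 \<Longrightarrow> y i \<noteq> 0\<^sub>v n"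
      and y1: "\<And>i j. i < j \<Longrightarrow> j < n + 2 \<Longrightarrow> F (y i) \<bullet> y j = 1" by blast
  have y0: "F (y j) \<bullet> y i = 0" if "i \<le> j" "j < n + 2" for i j
    using that y1[of i j] prod0[of "y i" "y j"] y[of i] y[of j] F[of "y i"] by (cases "i = j") auto
  \<comment> \<open>Shifting the column index by one turns the strictly triangular pattern into a
    unitriangular matrix \<open>G * Y\<close> of size \<open>n + 1\<close>, which uses
    \<open>n + 2\<close> vectors. Padding leaves \<open>G\<close> with a zero column, against
    determinant 1.\<close>
  let ?m = "Suc n"
  define G where "G = mat ?m ?m (\<lambda>(i, s). if s < n then F (y i) $ s else 0)"
  define Y where "Y = mat ?m ?m (\<lambda>(s, j). if s < n then y (Suc j) $ s else 0)"
  have G: "G \<in> carrier_mat ?m ?m" and Y: "Y \<in> carrier_mat ?m ?m" by (auto simp: G_def Y_def)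
  have GY: "(G * Y) $$ (i, j) = F (y i) \<bullet> y (Suc j)" if "i < ?m" "j < ?m" for i j
    using that y[of "Suc j"] by (simp add: index_mult_mat_sum[OF G Y]) (simp add: G_def Y_def scalar_prod_def lessThan_atLeast0)
  have "det (G * Y) = prod_list (diag_mat (G * Y))"
    by (rule det_upper_triangular[of _ ?m]) (use G Y y0 in \<open>auto simp: upper_triangular_def GY\<close>)
  also have "diag_mat (G * Y) = replicate ?m 1"
    using G Y y1 by (intro nth_equalityI) (auto simp: diag_mat_def GY simp del: upt_Suc replicate_Suc)
  also have "prod_list (replicate ?m (1 :: 'a)) = 1" by simp
  finally have "det G \<noteq> 0" using det_mult[OF G Y] by auto
  moreover have "G *\<^sub>v unit_vec ?m n = 0\<^sub>v ?m"
    using G by (intro eq_vecI) (auto simp: G_def)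
  moreover have "unit_vec ?m n \<noteq> (0\<^sub>v ?m :: 'a vec)" by simp
  ultimately show False using det_0_iff_vec_prod_zero[OF G] unit_vec_carrier by blast
qed

section \<open>Block matrices and transvections\<close>

lemma eigenvalue_block_upper:
  fixes M :: "'a :: field mat"
  assumes M: "M \<in> carrier_mat (k + l) (k + l)" 
    and z: "\<And>i j. k \<le> i \<Longrightarrow> i < k + l \<Longrightarrow> j < k \<Longrightarrow> M $$ (i, j) = 0"
  shows "eigenvalue M x \<longleftrightarrow> eigenvalue (topleft k M) x \<or> eigenvalue (botright k l M) x"
proof -
  have eq: "char_matrix M x = four_block_mat (char_matrix (topleft k M) x) (mat k l (\<lambda>(i, j). M $$ (i, k + j)))
       (0\<^sub>m l k) (char_matrix (botright k l M) x)"
    using M z by (intro eq_matI) (auto simp: char_matrix_def topleft_def botright_def)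
  have "det (char_matrix M x) = det (char_matrix (topleft k M) x) * det (char_matrix (botright k l M) x)"
    unfolding eq by (rule det_four_block_mat_lower_left_zero) auto
  then show ?thesis
    by (simp add: eigenvalue_det[OF M] eigenvalue_det[OF topleft_carrier] eigenvalue_det[OF botright_carrier])
qed

lemma map_topleft: "M \<in> carrier_mat n n \<Longrightarrow> k \<le> n \<Longrightarrow> topleft k (map_mat f M) = map_mat f (topleft k M)"
  by (intro eq_matI) (auto simp: topleft_def)

lemma map_botright: "M \<in> carrier_mat (k + l) (k + l) \<Longrightarrow> botright k l (map_mat f M) = map_mat f (botright k l M)"
  by (intro eq_matI) (auto simp: botright_def)

lemma amo_block_lower:
  assumes M: "M \<in> carrier_mat (k + l) (k + l)" and "amo M"
    and z: "\<And>i j. i < k \<Longrightarrow> k \<le> j \<Longrightarrow> j < k + l \<Longrightarrow> M $$ (i, j) = 0"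
  shows "amo (topleft k M)" "amo (botright k l M)"
    and "eigenvalue (map_mat to_ac (topleft k M)) a \<Longrightarrow> eigenvalue (map_mat to_ac (botright k l M)) b
      \<Longrightarrow> a \<noteq> 0 \<Longrightarrow> b \<noteq> 0 \<Longrightarrow> a = b"
proof -
  have "eigenvalue (map_mat to_ac M) x \<longleftrightarrow> eigenvalue (topleft k (map_mat to_ac M)) x \<or> eigenvalue (botright k l (map_mat to_ac M)) x" for x
    by (rule eigenvalue_block_lower) (use M z in auto)
  then show "amo (topleft k M)" "amo (botright k l M)" 
     "eigenvalue (map_mat to_ac (topleft k M)) a \<Longrightarrow> eigenvalue (map_mat to_ac (botright k l M)) b
      \<Longrightarrow> a \<noteq> 0 \<Longrightarrow> b \<noteq> 0 \<Longrightarrow> a = b"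
    using \<open>amo M\<close> map_topleft[OF M, of k to_ac] map_botright[OF M, of to_ac]
    by (simp_all add: at_most_one_nonzero_eigenvalue_def)
qed

lemma amo_block_upper:
  assumes M: "M \<in> carrier_mat (k + l) (k + l)" and "amo M"
    and z: "\<And>i j. k \<le> i \<Longrightarrow> i < k + l \<Longrightarrow> j < k \<Longrightarrow> M $$ (i, j) = 0"
  shows "amo (botright k l M)"
proof -
  have "eigenvalue (map_mat to_ac M) x \<longleftrightarrow> eigenvalue (topleft k (map_mat to_ac M)) x \<or> eigenvalue (botright k l (map_mat to_ac M)) x" for x
    by (rule eigenvalue_block_upper) (use M z in auto)
  then show ?thesis
    using \<open>amo M\<close> map_botright[OF M, of to_ac]
    by (simp add: at_most_one_nonzero_eigenvalue_def)
qed

lemma amo_triangular_diag: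
  assumes M: "M \<in> carrier_mat n n" and "amo M" and z: "\<And>i j. j < i \<Longrightarrow> i < n \<Longrightarrow> M $$ (i, j) = 0"
    and ij: "i < n" "j < n" and ne: "M $$ (i, i) \<noteq> 0" "M $$ (j, j) \<noteq> 0"
  shows "M $$ (i, i) = M $$ (j, j)"
proof -
  have *: "eigenvalue (map_mat to_ac M) (to_ac (M $$ (i, i)))" if "i < n" for i
    using M z that by (subst eigenvalue_upper_triangular[of _ n]) auto
  have "to_ac (M $$ (i, i)) = to_ac (M $$ (j, j))"
    using *[OF ij(1)] *[OF ij(2)] ne \<open>amo M\<close>
    unfolding at_most_one_nonzero_eigenvalue_def by (metis to_ac_eq_0_iff)
  then show ?thesis by simp
qed

section \<open>Simultaneous conjugation and triangularization\<close>

lemma mlin_conj: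
  assumes PQ: "inv_pair n P Q" and V: "msub n n V"
  shows "mlin n n n n V (\<lambda>A. P * A * Q)"
proof -
  have c: "P \<in> carrier_mat n n" "Q \<in> carrier_mat n n" using PQ by (auto simp: inv_pair_def)
  have VC: "A \<in> carrier_mat n n" if "A \<in> V" for A using V that by (auto simp: msub_def)
  have "P * (A + B) * Q = P * A * Q + P * B * Q" if "A \<in> V" "B \<in> V" for A B
  proof -
    have "P * (A + B) = P * A + P * B" using c VC that by (intro mult_add_distrib_mat) auto
    then show ?thesis using c VC that add_mult_distrib_mat[of "P * A" n n "P * B" Q n] by simp
  qed
  moreover have "P * (t \<cdot>\<^sub>m A) * Q = t \<cdot>\<^sub>m (P * A * Q)" if "A \<in> V" for A t
  proof -
    have "P * (t \<cdot>\<^sub>m A) = t \<cdot>\<^sub>m (P * A)" using c VC that by (intro mult_smult_distrib) auto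
    then show ?thesis using c VC[OF that] mult_smult_assoc_mat[of "P * A" n n Q n] by simp
  qed
  moreover have "P * A * Q \<in> carrier_mat n n" if "A \<in> V" for A using c VC[OF that] by simp
  ultimately show ?thesis by (simp add: mlin_def)
qed

lemma spec_space_conj:
  assumes PQ: "inv_pair n P Q" and V: "spec_space n V"
  shows "spec_space n ((\<lambda>A. P * A * Q) ` V)" "mdim n n ((\<lambda>A. P * A * Q) ` V) = mdim n n V"
proof -
  note D = spec_spaceD[OF V]
  note L = mlin_conj[OF PQ D(6)]
  show "spec_space n ((\<lambda>A. P * A * Q) ` V)"
    using mlin_image[OF D(6) L] D amo_conj[OF PQ] by (auto simp: spec_space_def)
  show "mdim n n ((\<lambda>A. P * A * Q) ` V) = mdim n n V"
  proof (rule mdim_inj[OF D(6) L])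
    fix A assume A: "A \<in> V" and z: "P * A * Q = 0\<^sub>m n n"
    have "A = Q * (P * A * Q) * P" using conj_cancel[OF PQ D(1)[OF A]] by simp
    then show "A = 0\<^sub>m n n" unfolding z
      using PQ right_mult_zero_mat[of Q n n n] left_mult_zero_mat[of P n n n] by (simp add: inv_pair_def)
  qed
qed

definition triangularizable :: "nat \<Rightarrow> 'a :: field mat set \<Rightarrow> bool" where
  "triangularizable n V \<longleftrightarrow> (\<exists>P Q. inv_pair n P Q \<and> (\<forall>A\<in>V. \<forall>i j. j < i \<longrightarrow> i < n \<longrightarrow> (P * A * Q) $$ (i, j) = 0))"

lemma triangularizable_conjD:
  assumes PQ: "inv_pair n P Q" and V: "V \<subseteq> carrier_mat n n" and t: "triangularizable n ((\<lambda>A. P * A * Q) ` V)"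
  shows "triangularizable n V"
proof -
  obtain P' Q' where PQ': "inv_pair n P' Q'" 
    "\<And>A i j. A \<in> V \<Longrightarrow> j < i \<Longrightarrow> i < n \<Longrightarrow> (P' * (P * A * Q) * Q') $$ (i, j) = 0"
    using t by (auto simp: triangularizable_def)
  have "(P' * P * A * (Q * Q')) $$ (i, j) = 0" if "A \<in> V" "j < i" "i < n" for A i j
    using PQ'(2)[OF that] conj_conj[OF PQ PQ'(1)] V that by auto
  then show ?thesis unfolding triangularizable_def
    using inv_pair_mult[OF PQ PQ'(1)] by (intro exI[of _ "P' * P"] exI[of _ "Q * Q'"]) blast
qed

text \<open>The map fixing the last basis vector and adding \<open>r j\<close> times it to basis
  vector \<open>j\<close>; negating \<open>r\<close> inverts it.\<close>

definition transv :: "nat \<Rightarrow> (nat \<Rightarrow> 'a :: field) \<Rightarrow> 'a mat" where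
  "transv m r = mat (Suc m) (Suc m) (\<lambda>(i, j). if i = j then 1 else if i = m then r j else 0)"

lemma transv_carrier [simp]: "transv m r \<in> carrier_mat (Suc m) (Suc m)"
  by (simp add: transv_def)

lemma transv_mult_index:
  assumes M: "M \<in> carrier_mat (Suc m) (Suc m)" and j: "j < Suc m"
  shows "i < m \<Longrightarrow> (transv m r * M) $$ (i, j) = M $$ (i, j)"
    and "(transv m r * M) $$ (m, j) = (\<Sum>s<m. r s * M $$ (s, j)) + M $$ (m, j)"
    and "i < m \<Longrightarrow> (M * transv m r) $$ (j, i) = M $$ (j, i) + M $$ (j, m) * r i"
    and "(M * transv m r) $$ (j, m) = M $$ (j, m)"
proof -
  note * = index_mult_mat_sum[OF transv_carrier M _ j] index_mult_mat_sum[OF M transv_carrier j]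
  show "i < m \<Longrightarrow> (transv m r * M) $$ (i, j) = M $$ (i, j)"
    by (subst *) (auto simp: transv_def if_distrib[of "\<lambda>x. x * _"] cong: if_cong)
  show "(transv m r * M) $$ (m, j) = (\<Sum>s<m. r s * M $$ (s, j)) + M $$ (m, j)"
    by (subst *) (auto simp: transv_def intro!: sum.cong)
  show "(M * transv m r) $$ (j, i) = M $$ (j, i) + M $$ (j, m) * r i" if i: "i < m"
  proof -
    have "(\<Sum>s<m. M $$ (j, s) * transv m r $$ (s, i)) = (\<Sum>s<m. if s = i then M $$ (j, i) else 0)"
      using i by (intro sum.cong) (auto simp: transv_def)
    then show ?thesis using i by (subst *) (auto simp: transv_def)
  qed
  have "(\<Sum>s<m. M $$ (j, s) * transv m r $$ (s, m)) = 0"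
    by (intro sum.neutral) (auto simp: transv_def)
  then show "(M * transv m r) $$ (j, m) = M $$ (j, m)"
    by (subst *) (auto simp: transv_def)
qed

lemma inv_pair_transv: "inv_pair (Suc m) (transv m r) (transv m (\<lambda>i. - r i))"
proof -
  have *: "transv m r * transv m (\<lambda>i. - r i) = 1\<^sub>m (Suc m)" for r :: "nat \<Rightarrow> 'a"
  proof (rule eq_matI)
    fix i j assume "i < dim_row (1\<^sub>m (Suc m))" "j < dim_col (1\<^sub>m (Suc m))"
    then have ij: "i < Suc m" "j < Suc m" by auto
    show "(transv m r * transv m (\<lambda>i. - r i)) $$ (i, j) = 1\<^sub>m (Suc m) $$ (i, j)"
    proof (cases "j < m")
      case True
      then show ?thesis using ij
        by (subst transv_mult_index(3)[OF transv_carrier]) (auto simp: transv_def)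
    next
      case False
      then have "j = m" using ij by simp
      then show ?thesis using ij
        by (simp add: transv_mult_index(4)[OF transv_carrier]) (auto simp: transv_def)
    qed
  qed (auto simp: transv_def)
  show ?thesis using *[of r] *[of "\<lambda>i. - r i"] by (simp add: inv_pair_def)
qed

lemma transv_conj_index:
  fixes r :: "nat \<Rightarrow> 'a :: field"
  assumes M: "M \<in> carrier_mat (Suc m) (Suc m)"
  defines "N \<equiv> transv m r * M * transv m (\<lambda>i. - r i)"
  shows "i < m \<Longrightarrow> j < m \<Longrightarrow> N $$ (i, j) = M $$ (i, j) - M $$ (i, m) * r j"
    and "i < m \<Longrightarrow> N $$ (i, m) = M $$ (i, m)"
    and "j < m \<Longrightarrow> N $$ (m, j) = (\<Sum>s<m. r s * M $$ (s, j)) + M $$ (m, j) - ((\<Sum>s<m. r s * M $$ (s, m)) + M $$ (m, m)) * r j"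
    and "N $$ (m, m) = (\<Sum>s<m. r s * M $$ (s, m)) + M $$ (m, m)"
proof -
  have c: "transv m r * M \<in> carrier_mat (Suc m) (Suc m)" using M by simp
  show "i < m \<Longrightarrow> j < m \<Longrightarrow> N $$ (i, j) = M $$ (i, j) - M $$ (i, m) * r j"
    unfolding N_def by (subst transv_mult_index(3)[OF c]) (auto simp: transv_mult_index(1)[OF M])
  show "i < m \<Longrightarrow> N $$ (i, m) = M $$ (i, m)"
    unfolding N_def by (subst transv_mult_index(4)[OF c]) (auto simp: transv_mult_index(1)[OF M])
  show "j < m \<Longrightarrow> N $$ (m, j) = (\<Sum>s<m. r s * M $$ (s, j)) + M $$ (m, j) - ((\<Sum>s<m. r s * M $$ (s, m)) + M $$ (m, m)) * r j"
    unfolding N_def by (subst transv_mult_index(3)[OF c]) (auto simp: transv_mult_index(2)[OF M])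
  show "N $$ (m, m) = (\<Sum>s<m. r s * M $$ (s, m)) + M $$ (m, m)"
    unfolding N_def by (subst transv_mult_index(4)[OF c]) (auto simp: transv_mult_index(2)[OF M])
qed

text \<open>One of 1 and -1 serves, since 4 and -4 differ when \<open>2 \<noteq> 0\<close>. In the
  applications \<open>\<tau>\<close> is the trace of a 2 x 2 matrix and \<open>e\<close> a
  determinant that \<open>amo_2x2\<close> forbids for it.\<close>

lemma ex_det_not_admissible:
  assumes two: "(2 :: 'a :: field) \<noteq> 0"
  shows "\<exists>e :: 'a. e \<noteq> 0 \<and> \<tau> ^ 2 \<noteq> 4 * e"
proof (cases "\<tau> ^ 2 = 4")
  case True
  have "(4 :: 'a) \<noteq> - 4"
  proof
    assume "(4 :: 'a) = - 4"
    then have "(2 :: 'a) ^ 3 = 0" by (simp add: eq_neg_iff_add_eq_0)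
    then show False using power_not_zero[OF two, of 3] by blast
  qed
  then show ?thesis using True by (intro exI[of _ "- 1"]) auto
next
  case False
  then show ?thesis by (intro exI[of _ 1]) auto
qed

text \<open>\<open>Q\<close> is a linear space of matrices with rows \<open>(a, b)\<close> and
  \<open>(c, d)\<close>; the conclusion says, without division, that each maps \<open>(u, v)\<close>
  to a parallel vector. A nonzero traceless member is nilpotent and its image is the common line. If
  there is none, the space is at most a line, and admissibility puts an eigenvalue of a generator
  into the field.\<close>

lemma common_eigenvector_2x2:
  fixes Q :: "'a :: field \<Rightarrow> 'a \<Rightarrow> 'a \<Rightarrow> 'a \<Rightarrow> bool"
  assumes two: "(2 :: 'a) \<noteq> 0"
    and add: "\<And>a b c d a' b' c' d'. Q a b c d \<Longrightarrow> Q a' b' c' d' \<Longrightarrow> Q (a + a') (b + b') (c + c') (d + d')"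
    and scale: "\<And>t a b c d. Q a b c d \<Longrightarrow> Q (t * a) (t * b) (t * c) (t * d)"
    and adm: "\<And>a b c d. Q a b c d \<Longrightarrow> a * d - b * c = 0 \<or> (a + d) ^ 2 = 4 * (a * d - b * c)"
  shows "\<exists>u v. (u, v) \<noteq> (0, 0) \<and> (\<forall>a b c d. Q a b c d \<longrightarrow> (a * u + b * v) * v = (c * u + d * v) * u)"
proof (cases "\<exists>a b c. Q a b c (- a) \<and> (a, b, c) \<noteq> (0, 0, 0)")
  case True
  then obtain a b c where Q: "Q a b c (- a)" and ne: "(a, b, c) \<noteq> (0, 0, 0)" by blast
  define k where "k = a * a + b * c"
  have d: "a * - a - b * c = - k" by (simp add: k_def)
  have "4 * k = 0 \<or> k = 0" using adm[OF Q, unfolded d] by auto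
  moreover have "(4 :: 'a) = 2 * 2" by simp
  then have "(4 :: 'a) \<noteq> 0" using two by (metis mult_eq_0_iff)
  ultimately have nil: "a * a + b * c = 0" unfolding k_def[symmetric] by (metis mult_eq_0_iff)
  \<comment> \<open>The expression is the trace of the product with the nilpotent matrix. Were it
    nonzero, adding multiples of that matrix would keep the trace and give the determinant any
    value, even a forbidden \<open>e\<close>.\<close>
  have orth: "a * (a' - d') + b * c' + c * b' = 0" if Q': "Q a' b' c' d'" for a' b' c' d'
  proof (rule ccontr)
    define w where "w = a * (a' - d') + b * c' + c * b'"
    assume "a * (a' - d') + b * c' + c * b' \<noteq> 0"
    then have w: "w \<noteq> 0" by (simp add: w_def)
    obtain e where e: "e \<noteq> 0" "(a' + d') ^ 2 \<noteq> 4 * e" using ex_det_not_admissible[OF two] by blast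
    define t where "t = (a' * d' - b' * c' - e) * inverse w"
    have tw: "t * w = a' * d' - b' * c' - e" using w by (simp add: t_def mult.assoc)
    have "(a' + t * a) * (d' + t * (- a)) - (b' + t * b) * (c' + t * c)
       = a' * d' - b' * c' - t * w - t * t * (a * a + b * c)"
      unfolding w_def by (simp add: algebra_simps)
    then have d: "(a' + t * a) * (d' + t * (- a)) - (b' + t * b) * (c' + t * c) = e"
      unfolding nil tw by simp
    show False using adm[OF add[OF Q' scale[OF Q, of t]], unfolded d] e by simp
  qed
  show ?thesis
  \<comment> \<open>The image of the nilpotent matrix is spanned by the first unit vector if
    \<open>c = 0\<close>, and by its first column \<open>(a, c)\<close> otherwise.\<close>
  proof (cases "c = 0")
    case True
    then have "a = 0" using nil by simp
    then have "b \<noteq> 0" using ne True by simp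
    then have "c' = 0" if "Q a' b' c' d'" for a' b' c' d' using orth[OF that] True \<open>a = 0\<close> by simp
    then show ?thesis by (intro exI[of _ 1] exI[of _ 0]) auto
  next
    case False
    have "(a' * a + b' * c) * c = (c' * a + d' * c) * a" if "Q a' b' c' d'" for a' b' c' d'
    proof -
      have "(a' * a + b' * c) * c - (c' * a + d' * c) * a 
          = c * (a * (a' - d') + b * c' + c * b') - c' * (a * a + b * c)"
        by (simp add: algebra_simps)
      then show ?thesis using orth[OF that] nil by simp
    qed
    then show ?thesis using False by (intro exI[of _ a] exI[of _ c]) auto
  qed
next
  case False
  show ?thesis
  proof (cases "\<exists>a b c d. Q a b c d \<and> (a, b, c, d) \<noteq> (0, 0, 0, 0)")
    case True
    then obtain a b c d where Q: "Q a b c d" and ne: "(a, b, c, d) \<noteq> (0, 0, 0, 0)" by blast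
    have tr: "a + d \<noteq> 0"
    proof
      assume "a + d = 0"
      then have "d = - a" by (simp add: eq_neg_iff_add_eq_0 add.commute)
      then show False using False Q ne by auto
    qed
    \<comment> \<open>The combination of the two matrices that cancels their traces is traceless,
      hence zero.\<close>
    have mult: "(a + d) * a' = (a' + d') * a \<and> (a + d) * b' = (a' + d') * b \<and> (a + d) * c' = (a' + d') * c"
      if "Q a' b' c' d'" for a' b' c' d'
    proof -
      let ?w = "- (a' + d')"
      have 1: "Q ((a + d) * a' + ?w * a) ((a + d) * b' + ?w * b) ((a + d) * c' + ?w * c) ((a + d) * d' + ?w * d)"
        by (rule add[OF scale[OF that] scale[OF Q]])
      have 2: "(a + d) * d' + ?w * d = - ((a + d) * a' + ?w * a)"
        by (simp add: algebra_simps)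
      have "((a + d) * a' + ?w * a, (a + d) * b' + ?w * b, (a + d) * c' + ?w * c) = (0, 0, 0)"
        using False 1[unfolded 2] by blast
      then have "(a + d) * a' + ?w * a = 0" "(a + d) * b' + ?w * b = 0" "(a + d) * c' + ?w * c = 0"
        by blast+
      then show ?thesis by (simp only: mult_minus_left add_uminus_conv_diff right_minus_eq)
    qed
    have mult_d: "(a + d) * d' = (a' + d') * d" if "Q a' b' c' d'" for a' b' c' d'
      using mult[OF that] by (simp add: algebra_simps)
    \<comment> \<open>The eigenvalue is 0 if the determinant vanishes, and half the trace if the
      discriminant does.\<close>
    obtain l where l: "l * l - (a + d) * l + (a * d - b * c) = 0"
    proof (cases "a * d - b * c = 0")
      case True
      then show ?thesis using that[of 0] by simp
    next
      case False
      define l where "l = (a + d) * inverse 2"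
      have s: "a + d = 2 * l" using two by (simp add: l_def)
      have "(2 * l) ^ 2 = 4 * (a * d - b * c)" using adm[OF Q] False s by simp
      then have "4 * (l * l) = 4 * (a * d - b * c)" by (simp add: power2_eq_square)
      moreover have "(4 :: 'a) = 2 * 2" by simp
      then have "(4 :: 'a) \<noteq> 0" using two by (metis mult_eq_0_iff)
      ultimately have "l * l = a * d - b * c" by (metis mult_left_cancel)
      then show ?thesis using that[of l] unfolding s by (simp add: algebra_simps)
    qed
    have "\<exists>u v. (u, v) \<noteq> (0, 0) \<and> (a * u + b * v) * v = (c * u + d * v) * u"
    proof (cases "b = 0")
      case True
      then show ?thesis by (intro exI[of _ 0] exI[of _ 1]) auto
    next
      case False
      have "(a * b + b * (l - a)) * (l - a) - (c * b + d * (l - a)) * b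
         = b * (l * l - (a + d) * l + (a * d - b * c))" by (simp add: algebra_simps)
      then show ?thesis using False l by (intro exI[of _ b] exI[of _ "l - a"]) auto
    qed
    then obtain u v where uv: "(u, v) \<noteq> (0, 0)" "(a * u + b * v) * v = (c * u + d * v) * u" by blast
    have "(a' * u + b' * v) * v = (c' * u + d' * v) * u" if Q': "Q a' b' c' d'" for a' b' c' d'
    proof -
      have "(a + d) * ((a' * u + b' * v) * v) = ((a + d) * a' * u + (a + d) * b' * v) * v" by (simp add: algebra_simps)
      also have "\<dots> = (a' + d') * ((a * u + b * v) * v)" using mult[OF Q'] by (simp add: algebra_simps)
      also have "\<dots> = ((a + d) * c' * u + (a + d) * d' * v) * u" unfolding uv(2)
        using mult[OF Q'] mult_d[OF Q'] by (simp add: algebra_simps)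
      also have "\<dots> = (a + d) * ((c' * u + d' * v) * u)" by (simp add: algebra_simps)
      finally show ?thesis using tr by simp
    qed
    then show ?thesis using uv(1) by blast
  next
    case False
    then have "a = 0 \<and> b = 0 \<and> c = 0 \<and> d = 0" if "Q a b c d" for a b c d using that by auto
    then show ?thesis by (intro exI[of _ 1] exI[of _ 0]) auto
  qed
qed

section \<open>Spaces containing hooks\<close>

text \<open>A matrix unit with an unknown last row: prescribing the top left block and a zero last
  column leaves the last row undetermined.\<close>

definition hook :: "nat \<Rightarrow> nat \<Rightarrow> nat \<Rightarrow> 'a :: field mat \<Rightarrow> bool" where
  "hook m i j A \<longleftrightarrow> A \<in> carrier_mat (Suc m) (Suc m) \<and> A $$ (m, m) = 0
     \<and> (\<forall>k<m. \<forall>l\<le>m. A $$ (k, l) = (if k = i \<and> l = j then 1 else 0))"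

definition full_last_col :: "nat \<Rightarrow> 'a :: field mat set \<Rightarrow> bool" where
  "full_last_col m V \<longleftrightarrow> (\<forall>c. \<exists>M\<in>V. \<forall>i<m. M $$ (i, m) = c i)"

lemma hookD:
  assumes "hook m i j A"
  shows "A \<in> carrier_mat (Suc m) (Suc m)" "A $$ (m, m) = 0"
    "k < m \<Longrightarrow> l \<le> m \<Longrightarrow> A $$ (k, l) = (if k = i \<and> l = j then 1 else 0)"
  using assms by (auto simp: hook_def)

lemma mtr_hook: "hook m i j A \<Longrightarrow> i < j \<Longrightarrow> mtr (Suc m) A = 0"
  by (auto simp: hook_def mtr_def intro!: sum.neutral)

lemma hook_mult_index:
  assumes h: "hook m i j A" and ij: "i < m" "j < m" and B: "B \<in> carrier_mat (Suc m) (Suc m)"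
    and kl: "k < m" "l \<le> m"
  shows "(A * B) $$ (k, l) = (if k = i then B $$ (j, l) else 0)"
proof -
  note D = hookD[OF h]
  have "(A * B) $$ (k, l) = (\<Sum>s<Suc m. A $$ (k, s) * B $$ (s, l))"
    using kl by (intro index_mult_mat_sum[OF D(1) B]) auto
  also have "\<dots> = (\<Sum>s<Suc m. if s = j then (if k = i then B $$ (j, l) else 0) else 0)"
    using kl by (intro sum.cong refl) (auto simp: D(3))
  also have "\<dots> = (if k = i then B $$ (j, l) else 0)" using ij by (subst sum.delta) auto
  finally show ?thesis .
qed

lemma mtr_hook_mult:
  assumes h: "hook m i j A" and ij: "i < m" "j < m" and B: "B \<in> carrier_mat (Suc m) (Suc m)"
  shows "mtr (Suc m) (A * B) = B $$ (j, i) + (\<Sum>s<m. A $$ (m, s) * B $$ (s, m))"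
proof -
  note D = hookD[OF h]
  have "mtr (Suc m) (A * B) = (\<Sum>k<m. (A * B) $$ (k, k)) + (A * B) $$ (m, m)"
    by (simp add: mtr_def)
  also have "(A * B) $$ (m, m) = (\<Sum>s<m. A $$ (m, s) * B $$ (s, m))"
    using D by (subst index_mult_mat_sum[OF D(1) B]) auto
  also have "(\<Sum>k<m. (A * B) $$ (k, k)) = (\<Sum>k<m. if k = i then B $$ (j, i) else 0)"
    by (intro sum.cong refl) (auto simp: hook_mult_index[OF h ij B])
  also have "\<dots> = B $$ (j, i)" using ij by simp
  finally show ?thesis .
qed

lemma mtr_hook_hook_mult:
  assumes h: "hook m i j A" and ij: "i < m" "j < m" and h': "hook m k l A'" and kl: "k < m" "l < m"
    and B: "B \<in> carrier_mat (Suc m) (Suc m)"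
  shows "mtr (Suc m) (A * (A' * B)) = (if j = k then B $$ (l, i) else 0) + A $$ (m, k) * B $$ (l, m)"
proof -
  have c: "A' * B \<in> carrier_mat (Suc m) (Suc m)" using hookD(1)[OF h'] B by simp
  have "(\<Sum>s<m. A $$ (m, s) * (A' * B) $$ (s, m)) = (\<Sum>s<m. if s = k then A $$ (m, k) * B $$ (l, m) else 0)"
    by (intro sum.cong refl) (auto simp: hook_mult_index[OF h' kl B])
  also have "\<dots> = A $$ (m, k) * B $$ (l, m)" using kl by simp
  finally have "(\<Sum>s<m. A $$ (m, s) * (A' * B) $$ (s, m)) = A $$ (m, k) * B $$ (l, m)" .
  then show ?thesis using ij by (simp add: mtr_hook_mult[OF h ij c] hook_mult_index[OF h' kl B])
qed

text \<open>\<open>trace_orthogonal\<close> for a hook; it expresses a below-diagonal entry of the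
  block of \<open>M\<close> by the last column of \<open>M\<close> and the last row of the
  hook.\<close>

lemma hook_orthogonal:
  fixes V :: "'a :: field mat set"
  assumes V: "spec_space (Suc m) V" and two: "(2 :: 'a) \<noteq> 0"
    and h: "hook m i j A" and ij: "i < j" "j < m" and A: "A \<in> V" and M: "M \<in> V"
  shows "M $$ (j, i) + (\<Sum>s<m. A $$ (m, s) * M $$ (s, m)) = 0"
  using trace_orthogonal[OF V two A M mtr_hook[OF h ij(1)]] mtr_hook_mult[OF h _ ij(2) spec_spaceD(1)[OF V M]] ij
  by simp

text \<open>\<open>trace_cubic\<close> for two hooks and \<open>M\<close>. Cyclicity brings both
  traces to the form hook times hook times \<open>M\<close>, where only a few entries
  survive.\<close>

lemma hook_cubic:
  fixes V :: "'a :: field mat set"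
  assumes V: "spec_space (Suc m) V" and two: "(2 :: 'a) \<noteq> 0" and three: "(3 :: 'a) \<noteq> 0"
    and h: "hook m i j A" and ij: "i < j" "j < m" and h': "hook m k l A'" and kl: "k < l" "l < m" 
    and A: "A \<in> V" and A': "A' \<in> V" and M: "M \<in> V"
  shows "(if j = k then M $$ (l, i) else 0) + A $$ (m, k) * M $$ (l, m)
     + ((if l = i then M $$ (j, k) else 0) + A' $$ (m, i) * M $$ (j, m)) = 0"
proof -
  note c = hookD(1)[OF h] hookD(1)[OF h'] spec_spaceD(1)[OF V M]
  have "mtr (Suc m) (A * (A' * M)) + mtr (Suc m) (A * (M * A')) = 0"
    by (rule trace_cubic[OF V two three A A' M mtr_hook[OF h ij(1)]])
  moreover have "mtr (Suc m) (A * (M * A')) = mtr (Suc m) (A' * (A * M))"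
    using c mtr_comm[of "A * M" "Suc m" A'] by simp
  ultimately show ?thesis
    using mtr_hook_hook_mult[OF h _ ij(2) h' _ kl(2) c(3)] mtr_hook_hook_mult[OF h' _ kl(2) h _ ij(2) c(3)] ij kl
    by simp
qed

text \<open>By the cubic trace identity the last row \<open>\<rho>\<^sub>i\<^sub>j\<close> of the hook at \<open>(i, j)\<close> is \<open>r\<^sub>i e\<^sub>j\<close> up to its
  entry at \<open>q\<close>, so a transvection removes everything but that entry.\<close>

lemma hook_rows:
  fixes V :: "'a :: field mat set"
  assumes V: "spec_space (Suc (Suc q)) V" and two: "(2 :: 'a) \<noteq> 0" and three: "(3 :: 'a) \<noteq> 0"
    and col: "full_last_col (Suc q) V"
    and H: "\<And>i j. i < j \<Longrightarrow> j < Suc q \<Longrightarrow> hook (Suc q) i j (H i j) \<and> H i j \<in> V"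
  shows "\<exists>r. \<forall>i j s. i < j \<longrightarrow> j \<le> q \<longrightarrow> s \<le> q \<longrightarrow> (j = q \<or> s < q) \<longrightarrow>
     H i j $$ (Suc q, s) = (if s = j then r i else 0)"
proof -
  let ?m = "Suc q"
  define \<rho> where "\<rho> i j s = H i j $$ (?m, s)" for i j s
  have cub: "(if j = k then M $$ (l, i) else 0) + \<rho> i j k * M $$ (l, ?m)
     + ((if l = i then M $$ (j, k) else 0) + \<rho> k l i * M $$ (j, ?m)) = 0"
    if "i < j" "j < ?m" "k < l" "l < ?m" "M \<in> V" for i j k l M
    unfolding \<rho>_def using H that
    by (intro hook_cubic[OF V two three, of i j "H i j" k l "H k l"]) auto
  have orth: "M $$ (j, i) + (\<Sum>s<?m. \<rho> i j s * M $$ (s, ?m)) = 0" if "i < j" "j < ?m" "M \<in> V" for i j M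
    unfolding \<rho>_def using H that by (intro hook_orthogonal[OF V two, of i j "H i j"]) auto
  have orth1: "M $$ (j, i) = - \<rho> i j k"
    if "i < j" "j < ?m" "M \<in> V" "k < ?m" "\<And>i. i < ?m \<Longrightarrow> M $$ (i, ?m) = (if i = k then 1 else 0)" for i j k M
  proof -
    have "(\<Sum>s<?m. \<rho> i j s * M $$ (s, ?m)) = (\<Sum>s<?m. if s = k then \<rho> i j k else 0)"
      using that(5) by (intro sum.cong) auto
    also have "\<dots> = \<rho> i j k" using that(4) by simp
    finally show ?thesis using orth[OF that(1-3)] by (simp add: eq_neg_iff_add_eq_0)
  qed
  \<comment> \<open>In \<open>cub\<close> and \<open>orth\<close> the last column of
    \<open>E\<close> selects the terms at \<open>q\<close>, the last index of the block.\<close>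
  obtain E where E: "E \<in> V" "\<And>i. i < ?m \<Longrightarrow> E $$ (i, ?m) = (if i = q then 1 else 0)"
    using col[unfolded full_last_col_def, rule_format, of "\<lambda>i. if i = q then 1 else 0"] by blast
  have R1: "\<rho> i j k = 0" if "i < j" "j < q" "k < q" "k \<noteq> j" for i j k
    using cub[of i j k q E] that E by simp
  \<comment> \<open>This antisymmetry and the symmetry \<open>R3\<close> together force the
    vanishing in \<open>R5\<close>.\<close>
  have R2: "\<rho> i q k + \<rho> k q i = 0" if "i < q" "k < q" for i k
    using cub[of i q k q E] that E by simp
  have R3: "\<rho> i q k = \<rho> k q i" if "i < k" "k < q" for i k
  proof -
    obtain M where M: "M \<in> V" "\<And>i. i < ?m \<Longrightarrow> M $$ (i, ?m) = (if i = k then 1 else 0)"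
      using col[unfolded full_last_col_def, rule_format, of "\<lambda>i. if i = k then 1 else 0"] by blast
    show ?thesis using cub[of i k k q M] orth1[of i q M k] M that by simp
  qed
  have R4: "\<rho> i k k = \<rho> i q q" if "i < k" "k < q" for i k
    using cub[of i k k q E] orth1[of i q E q] E that by simp
  have R5: "\<rho> i q k = 0" if "i < q" "k < q" for i k
  proof -
    have "\<rho> i q k = \<rho> k q i" using R3[of i k] R3[of k i] that by (cases i k rule: linorder_cases) auto
    then have "2 * \<rho> i q k = 0" using R2[OF that] by simp
    then show ?thesis using two by simp
  qed
  show ?thesis
  proof (intro exI[of _ "\<lambda>i. \<rho> i q q"] allI impI)
    fix i j s assume "i < j" "j \<le> q" "s \<le> q" "j = q \<or> s < q"
    then show "H i j $$ (?m, s) = (if s = j then \<rho> i q q else 0)"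
      unfolding \<rho>_def[symmetric] using R1[of i j s] R4[of i j] R5[of i s]
      by (cases "j = q"; cases "s = q"; cases "s = j") auto
  qed
qed

text \<open>For \<open>j < m\<close> the last column of a hook is zero, so conjugation by a
  transvection affects its last row only.\<close>

lemma hook_transv:
  assumes h: "hook m i j A" and ij: "i < m" "j < m" 
  shows "hook m i j (transv m r * A * transv m (\<lambda>i. - r i))"
    and "s < m \<Longrightarrow> (transv m r * A * transv m (\<lambda>i. - r i)) $$ (m, s) = A $$ (m, s) + (if s = j then r i else 0)"
proof -
  note D = hookD[OF h]
  have sum0: "(\<Sum>s<m. r s * A $$ (s, m)) = 0" using ij by (intro sum.neutral) (auto simp: D(3))
  have sumj: "(\<Sum>k<m. r k * A $$ (k, s)) = (if s = j then r i else 0)" if "s < m" for s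
  proof -
    have "(\<Sum>k<m. r k * A $$ (k, s)) = (\<Sum>k<m. if k = i then (if s = j then r i else 0) else 0)"
      using that by (intro sum.cong) (auto simp: D(3))
    then show ?thesis using ij by simp
  qed
  let ?B = "transv m r * A * transv m (\<lambda>i. - r i)"
  have "?B $$ (k, l) = A $$ (k, l)" if "k < m" "l \<le> m" for k l
    using transv_conj_index(1)[OF D(1), of k l r] transv_conj_index(2)[OF D(1), of k r] that ij by (cases "l = m") (auto simp: D(3))
  then show "hook m i j ?B"
    using D transv_conj_index(4)[OF D(1), of r] sum0 by (auto simp: hook_def)
  show "s < m \<Longrightarrow> ?B $$ (m, s) = A $$ (m, s) + (if s = j then r i else 0)"
    using transv_conj_index(3)[OF D(1), of s r] sum0 sumj[of s] D(2) by simp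
qed

text \<open>By \<open>H0\<close> each \<open>H i j\<close> is an exact matrix unit. Orthogonality to
  these clears the entries below the diagonal in the rows up to \<open>q\<close>, the cubic identity
  clears the last row left of \<open>q\<close>, and the remaining last 2 x 2 blocks have a common
  eigenvector.\<close>

lemma triangularizable_of_units:
  fixes V :: "'a :: field mat set"
  assumes V: "spec_space (Suc (Suc q)) V" and two: "(2 :: 'a) \<noteq> 0" and three: "(3 :: 'a) \<noteq> 0"
    and col: "full_last_col (Suc q) V"
    and H: "\<And>i j. i < j \<Longrightarrow> j < Suc q \<Longrightarrow> hook (Suc q) i j (H i j) \<and> H i j \<in> V"
    and H0: "\<And>i j s. i < j \<Longrightarrow> j \<le> q \<Longrightarrow> s \<le> q \<Longrightarrow> H i j $$ (Suc q, s) = 0"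
  shows "triangularizable (Suc (Suc q)) V"
proof -
  let ?m = "Suc q" and ?n = "Suc (Suc q)"
  note D = spec_spaceD[OF V]
  have low: "M $$ (j, i) = 0" if "i < j" "j \<le> q" "M \<in> V" for i j M
  proof -
    have "(\<Sum>s<?m. H i j $$ (?m, s) * M $$ (s, ?m)) = 0"
      using that H0 by (intro sum.neutral) auto
    then show ?thesis
      using hook_orthogonal[OF V two, of i j "H i j" M] H[of i j] that by simp
  qed
  \<comment> \<open>The trace of the unit at \<open>(i, q)\<close> times \<open>M N\<close> is the
    \<open>(q, i)\<close> entry of \<open>M N\<close>; by \<open>low\<close> only the summand
    through the last index survives.\<close>
  have cub: "M $$ (q, ?m) * N $$ (?m, i) + N $$ (q, ?m) * M $$ (?m, i) = 0" if "i < q" "M \<in> V" "N \<in> V" for i M N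
  proof -
    note h = H[of i q, THEN conjunct1] and hV = H[of i q, THEN conjunct2]
    have e: "mtr ?n (H i q * (M * N)) = M $$ (q, ?m) * N $$ (?m, i)" if MN: "M \<in> V" "N \<in> V" for M N
    proof -
      note c = D(1)[OF MN(1)] D(1)[OF MN(2)]
      have "(\<Sum>s<?m. H i q $$ (?m, s) * (M * N) $$ (s, ?m)) = 0"
        using \<open>i < q\<close> H0 by (intro sum.neutral) auto
      then have "mtr ?n (H i q * (M * N)) = (M * N) $$ (q, i)"
        using mtr_hook_mult[OF h, of "M * N"] c \<open>i < q\<close> by simp
      also have "\<dots> = (\<Sum>s<?n. M $$ (q, s) * N $$ (s, i))"
        using c \<open>i < q\<close> by (intro index_mult_mat_sum[of _ ?n _ _ ?n]) auto
      also have "\<dots> = (\<Sum>s<q. M $$ (q, s) * N $$ (s, i)) + M $$ (q, q) * N $$ (q, i) + M $$ (q, ?m) * N $$ (?m, i)"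
        by simp
      also have "(\<Sum>s<q. M $$ (q, s) * N $$ (s, i)) = 0"
        using low MN by (intro sum.neutral) auto
      also have "N $$ (q, i) = 0" using low MN \<open>i < q\<close> by auto
      finally show ?thesis by simp
    qed
    have "mtr ?n (H i q * (M * N)) + mtr ?n (H i q * (N * M)) = 0"
      by (rule trace_cubic[OF V two three hV that(2,3) mtr_hook[OF h]]) (use that in auto)
    then show ?thesis using e that by simp
  qed
  obtain E where E: "E \<in> V" "E $$ (q, ?m) = 1"
    using col[unfolded full_last_col_def, rule_format, of "\<lambda>_. 1"] by auto
  \<comment> \<open>Pairing \<open>E\<close> with itself clears its last row left of
    \<open>q\<close>; pairing it with \<open>M\<close> then does the same for
    \<open>M\<close>.\<close>
  have "E $$ (?m, i) = 0" if "i < q" for i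
  proof -
    have "2 * E $$ (?m, i) = 0" using cub[OF that E(1) E(1)] E(2) by simp
    then show ?thesis using two by simp
  qed
  then have bot: "M $$ (?m, i) = 0" if "i < q" "M \<in> V" for i M
    using cub[OF that(1) E(1) that(2)] E(2) that(1) by simp
  define Z where "Z a b c d \<longleftrightarrow> (\<exists>M\<in>V. a = M $$ (q, q) \<and> b = M $$ (q, ?m) \<and> c = M $$ (?m, q) \<and> d = M $$ (?m, ?m))" for a b c d
  have "\<exists>u v. (u, v) \<noteq> (0, 0) \<and> (\<forall>a b c d. Z a b c d \<longrightarrow> (a * u + b * v) * v = (c * u + d * v) * u)"
  proof (rule common_eigenvector_2x2[OF two])
    fix a b c d a' b' c' d' assume "Z a b c d" "Z a' b' c' d'"
    then obtain M N where MN: "M \<in> V" "N \<in> V" 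
      "a = M $$ (q, q)" "b = M $$ (q, ?m)" "c = M $$ (?m, q)" "d = M $$ (?m, ?m)"
      "a' = N $$ (q, q)" "b' = N $$ (q, ?m)" "c' = N $$ (?m, q)" "d' = N $$ (?m, ?m)" by (auto simp: Z_def)
    have "M + N \<in> V" using MN D by simp
    then show "Z (a + a') (b + b') (c + c') (d + d')"
      unfolding Z_def using MN D(1)[OF MN(1)] D(1)[OF MN(2)] by (intro bexI[of _ "M + N"]) auto
  next
    fix t a b c d assume "Z a b c d"
    then obtain M where M: "M \<in> V" 
      "a = M $$ (q, q)" "b = M $$ (q, ?m)" "c = M $$ (?m, q)" "d = M $$ (?m, ?m)" by (auto simp: Z_def)
    have "t \<cdot>\<^sub>m M \<in> V" using M D by simp
    then show "Z (t * a) (t * b) (t * c) (t * d)"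
      unfolding Z_def using M D(1)[OF M(1)] by (intro bexI[of _ "t \<cdot>\<^sub>m M"]) auto
  next
    fix a b c d assume "Z a b c d"
    then obtain M where M: "M \<in> V" 
      "a = M $$ (q, q)" "b = M $$ (q, ?m)" "c = M $$ (?m, q)" "d = M $$ (?m, ?m)" by (auto simp: Z_def)
    have "amo (botright q 2 M)"
    proof (rule amo_block_upper)
      show "M $$ (i, j) = 0" if "q \<le> i" "i < q + 2" "j < q" for i j
      proof -
        have "i = q \<or> i = ?m" using that by auto
        then show ?thesis using that low[of j q M] bot[of j M] M(1) by auto
      qed
    qed (use D M in auto)
    from amo_2x2[OF botright_carrier this two]
    show "a * d - b * c = 0 \<or> (a + d)\<^sup>2 = 4 * (a * d - b * c)"
      by (simp add: botright_def M)
  qed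
  then obtain u v where uv: "(u, v) \<noteq> (0, 0)" 
    "\<And>a b c d. Z a b c d \<Longrightarrow> (a * u + b * v) * v = (c * u + d * v) * u" by blast
  \<comment> \<open>For \<open>u = 0\<close> the second unit vector would be an eigenvector of the
    block of \<open>E\<close>, whose upper right entry is 1. So the eigenvector can be scaled to
    \<open>(1, y)\<close>.\<close>
  have "u \<noteq> 0"
  proof
    assume "u = 0"
    have "Z (E $$ (q, q)) 1 (E $$ (?m, q)) (E $$ (?m, ?m))" using E by (auto simp: Z_def)
    from uv(2)[OF this] show False using \<open>u = 0\<close> uv(1) by simp
  qed
  define y where "y = v * inverse u"
  have v: "v = y * u" using \<open>u \<noteq> 0\<close> by (simp add: y_def mult.assoc)
  have ev: "(M $$ (q, q) + M $$ (q, ?m) * y) * y = M $$ (?m, q) + M $$ (?m, ?m) * y" if "M \<in> V" for M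
  proof -
    have "Z (M $$ (q, q)) (M $$ (q, ?m)) (M $$ (?m, q)) (M $$ (?m, ?m))" using that by (auto simp: Z_def)
    from uv(2)[OF this]
    have "(u * u) * ((M $$ (q, q) + M $$ (q, ?m) * y) * y) = (u * u) * (M $$ (?m, q) + M $$ (?m, ?m) * y)"
      unfolding v by (simp add: algebra_simps)
    then show ?thesis using \<open>u \<noteq> 0\<close> by simp
  qed
  \<comment> \<open>This transvection subtracts \<open>y\<close> times row \<open>q\<close> from the
    last row and carries \<open>(1, y)\<close> to \<open>(1, 0)\<close>.\<close>
  define r where "r i = (if i = q then - y else 0)" for i
  show ?thesis unfolding triangularizable_def
  proof (rule exI[of _ "transv ?m r"], rule exI[of _ "transv ?m (\<lambda>i. - r i)"], intro conjI ballI allI impI)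
    show "inv_pair ?n (transv ?m r) (transv ?m (\<lambda>i. - r i))" by (rule inv_pair_transv)
    fix M i j assume M: "M \<in> V" and ij: "j < i" "i < ?n"
    note Mc = D(1)[OF M]
    have sm: "(\<Sum>s<?m. r s * M $$ (s, k)) = - y * M $$ (q, k)" for k
    proof -
      have "(\<Sum>s<?m. r s * M $$ (s, k)) = (\<Sum>s<?m. if s = q then - y * M $$ (q, k) else 0)"
        by (intro sum.cong) (auto simp: r_def)
      then show ?thesis by simp
    qed
    show "(transv ?m r * M * transv ?m (\<lambda>i. - r i)) $$ (i, j) = 0"
    proof (cases "i = ?m")
      case True
      have jm: "j < ?m" using ij True by simp
      have N: "(transv ?m r * M * transv ?m (\<lambda>i. - r i)) $$ (?m, j)
         = - y * M $$ (q, j) + M $$ (?m, j) - (- y * M $$ (q, ?m) + M $$ (?m, ?m)) * r j"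
        using transv_conj_index(3)[OF Mc jm, of r] unfolding sm .
      show ?thesis
      proof (cases "j = q")
        case True
        have "- y * M $$ (q, q) + M $$ (?m, q) - (- y * M $$ (q, ?m) + M $$ (?m, ?m)) * (- y) = 
           M $$ (?m, q) + M $$ (?m, ?m) * y - (M $$ (q, q) + M $$ (q, ?m) * y) * y"
          by (simp add: algebra_simps)
        then show ?thesis using N ev[OF M] \<open>i = ?m\<close> True by (simp add: r_def)
      next
        case False
        then have "j < q" using jm by simp
        then show ?thesis using N low[of j q M] bot[of j M] M \<open>i = ?m\<close> by (simp add: r_def)
      qed
    next
      case False
      then have "i \<le> q" "j < q" using ij by auto
      then show ?thesis using transv_conj_index(1)[OF Mc, of i j r] low[of j i M] M ij by (simp add: r_def)
    qed
  qed
qed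

text \<open>A nonzero entry \<open>\<sigma>\<close> would produce an affine line of \<open>2 \<times> 2\<close> blocks with constant trace and
  arbitrary determinant.\<close>

lemma hook_last_entry_zero:
  fixes V :: "'a :: field mat set"
  assumes V: "spec_space (Suc (Suc q)) V" and two: "(2 :: 'a) \<noteq> 0"
    and col: "full_last_col (Suc q) V"
    and H: "\<And>i j. i < j \<Longrightarrow> j < Suc q \<Longrightarrow> hook (Suc q) i j (H i j) \<and> H i j \<in> V"
    and H0: "\<And>i j s. i < j \<Longrightarrow> j \<le> q \<Longrightarrow> s \<le> q \<Longrightarrow> j = q \<or> s < q \<Longrightarrow> H i j $$ (Suc q, s) = 0"
    and ij: "i < j" "j \<le> q"
  shows "H i j $$ (Suc q, q) = 0"
proof (rule ccontr)
  let ?m = "Suc q" and ?n = "Suc (Suc q)"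
  define \<sigma> where "\<sigma> = H i j $$ (?m, q)"
  assume "H i j $$ (?m, q) \<noteq> 0"
  then have \<sigma>: "\<sigma> \<noteq> 0" by (simp add: \<sigma>_def)
  with H0[of i j q] ij have jq: "j < q" by (cases "j = q") (auto simp: \<sigma>_def)
  note D = spec_spaceD[OF V]
  \<comment> \<open>Hooks at \<open>(p, q)\<close> successively clear column \<open>q\<close> above
    row \<open>q\<close> and keep the last column above the corner. For \<open>p = q\<close> the
    last 2 x 2 block splits off.\<close>
  have "\<exists>M\<in>V. (\<forall>l\<le>q. M $$ (l, ?m) = (if l = q then 1 else 0)) \<and> (\<forall>l<p. M $$ (l, q) = 0)" if "p \<le> q" for p
    using that
  proof (induction p)
    case 0
    obtain M where "M \<in> V" "\<forall>l<?m. M $$ (l, ?m) = (if l = q then 1 else 0)"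
      using col[unfolded full_last_col_def, rule_format, of "\<lambda>l. if l = q then 1 else 0"] by blast
    then show ?case by (intro bexI[of _ M]) auto
  next
    case (Suc p)
    then obtain M where M: "M \<in> V" "\<And>l. l \<le> q \<Longrightarrow> M $$ (l, ?m) = (if l = q then 1 else 0)" 
      "\<And>l. l < p \<Longrightarrow> M $$ (l, q) = 0" by auto
    have h: "hook ?m p q (H p q)" "H p q \<in> V" using H[of p q] Suc.prems by auto
    define N where "N = M + (- M $$ (p, q)) \<cdot>\<^sub>m H p q"
    have N: "N \<in> V" using D M(1) h(2) by (simp add: N_def)
    have Ni: "N $$ (k, l) = M $$ (k, l) - M $$ (p, q) * (if k = p \<and> l = q then 1 else 0)" if "k \<le> q" "l \<le> ?m" for k l
    proof -
      have "N $$ (k, l) = M $$ (k, l) - M $$ (p, q) * H p q $$ (k, l)"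
        using that D(1)[OF M(1)] hookD(1)[OF h(1)] by (simp add: N_def)
      then show ?thesis using hookD(3)[OF h(1), of k l] that by simp
    qed
    have "N $$ (l, ?m) = (if l = q then 1 else 0)" if "l \<le> q" for l using Ni[of l ?m] M(2)[of l] that by simp
    moreover have "N $$ (l, q) = 0" if "l < Suc p" for l 
      using Ni[of l q] M(3)[of l] that Suc.prems by (cases "l = p") auto
    ultimately show ?case using N by (intro bexI[of _ N]) auto
  qed
  from this[of q] obtain M where M: "M \<in> V" "\<And>l. l \<le> q \<Longrightarrow> M $$ (l, ?m) = (if l = q then 1 else 0)" 
    "\<And>l. l < q \<Longrightarrow> M $$ (l, q) = 0" by auto
  have h: "hook ?m i j (H i j)" "H i j \<in> V" using H[of i j] ij by auto
  let ?\<tau> = "M $$ (q, q) + M $$ (?m, ?m)"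
  obtain e where e: "e \<noteq> 0" "?\<tau> ^ 2 \<noteq> 4 * e" using ex_det_not_admissible[OF two] by blast
  \<comment> \<open>As \<open>j < q\<close>, adding \<open>t\<close> times the hook changes only the
    lower left entry of the last block; this \<open>t\<close> gives the block the forbidden
    determinant \<open>e\<close>.\<close>
  define t where "t = (M $$ (q, q) * M $$ (?m, ?m) - M $$ (?m, q) - e) * inverse \<sigma>"
  have t: "t * \<sigma> = M $$ (q, q) * M $$ (?m, ?m) - M $$ (?m, q) - e" using \<sigma> by (simp add: t_def mult.assoc)
  define N where "N = M + t \<cdot>\<^sub>m H i j"
  have N: "N \<in> V" using D M(1) h(2) by (simp add: N_def)
  have Nc: "N \<in> carrier_mat (q + 2) (q + 2)" using D(1)[OF N] by simp
  have Ni: "N $$ (k, l) = M $$ (k, l) + t * H i j $$ (k, l)" if "k \<le> ?m" "l \<le> ?m" for k l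
    using that D(1)[OF M(1)] hookD(1)[OF h(1)] by (simp add: N_def)
  have "amo (botright q 2 N)"
  proof (rule amo_block_lower(2)[OF Nc D(2)[OF N]])
    fix k l assume kl: "k < q" "q \<le> l" "l < q + 2"
    then have "l = q \<or> l = ?m" by auto
    then show "N $$ (k, l) = 0"
      using Ni[of k l] hookD(3)[OF h(1), of k l] M(2)[of k] M(3)[of k] kl jq by auto
  qed
  from amo_2x2[OF botright_carrier this two]
  have "N $$ (q, q) * N $$ (?m, ?m) - N $$ (q, ?m) * N $$ (?m, q) = 0 \<or>
     (N $$ (q, q) + N $$ (?m, ?m)) ^ 2 = 4 * (N $$ (q, q) * N $$ (?m, ?m) - N $$ (q, ?m) * N $$ (?m, q))"
    by (simp add: botright_def)
  moreover have "N $$ (q, q) = M $$ (q, q)" "N $$ (?m, ?m) = M $$ (?m, ?m)" "N $$ (q, ?m) = 1"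
      "N $$ (?m, q) = M $$ (?m, q) + t * \<sigma>"
    using Ni[of q q] Ni[of ?m ?m] Ni[of q ?m] Ni[of ?m q] hookD(2)[OF h(1)] hookD(3)[OF h(1), of q q] 
      hookD(3)[OF h(1), of q ?m] M(2)[of q] jq ij by (auto simp: \<sigma>_def)
  moreover have "M $$ (q, q) * M $$ (?m, ?m) - 1 * (M $$ (?m, q) + t * \<sigma>) = e" unfolding t by simp
  ultimately show False using e by (simp only:) blast
qed

text \<open>The transvection with \<open>- r\<close> cancels the rows found in
  \<open>hook_rows\<close> up to the entry at \<open>q\<close>, which
  \<open>hook_last_entry_zero\<close> excludes. The hooks are then matrix units.\<close>

lemma triangularizable_of_hooks:
  fixes V :: "'a :: field mat set"
  assumes V: "spec_space (Suc m) V" and two: "(2 :: 'a) \<noteq> 0" and three: "(3 :: 'a) \<noteq> 0" and m: "m > 0"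
    and col: "full_last_col m V"
    and ex: "\<And>i j. i < j \<Longrightarrow> j < m \<Longrightarrow> \<exists>A\<in>V. hook m i j A"
  shows "triangularizable (Suc m) V"
proof -
  obtain q where q: "m = Suc q" using m by (cases m) auto
  note V = V[unfolded q] and col = col[unfolded q] and ex = ex[unfolded q]
  let ?m = "Suc q" and ?n = "Suc (Suc q)"
  note D = spec_spaceD[OF V]
  define H where "H i j = (SOME A. A \<in> V \<and> hook ?m i j A)" for i j
  have H: "hook ?m i j (H i j) \<and> H i j \<in> V" if "i < j" "j < ?m" for i j
    using someI_ex[of "\<lambda>A. A \<in> V \<and> hook ?m i j A"] ex[OF that] unfolding H_def by blast
  obtain r where r: "\<And>i j s. i < j \<Longrightarrow> j \<le> q \<Longrightarrow> s \<le> q \<Longrightarrow> j = q \<or> s < q \<Longrightarrow>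
     H i j $$ (?m, s) = (if s = j then r i else 0)"
    using hook_rows[OF V two three col H] by blast
  define P where "P = transv ?m (\<lambda>i. - r i)"
  define Q where "Q = transv ?m r"
  have PQ: "inv_pair ?n P Q" unfolding P_def Q_def by (rule inv_pair_sym[OF inv_pair_transv])
  have PQ_conj: "P * A * Q = transv ?m (\<lambda>i. - r i) * A * transv ?m (\<lambda>i. - (- r i))" for A
    by (simp add: P_def Q_def)
  define W where "W = (\<lambda>A. P * A * Q) ` V"
  have W: "spec_space ?n W" unfolding W_def by (rule spec_space_conj(1)[OF PQ V])
  define K where "K i j = P * H i j * Q" for i j
  have K: "hook ?m i j (K i j) \<and> K i j \<in> W" if "i < j" "j < ?m" for i j
    using H[OF that] hook_transv(1)[of ?m i j "H i j" "\<lambda>i. - r i"] that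
    unfolding K_def W_def PQ_conj by auto
  have K0: "K i j $$ (?m, s) = 0" if "i < j" "j \<le> q" "s \<le> q" "j = q \<or> s < q" for i j s
    using hook_transv(2)[of ?m i j "H i j" s "\<lambda>i. - r i"] H[of i j] r[OF that] that
    unfolding K_def PQ_conj by simp
  have colW: "full_last_col ?m W" unfolding full_last_col_def
  proof
    fix c :: "nat \<Rightarrow> 'a"
    obtain M where M: "M \<in> V" "\<And>i. i < ?m \<Longrightarrow> M $$ (i, ?m) = c i"
      using col[unfolded full_last_col_def, rule_format, of c] by blast
    have "(P * M * Q) $$ (i, ?m) = c i" if "i < ?m" for i
      using transv_conj_index(2)[OF D(1)[OF M(1)] that, of "\<lambda>i. - r i"] M(2)[OF that] unfolding PQ_conj by simp
    then show "\<exists>M\<in>W. \<forall>i<?m. M $$ (i, ?m) = c i" using M(1) by (auto simp: W_def)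
  qed
  have "K i j $$ (?m, s) = 0" if "i < j" "j \<le> q" "s \<le> q" for i j s
    using hook_last_entry_zero[OF W two colW K K0 that(1,2)] K0[OF that] that(3) by (cases "s = q") auto
  from triangularizable_of_units[OF W two three colW K this]
  have "triangularizable ?n W" .
  then show ?thesis unfolding q W_def
    by (rule triangularizable_conjD[OF PQ, rotated]) (use D in auto)
qed

section \<open>Nilpotent spaces and scalar matrices\<close>

definition nil_mat :: "'a :: field mat \<Rightarrow> bool" where
  "nil_mat A \<longleftrightarrow> (\<forall>x. eigenvalue (map_mat to_ac A) x \<longrightarrow> x = 0)"

definition add_scalars :: "nat \<Rightarrow> 'a :: field mat set \<Rightarrow> 'a mat set" where
  "add_scalars n U = {c \<cdot>\<^sub>m 1\<^sub>m n + A | c A. A \<in> U}"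

lemma add_scalar_add:
  assumes "A \<in> carrier_mat n n" "B \<in> carrier_mat n n"
  shows "(c \<cdot>\<^sub>m 1\<^sub>m n + A) + (d \<cdot>\<^sub>m 1\<^sub>m n + B) = (c + d) \<cdot>\<^sub>m 1\<^sub>m n + (A + B :: 'a :: field mat)"
  by (rule eq_matI) (use assms in \<open>simp_all del: assoc_add_mat\<close>)

lemma add_scalar_smult:
  assumes "A \<in> carrier_mat n n"
  shows "t \<cdot>\<^sub>m (c \<cdot>\<^sub>m 1\<^sub>m n + A) = (t * c) \<cdot>\<^sub>m 1\<^sub>m n + t \<cdot>\<^sub>m (A :: 'a :: field mat)"
  by (rule eq_matI) (use assms in \<open>simp_all add: distrib_left del: assoc_add_mat\<close>)

lemma eigenvalue_add_scalar:
  fixes A :: "'a :: field mat"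
  assumes A: "A \<in> carrier_mat n n" and e: "eigenvalue (map_mat to_ac (c \<cdot>\<^sub>m 1\<^sub>m n + A)) x"
  shows "eigenvalue (map_mat to_ac A) (x - to_ac c)"
proof -
  let ?A = "map_mat to_ac A"
  have A': "?A \<in> carrier_mat n n" using A by simp
  have m: "map_mat to_ac (c \<cdot>\<^sub>m 1\<^sub>m n + A) = to_ac c \<cdot>\<^sub>m 1\<^sub>m n + ?A"
    using A by (intro eq_matI) auto
  have "char_matrix (to_ac c \<cdot>\<^sub>m 1\<^sub>m n + ?A) x = char_matrix ?A (x - to_ac c)"
    using A by (intro eq_matI) (auto simp: char_matrix_def algebra_simps)
  moreover have "to_ac c \<cdot>\<^sub>m 1\<^sub>m n + ?A \<in> carrier_mat n n" using A' by auto
  ultimately show ?thesis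
    using e eigenvalue_det[OF A'] eigenvalue_det[of "to_ac c \<cdot>\<^sub>m 1\<^sub>m n + ?A" n] unfolding m by metis
qed

text \<open>The only possible eigenvalue of \<open>c\<close> times the identity plus a nilpotent
  matrix is \<open>c\<close>, and the identity is not nilpotent. So a bound for
  \<open>spec_space\<close> yields one that is smaller by 1 for nilpotent spaces.\<close>

lemma add_scalars:
  fixes U :: "'a :: field mat set"
  assumes U: "msub n n U" and nil: "\<And>A. A \<in> U \<Longrightarrow> nil_mat A" and n: "n > 0"
  shows "spec_space n (add_scalars n U)" "mdim n n U < mdim n n (add_scalars n U)"
proof -
  have UC: "A \<in> carrier_mat n n" if "A \<in> U" for A using U that by (auto simp: msub_def)
  have mU: "msub n n (add_scalars n U)"
    unfolding msub_def
  proof (intro conjI ballI allI)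
    show "add_scalars n U \<subseteq> carrier_mat n n" using UC by (auto simp: add_scalars_def)
    have "0\<^sub>m n n = 0 \<cdot>\<^sub>m 1\<^sub>m n + (0\<^sub>m n n :: 'a mat)" by (intro eq_matI) auto
    then show "0\<^sub>m n n \<in> add_scalars n U" using U unfolding add_scalars_def msub_def by blast
    fix A assume "A \<in> add_scalars n U"
    then obtain c A' where A: "A = c \<cdot>\<^sub>m 1\<^sub>m n + A'" "A' \<in> U" unfolding add_scalars_def by blast
    show "A + B \<in> add_scalars n U" if Bs: "B \<in> add_scalars n U" for B
    proof -
      obtain d B' where B: "B = d \<cdot>\<^sub>m 1\<^sub>m n + B'" "B' \<in> U" using Bs unfolding add_scalars_def by blast
      have "A + B = (c + d) \<cdot>\<^sub>m 1\<^sub>m n + (A' + B')" unfolding A(1) B(1)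
        by (rule add_scalar_add[OF UC[OF A(2)] UC[OF B(2)]])
      moreover have "A' + B' \<in> U" using A(2) B(2) U unfolding msub_def by blast
      ultimately show ?thesis unfolding add_scalars_def by blast
    qed
    show "t \<cdot>\<^sub>m A \<in> add_scalars n U" for t
    proof -
      have "t \<cdot>\<^sub>m A = (t * c) \<cdot>\<^sub>m 1\<^sub>m n + t \<cdot>\<^sub>m A'" unfolding A(1)
        by (rule add_scalar_smult[OF UC[OF A(2)]])
      moreover have "t \<cdot>\<^sub>m A' \<in> U" using A(2) U unfolding msub_def by blast
      ultimately show ?thesis unfolding add_scalars_def by blast
    qed
  qed
  have "amo A" if As: "A \<in> add_scalars n U" for A
  proof -
    obtain c A' where A: "A = c \<cdot>\<^sub>m 1\<^sub>m n + A'" "A' \<in> U" using As unfolding add_scalars_def by blast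
    have "x = to_ac c" if "eigenvalue (map_mat to_ac A) x" for x
      using eigenvalue_add_scalar[OF UC[OF A(2)]] nil[OF A(2)] that unfolding A nil_mat_def by fastforce
    then show ?thesis by (auto simp: at_most_one_nonzero_eigenvalue_def)
  qed
  with mU show "spec_space n (add_scalars n U)" by (simp add: spec_space_def)
  have sub: "U \<subseteq> add_scalars n U"
  proof
    fix A assume A: "A \<in> U"
    have "A = 0 \<cdot>\<^sub>m 1\<^sub>m n + A" using UC[OF A] by (intro eq_matI) auto
    then show "A \<in> add_scalars n U" using A unfolding add_scalars_def by blast
  qed
  have one: "1\<^sub>m n \<in> add_scalars n U"
  proof -
    have "1\<^sub>m n = 1 \<cdot>\<^sub>m 1\<^sub>m n + (0\<^sub>m n n :: 'a mat)" by (intro eq_matI) auto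
    then show ?thesis using U unfolding add_scalars_def msub_def by blast
  qed
  have "1\<^sub>m n \<notin> U"
  proof
    assume "1\<^sub>m n \<in> U"
    moreover have "eigenvalue (map_mat to_ac (1\<^sub>m n :: 'a mat)) 1"
      using n by (subst eigenvalue_upper_triangular[of _ n]) auto
    ultimately show False using nil unfolding nil_mat_def by (metis one_neq_zero)
  qed
  then have "U \<noteq> add_scalars n U" using one by blast
  then show "mdim n n U < mdim n n (add_scalars n U)"
    using mdim_mono[OF U mU sub] mdim_eqD[OF U mU sub] by linarith
qed

section \<open>Triangular spaces of maximal dimension\<close>

lemma NT_msub: "msub n n (NT n)"
  by (auto simp: msub_def NT_def)

lemma NT_nil: "A \<in> NT n \<Longrightarrow> nil_mat A"
  unfolding nil_mat_def
  by (subst eigenvalue_upper_triangular[of _ n]) (auto simp: NT_def)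

text \<open>The bound applied to \<open>NT n\<close> plus scalars limits the dimension of
  \<open>NT n\<close>, so some member of \<open>V\<close> has a nonzero diagonal entry, at
  \<open>i0\<close> say. Members vanishing at \<open>(i0, i0)\<close> have zero diagonal; they form
  a space of codimension at most 1, which must be all of \<open>NT n\<close>. One further matrix
  supplies the diagonal of \<open>D_mat n I\<close>.\<close>

lemma upper_triangular_eq_V1star:
  fixes V :: "'a :: field mat set"
  assumes bound: "\<And>U :: 'a mat set. spec_space n U \<Longrightarrow> mdim n n U \<le> (n choose 2) + 1"
    and two: "(2 :: 'a) \<noteq> 0" and n: "n > 0" and V: "spec_space n V" and dim: "mdim n n V = (n choose 2) + 1"
    and ut: "\<And>A i j. A \<in> V \<Longrightarrow> j < i \<Longrightarrow> i < n \<Longrightarrow> A $$ (i, j) = 0"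
  shows "\<exists>I. I \<noteq> {} \<and> I \<subseteq> {0..<n} \<and> V = V1star n I"
proof -
  note D = spec_spaceD[OF V]
  have NTd: "mdim n n (NT n :: 'a mat set) \<le> n choose 2"
    using add_scalars(2)[OF NT_msub NT_nil[of _ n] n, where ?'a = 'a] bound[OF add_scalars(1)[OF NT_msub NT_nil[of _ n] n]]
    by linarith
  have "\<exists>A\<in>V. \<exists>i<n. A $$ (i, i) \<noteq> 0"
  proof (rule ccontr)
    assume "\<not> ?thesis"
    then have "V \<subseteq> NT n" using D(1) ut by (fastforce simp: NT_def le_less)
    from mdim_mono[OF D(6) NT_msub this] NTd dim show False by simp
  qed
  then obtain A0 i0 where A0: "A0 \<in> V" "i0 < n" "A0 $$ (i0, i0) \<noteq> 0" by blast
  define A where "A = inverse (A0 $$ (i0, i0)) \<cdot>\<^sub>m A0"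
  have A: "A \<in> V" using A0 D by (simp add: A_def)
  have Ai: "A $$ (i0, i0) = 1" using A0 D(1)[OF A0(1)] by (simp add: A_def)
  define I where "I = {i. i < n \<and> A $$ (i, i) \<noteq> 0}"
  have diagA: "A $$ (i, i) = (if i \<in> I then 1 else 0)" if "i < n" for i
    using amo_triangular_diag[OF D(1)[OF A] D(2)[OF A] ut[OF A] that A0(2)] that Ai by (auto simp: I_def)
  have i0: "i0 \<in> I" using A0(2) Ai by (simp add: I_def)
  have diag0: "M $$ (i, i) = 0" if M: "M \<in> V" "M $$ (i0, i0) = 0" and i: "i < n" for M i
  proof (rule ccontr)
    assume ne: "M $$ (i, i) \<noteq> 0"
    \<comment> \<open>The entry of \<open>M + t A\<close> at \<open>(i0, i0)\<close> is
      \<open>t\<close>, so every diagonal entry is 0 or \<open>t\<close>. For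
      \<open>i \<in> I\<close> taking \<open>t\<close> to be the entry of \<open>M\<close> itself is
      contradictory; otherwise \<open>t = 1\<close> and \<open>t = - 1\<close> are.\<close>
    have *: "M $$ (i, i) + t * A $$ (i, i) = 0 \<or> M $$ (i, i) + t * A $$ (i, i) = t" if "t \<noteq> 0" for t
    proof -
      have N: "M + t \<cdot>\<^sub>m A \<in> V" using D M(1) A by simp
      show ?thesis
        using amo_triangular_diag[OF D(1)[OF N] D(2)[OF N] ut[OF N] i A0(2)] that M D(1)[OF M(1)] D(1)[OF A] i A0(2) Ai
        by auto
    qed
    have m1: "(1 :: 'a) \<noteq> - 1" using two by (metis add.left_inverse one_add_one)
    show False
    proof (cases "i \<in> I")
      case True
      have "M $$ (i, i) + M $$ (i, i) = 0 \<or> M $$ (i, i) + M $$ (i, i) = M $$ (i, i)"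
        using *[OF ne] diagA[OF i] True by simp
      then have "2 * M $$ (i, i) = 0" using ne unfolding mult_2 by (metis add_cancel_right_right)
      then show False using two ne by simp
    next
      case False
      then have "M $$ (i, i) = 1" "M $$ (i, i) = - 1" using *[of 1] *[of "- 1"] diagA[OF i] ne by auto
      then show False using m1 by simp
    qed
  qed
  define f :: "'a mat \<Rightarrow> 'a mat" where "f M = mat 1 1 (\<lambda>_. M $$ (i0, i0))" for M
  have f0: "f M = 0\<^sub>m 1 1 \<longleftrightarrow> M $$ (i0, i0) = 0" for M
    by (auto simp: f_def mat_eq_iff)
  have fl: "mlin n n 1 1 V f"
    unfolding mlin_def
  proof (intro conjI ballI allI)
    show "f (M + N) = f M + f N" if "M \<in> V" "N \<in> V" for M N
      using that D(1)[OF that(1)] D(1)[OF that(2)] A0(2) by (intro eq_matI) (auto simp: f_def)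
    show "f (t \<cdot>\<^sub>m M) = t \<cdot>\<^sub>m f M" if "M \<in> V" for t M
      using D(1)[OF that] A0(2) by (intro eq_matI) (auto simp: f_def)
  qed (auto simp: f_def)
  let ?K = "{M \<in> V. f M = 0\<^sub>m 1 1}"
  have Ks: "msub n n ?K" by (rule mlin_ker[OF D(6) fl])
  have KNT: "?K \<subseteq> NT n"
  proof
    fix M assume "M \<in> ?K"
    then have M: "M \<in> V" "M $$ (i0, i0) = 0" using f0 by blast+
    then have "M $$ (i, j) = 0" if "i < n" "j \<le> i" for i j
      using that diag0[OF M, of i] ut[of M j i] by (cases "i = j") auto
    then show "M \<in> NT n" using D(1)[OF M(1)] by (simp add: NT_def)
  qed
  have "mdim 1 1 (f ` V) \<le> 1" using mdim_le[OF mlin_image[OF D(6) fl]] by simp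
  then have "mdim n n ?K \<ge> n choose 2" using rank_nullity[OF D(6) fl] dim by simp
  then have "mdim n n ?K = mdim n n (NT n :: 'a mat set)" using mdim_mono[OF Ks NT_msub KNT] NTd by simp
  then have K: "?K = NT n" by (rule mdim_eqD[OF Ks NT_msub KNT])
  have "V = V1star n I"
  proof (intro equalityI subsetI)
    fix M assume M: "M \<in> V"
    define c where "c = M $$ (i0, i0)"
    define N where "N = M + (- c) \<cdot>\<^sub>m D_mat n I"
    have "M + (- c) \<cdot>\<^sub>m A \<in> V" using M A D by simp
    moreover have "(M + (- c) \<cdot>\<^sub>m A) $$ (i0, i0) = 0" using D(1)[OF M] D(1)[OF A] A0(2) Ai by (simp add: c_def)
    ultimately have "M + (- c) \<cdot>\<^sub>m A \<in> ?K" using f0 by blast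
    then have "M + (- c) \<cdot>\<^sub>m A \<in> NT n" unfolding K .
    then have "M $$ (i, i) = c * A $$ (i, i)" if "i < n" for i
      using that D(1)[OF M] D(1)[OF A] by (auto simp: NT_def)
    then have "N \<in> NT n"
      using D(1)[OF M] ut[OF M] diagA by (auto simp: NT_def N_def D_mat_def le_less)
    moreover have "M = c \<cdot>\<^sub>m D_mat n I + N"
      unfolding N_def using D(1)[OF M] by (intro eq_matI) (auto simp: D_mat_def simp del: assoc_add_mat)
    ultimately show "M \<in> V1star n I" unfolding V1star_def by blast
  next
    fix M :: "'a mat" assume "M \<in> V1star n I"
    then obtain c N where M: "M = c \<cdot>\<^sub>m D_mat n I + N" "N \<in> NT n" unfolding V1star_def by blast
    define N' where "N' = N + c \<cdot>\<^sub>m (D_mat n I + (- 1) \<cdot>\<^sub>m A)"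
    have Nc: "N \<in> carrier_mat n n" using M(2) by (simp add: NT_def)
    have "N' \<in> NT n"
      using M(2) D(1)[OF A] ut[OF A] diagA by (auto simp: N'_def NT_def D_mat_def le_less)
    then have "N' \<in> V" unfolding K[symmetric] by blast
    moreover have "M = c \<cdot>\<^sub>m A + N'" unfolding M N'_def
      using D(1)[OF A] Nc by (intro eq_matI) (auto simp: D_mat_def algebra_simps simp del: assoc_add_mat)
    ultimately show "M \<in> V" using D A by simp
  qed
  moreover have "I \<noteq> {}" "I \<subseteq> {0..<n}" using i0 by (auto simp: I_def)
  ultimately show ?thesis by blast
qed

text \<open>Once the adapted vector is the last basis vector, the trace-zero matrices with image in
  its line are those supported in the last row with zero corner.\<close>

lemma ex_conj_adapted_last:
  fixes V :: "'a :: field mat set"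
  assumes V: "spec_space (Suc m) V" and two: "(2 :: 'a) \<noteq> 0"
  shows "\<exists>P Q. inv_pair (Suc m) P Q \<and> (\<forall>M\<in>(\<lambda>A. P * A * Q) ` V. 
     (\<forall>i<m. \<forall>j<Suc m. M $$ (i, j) = 0) \<longrightarrow> M $$ (m, m) = 0 \<longrightarrow> M = 0\<^sub>m (Suc m) (Suc m))"
proof -
  let ?n = "Suc m"
  note D = spec_spaceD[OF V]
  obtain x where x: "x \<in> carrier_vec ?n" "x \<noteq> 0\<^sub>v ?n"
    and ad: "\<And>f. f \<in> carrier_vec ?n \<Longrightarrow> f \<bullet> x = 0 \<Longrightarrow> outer ?n x f \<in> V \<Longrightarrow> f = 0\<^sub>v ?n"
    using ex_adapted_vector[OF V two] by blast
  obtain P Q where PQ: "inv_pair ?n P Q" and Px: "col P m = x" using ex_inv_pair_last_col[OF x] by blast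
  have c: "P \<in> carrier_mat ?n ?n" "Q \<in> carrier_mat ?n ?n" "P * Q = 1\<^sub>m ?n" "Q * P = 1\<^sub>m ?n"
    using PQ by (auto simp: inv_pair_def)
  have Pm: "P $$ (i, m) = x $ i" if "i < ?n" for i using Px c(1) that by (metis carrier_matD index_col lessI)
  have "M = 0\<^sub>m ?n ?n" if M: "M \<in> (\<lambda>A. Q * A * P) ` V" and rows: "\<And>i j. i < m \<Longrightarrow> j < ?n \<Longrightarrow> M $$ (i, j) = 0"
    and mm: "M $$ (m, m) = 0" for M
  proof -
    obtain A where A: "A \<in> V" "M = Q * A * P" using M by blast
    have Ac: "A \<in> carrier_mat ?n ?n" using D A by blast
    have Mc: "M \<in> carrier_mat ?n ?n" using A c Ac by simp
    have AM: "A = P * M * Q" unfolding A(2) using conj_cancel[OF inv_pair_sym[OF PQ] Ac] by simp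
    have MQc: "M * Q \<in> carrier_mat ?n ?n" using Mc c by simp
    define f where "f = vec ?n (\<lambda>j. (M * Q) $$ (m, j))"
    have f: "f \<in> carrier_vec ?n" by (simp add: f_def)
    have MQ0: "(M * Q) $$ (i, j) = 0" if "i < m" "j < ?n" for i j
      using that rows by (subst index_mult_mat_sum[OF Mc c(2)]) (auto intro!: sum.neutral)
    have "A = P * (M * Q)" unfolding AM using Mc c by (intro assoc_mult_mat) auto
    also have "\<dots> = outer ?n x f"
    proof (rule eq_matI)
      fix i j assume "i < dim_row (outer ?n x f)" "j < dim_col (outer ?n x f)"
      then have ij: "i < ?n" "j < ?n" by (auto simp: outer_def)
      have "(P * (M * Q)) $$ (i, j) = (\<Sum>s<?n. P $$ (i, s) * (M * Q) $$ (s, j))"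
        by (rule index_mult_mat_sum[OF c(1) MQc ij])
      also have "\<dots> = P $$ (i, m) * (M * Q) $$ (m, j)" using MQ0 ij by simp
      finally show "(P * (M * Q)) $$ (i, j) = outer ?n x f $$ (i, j)"
        using ij by (simp add: outer_def f_def Pm)
    qed (use c MQc in \<open>auto simp: outer_def\<close>)
    finally have Ao: "A = outer ?n x f" .
    have "f \<bullet> x = (\<Sum>j<?n. (M * Q) $$ (m, j) * P $$ (j, m))"
      using x by (auto simp: scalar_prod_def f_def Pm lessThan_atLeast0 intro!: sum.cong)
    also have "\<dots> = (M * Q * P) $$ (m, m)" by (rule index_mult_mat_sum[OF MQc c(1), symmetric]) auto
    also have "M * Q * P = M * (Q * P)" using Mc c by (intro assoc_mult_mat) auto
    also have "\<dots> = M" using c Mc by simp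
    finally have "f \<bullet> x = 0" using mm by simp
    then have "f = 0\<^sub>v ?n" using ad[OF f] A(1) Ao by simp
    then have "A = 0\<^sub>m ?n ?n" unfolding Ao by (intro eq_matI) (auto simp: outer_def)
    then show ?thesis unfolding A(2) 
      using c right_mult_zero_mat[of Q ?n ?n ?n] left_mult_zero_mat[of P ?n ?n ?n] by simp
  qed
  then show ?thesis using inv_pair_sym[OF PQ] by blast
qed

section \<open>Auxiliary facts on top left blocks and corner entries\<close>

lemma topleft_add: "A \<in> carrier_mat n n \<Longrightarrow> B \<in> carrier_mat n n \<Longrightarrow> m \<le> n \<Longrightarrow> topleft m (A + B) = topleft m A + topleft m B"
  by (intro eq_matI) (auto simp: topleft_def)

lemma topleft_smult: "A \<in> carrier_mat n n \<Longrightarrow> m \<le> n \<Longrightarrow> topleft m (c \<cdot>\<^sub>m A) = c \<cdot>\<^sub>m topleft m A"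
  by (intro eq_matI) (auto simp: topleft_def)

lemma eigenvalue_1x1: 
  fixes a :: "'a :: field"
  shows "eigenvalue (map_mat to_ac (mat 1 1 (\<lambda>_. a))) x \<longleftrightarrow> x = to_ac a"
  by (subst eigenvalue_upper_triangular[of _ 1]) auto

text \<open>As the last column vanishes above the corner, the corner is an eigenvalue of
  \<open>M\<close>, next to those of the block.\<close>

lemma spec_last_entry:
  assumes M: "M \<in> carrier_mat (Suc m) (Suc m)" "amo M" and col: "\<And>i. i < m \<Longrightarrow> M $$ (i, m) = 0"
    and x: "eigenvalue (map_mat to_ac (topleft m M)) x" "x \<noteq> 0"
  shows "M $$ (m, m) = 0 \<or> to_ac (M $$ (m, m)) = x"
proof -
  have b: "botright m 1 M = mat 1 1 (\<lambda>_. M $$ (m, m))" by (intro eq_matI) (auto simp: botright_def)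
  have "x = to_ac (M $$ (m, m))" if "M $$ (m, m) \<noteq> 0"
    by (rule amo_block_lower(3)[of M m 1])
       (use M col x that eigenvalue_1x1[of "M $$ (m, m)"] b in \<open>auto simp: le_Suc_eq less_Suc_eq_le\<close>)
  then show ?thesis by blast
qed

text \<open>A nonconstant affine function has three distinct values at 0, 1 and -1. These arguments
  come from the base field even when \<open>a\<close>, \<open>b\<close>, \<open>x\<close> lie in its
  closure.\<close>

lemma affine_two_values:
  fixes a b x :: "'a :: field"
  assumes two: "(2 :: 'a) \<noteq> 0" and v: "\<And>t. t \<in> {0, 1, - 1} \<Longrightarrow> a + t * b = 0 \<or> a + t * b = x"
  shows "b = 0"
proof (rule ccontr)
  assume b: "b \<noteq> 0"
  have b2: "2 * b \<noteq> 0" using two b by simp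
  have h: "a = 0 \<or> a = x" "a + b = 0 \<or> a + b = x" "a - b = 0 \<or> a - b = x"
    using v[of 0] v[of 1] v[of "- 1"] by auto
  have "2 * b = (a + b) - (a - b)" by simp
  then have "a + b \<noteq> a - b" using b2 by (metis right_minus_eq)
  moreover have "a \<noteq> a + b" using b by simp
  moreover have "a \<noteq> a - b" using b by (metis add_diff_cancel_left' diff_0_right diff_diff_eq2)
  ultimately show False using h by metis
qed

lemma Suc_choose_two: "Suc m choose 2 = m + (m choose 2)"
  by (simp add: numeral_2_eq_2)

section \<open>The dimension bound and triangularization\<close>

lemma NT_subset_V1star: "NT n \<subseteq> V1star n I"
proof
  fix N :: "'a mat" assume N: "N \<in> NT n"
  have "N = 0 \<cdot>\<^sub>m D_mat n I + N" using N by (intro eq_matI) (auto simp: NT_def D_mat_def)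
  then show "N \<in> V1star n I" using N unfolding V1star_def by blast
qed

lemma D_mat_in_V1star: "D_mat n I \<in> V1star n I"
proof -
  have "D_mat n I = 1 \<cdot>\<^sub>m D_mat n I + 0\<^sub>m n n" by (intro eq_matI) (auto simp: D_mat_def)
  moreover have "0\<^sub>m n n \<in> NT n" by (simp add: NT_def)
  ultimately show ?thesis unfolding V1star_def by blast
qed

lemma triangularizable_conj_V1star:
  fixes U :: "'a :: field mat set"
  assumes bound: "\<And>U :: 'a mat set. spec_space n U \<Longrightarrow> mdim n n U \<le> (n choose 2) + 1"
    and two: "(2 :: 'a) \<noteq> 0" and n: "n > 0" and U: "spec_space n U" and dim: "mdim n n U = (n choose 2) + 1"
    and t: "triangularizable n U"
  shows "\<exists>P Q I. inv_pair n P Q \<and> I \<noteq> {} \<and> I \<subseteq> {0..<n} \<and> (\<lambda>A. P * A * Q) ` U = V1star n I"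
proof -
  obtain P Q where PQ: "inv_pair n P Q" "\<And>A i j. A \<in> U \<Longrightarrow> j < i \<Longrightarrow> i < n \<Longrightarrow> (P * A * Q) $$ (i, j) = 0"
    using t unfolding triangularizable_def by blast
  have "\<exists>I. I \<noteq> {} \<and> I \<subseteq> {0..<n} \<and> (\<lambda>A. P * A * Q) ` U = V1star n I"
    by (rule upper_triangular_eq_V1star[OF bound two n spec_space_conj(1)[OF PQ(1) U]])
       (use spec_space_conj(2)[OF PQ(1) U] dim PQ(2) in auto)
  then show ?thesis using PQ(1) by blast
qed

text \<open>The induction step from \<open>m\<close> to \<open>Suc m\<close>; \<open>ad\<close> says
  that the last basis vector is adapted to \<open>V\<close>.\<close>

context
  fixes V :: "'a :: field mat set" and m :: nat
  assumes V: "spec_space (Suc m) V" and two: "(2 :: 'a) \<noteq> 0" and m: "m > 0"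
    and ad: "\<And>M. M \<in> V \<Longrightarrow> (\<And>i j. i < m \<Longrightarrow> j < Suc m \<Longrightarrow> M $$ (i, j) = 0) \<Longrightarrow> M $$ (m, m) = 0
       \<Longrightarrow> M = 0\<^sub>m (Suc m) (Suc m)"
    and IHb: "\<And>U :: 'a mat set. spec_space m U \<Longrightarrow> mdim m m U \<le> (m choose 2) + 1"
    and IHt: "\<And>U :: 'a mat set. spec_space m U \<Longrightarrow> mdim m m U = (m choose 2) + 1 \<Longrightarrow> triangularizable m U"
begin

definition last_col :: "'a mat \<Rightarrow> 'a mat" where
  "last_col M = mat m 1 (\<lambda>(i, _). M $$ (i, m))"

text \<open>The members of \<open>V\<close> having the last basis vector as an eigenvector.\<close>

definition fix_last where "fix_last = {M \<in> V. last_col M = 0\<^sub>m m 1}"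

lemma fix_last_iff: "M \<in> fix_last \<longleftrightarrow> M \<in> V \<and> (\<forall>i<m. M $$ (i, m) = 0)"
  by (auto simp: fix_last_def last_col_def mat_eq_iff)

lemma last_col_mlin: "mlin (Suc m) (Suc m) m 1 V last_col"
  unfolding mlin_def
proof (intro conjI ballI allI)
  note D = spec_spaceD[OF V]
  show "last_col (M + N) = last_col M + last_col N" if "M \<in> V" "N \<in> V" for M N
    using D(1)[OF that(1)] D(1)[OF that(2)] by (intro eq_matI) (auto simp: last_col_def)
  show "last_col (t \<cdot>\<^sub>m M) = t \<cdot>\<^sub>m last_col M" if "M \<in> V" for t M
    using D(1)[OF that] by (intro eq_matI) (auto simp: last_col_def)
qed (auto simp: last_col_def)

lemma fix_last_msub: "msub (Suc m) (Suc m) fix_last"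
  unfolding fix_last_def by (rule mlin_ker[OF spec_spaceD(6)[OF V] last_col_mlin])

lemma fix_last_D: 
  shows "M \<in> fix_last \<Longrightarrow> M \<in> carrier_mat (Suc m) (Suc m)" "M \<in> fix_last \<Longrightarrow> amo M"
    "M \<in> fix_last \<Longrightarrow> N \<in> fix_last \<Longrightarrow> M + N \<in> fix_last" "M \<in> fix_last \<Longrightarrow> c \<cdot>\<^sub>m M \<in> fix_last" "M \<in> fix_last \<Longrightarrow> i < m \<Longrightarrow> M $$ (i, m) = 0"
    "M \<in> fix_last \<Longrightarrow> M \<in> V"
  using fix_last_msub spec_spaceD(2)[OF V] fix_last_iff unfolding msub_def by blast+

lemma topleft_mlin: "mlin (Suc m) (Suc m) m m fix_last (topleft m)"
  unfolding mlin_def using fix_last_D(1) by (auto simp: topleft_add[of _ "Suc m"] topleft_smult[of _ "Suc m"])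

lemma topleft_fix_last_spec: "spec_space m (topleft m ` fix_last)"
  unfolding spec_space_def
proof (intro conjI ballI)
  show "msub m m (topleft m ` fix_last)" by (rule mlin_image[OF fix_last_msub topleft_mlin])
  fix A assume "A \<in> topleft m ` fix_last"
  then obtain M where M: "M \<in> fix_last" "A = topleft m M" by blast
  show "amo A" unfolding M(2)
    by (rule amo_block_lower(1)[of _ m 1]) (use fix_last_D[OF M(1)] in \<open>auto simp: le_Suc_eq less_Suc_eq_le\<close>)
qed

definition ker_topleft where "ker_topleft = {M \<in> fix_last. topleft m M = 0\<^sub>m m m}"

lemma ker_topleft_msub: "msub (Suc m) (Suc m) ker_topleft"
  unfolding ker_topleft_def by (rule mlin_ker[OF fix_last_msub topleft_mlin])

lemma ker_topleft_zero:
  assumes "M \<in> ker_topleft" "M $$ (m, m) = 0"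
  shows "M = 0\<^sub>m (Suc m) (Suc m)"
proof (rule ad)
  have M: "M \<in> fix_last" "topleft m M = 0\<^sub>m m m" using assms by (auto simp: ker_topleft_def)
  show "M \<in> V" using fix_last_D(6)[OF M(1)] .
  fix i j assume ij: "i < m" "j < Suc m"
  show "M $$ (i, j) = 0"
  proof (cases "j = m")
    case True
    then show ?thesis using fix_last_D(5)[OF M(1)] ij by simp
  next
    case False
    then have "topleft m M $$ (i, j) = M $$ (i, j)" using ij by (simp add: topleft_def)
    then show ?thesis using M(2) ij False by simp
  qed
qed (fact assms)

text \<open>Members of this kernel live in the last row, so by adaptedness the corner entry
  determines them.\<close>

lemma ker_topleft_dim: "mdim (Suc m) (Suc m) ker_topleft \<le> 1"
proof -
  define f :: "'a mat \<Rightarrow> 'a mat" where "f M = mat 1 1 (\<lambda>_. M $$ (m, m))" for M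
  have KC: "M \<in> carrier_mat (Suc m) (Suc m)" if "M \<in> ker_topleft" for M using ker_topleft_msub that by (auto simp: msub_def)
  have fl: "mlin (Suc m) (Suc m) 1 1 ker_topleft f"
    unfolding mlin_def
  proof (intro conjI ballI allI)
    show "f (M + N) = f M + f N" if "M \<in> ker_topleft" "N \<in> ker_topleft" for M N
      using KC[OF that(1)] KC[OF that(2)] by (intro eq_matI) (auto simp: f_def)
    show "f (t \<cdot>\<^sub>m M) = t \<cdot>\<^sub>m f M" if "M \<in> ker_topleft" for t M
      using KC[OF that] by (intro eq_matI) (auto simp: f_def)
  qed (auto simp: f_def)
  have "M $$ (m, m) = 0" if "f M = 0\<^sub>m 1 1" for M
  proof -
    have "f M $$ (0, 0) = 0" unfolding that by simp
    then show ?thesis by (simp add: f_def)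
  qed
  then have "mdim 1 1 (f ` ker_topleft) = mdim (Suc m) (Suc m) ker_topleft"
    using ker_topleft_zero by (intro mdim_inj[OF ker_topleft_msub fl]) auto
  then show ?thesis using mdim_le[OF mlin_image[OF ker_topleft_msub fl]] by simp
qed

lemma fix_last_dim: "mdim (Suc m) (Suc m) fix_last = mdim m m (topleft m ` fix_last) + mdim (Suc m) (Suc m) ker_topleft"
  unfolding ker_topleft_def by (rule rank_nullity[OF fix_last_msub topleft_mlin])

text \<open>The block determines the matrix, so the induction hypothesis applies to the blocks. At
  equality, adding multiples of a strictly triangular block to the block of \<open>D_mat m I\<close>
  keeps the eigenvalue 1. The corner, affine in the multiple, stays in {0, 1}, so its slope is
  zero.\<close>

lemma fix_last_trivial_kernel:
  assumes K: "ker_topleft = {0\<^sub>m (Suc m) (Suc m)}"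
  shows "mdim (Suc m) (Suc m) fix_last \<le> (m choose 2) + 1"
    and "mdim (Suc m) (Suc m) fix_last = (m choose 2) + 1 \<Longrightarrow> \<exists>P Q. inv_pair m P Q \<and> 
      (\<forall>N\<in>NT m. \<exists>M\<in>fix_last. M $$ (m, m) = 0 \<and> P * topleft m M * Q = N)"
proof -
  have d: "mdim (Suc m) (Suc m) fix_last = mdim m m (topleft m ` fix_last)" using fix_last_dim K by (simp add: mdim_zero)
  show "mdim (Suc m) (Suc m) fix_last \<le> (m choose 2) + 1" unfolding d by (rule IHb[OF topleft_fix_last_spec])
  assume dW: "mdim (Suc m) (Suc m) fix_last = (m choose 2) + 1"
  obtain P Q I where PQ: "inv_pair m P Q" and I: "I \<noteq> {}" "I \<subseteq> {0..<m}"
    and im: "(\<lambda>A. P * A * Q) ` topleft m ` fix_last = V1star m I"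
    using triangularizable_conj_V1star[OF IHb two m topleft_fix_last_spec dW[unfolded d] IHt[OF topleft_fix_last_spec dW[unfolded d]]]
    by blast
  obtain i0 where i0: "i0 \<in> I" "i0 < m" using I by (metis atLeastLessThan_iff ex_in_conv subsetD)
  have "D_mat m I \<in> (\<lambda>A. P * A * Q) ` topleft m ` fix_last" unfolding im by (rule D_mat_in_V1star)
  then obtain MD where MD: "MD \<in> fix_last" "P * topleft m MD * Q = D_mat m I" by auto
  show "\<exists>P Q. inv_pair m P Q \<and> (\<forall>N\<in>NT m. \<exists>M\<in>fix_last. M $$ (m, m) = 0 \<and> P * topleft m M * Q = N)"
  proof (intro exI conjI ballI)
    show "inv_pair m P Q" by fact
    fix N :: "'a mat" assume N: "N \<in> NT m"
    then have "N \<in> (\<lambda>A. P * A * Q) ` topleft m ` fix_last" unfolding im using NT_subset_V1star by blast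
    then obtain M where M: "M \<in> fix_last" "P * topleft m M * Q = N" by auto
    have "M $$ (m, m) = 0"
    proof (rule affine_two_values[OF two])
      fix t :: 'a
      define Y where "Y = MD + t \<cdot>\<^sub>m M"
      have Y: "Y \<in> fix_last" using fix_last_D MD(1) M(1) by (simp add: Y_def)
      have "topleft m Y = topleft m MD + t \<cdot>\<^sub>m topleft m M"
        using fix_last_D(1)[OF MD(1)] fix_last_D(1)[OF M(1)] by (simp add: Y_def topleft_add[of _ "Suc m"] topleft_smult[of _ "Suc m"])
      moreover have "mlin m m m m (carrier_mat m m) (\<lambda>A. P * A * Q)" by (rule mlin_conj[OF PQ msub_carrier])
      ultimately have cY: "P * topleft m Y * Q = D_mat m I + t \<cdot>\<^sub>m N"
        unfolding MD(2)[symmetric] M(2)[symmetric] by (simp add: mlin_def)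
      have "eigenvalue (map_mat to_ac (D_mat m I + t \<cdot>\<^sub>m N)) 1"
        by (subst eigenvalue_upper_triangular[of _ m]) (use N i0 in \<open>auto simp: D_mat_def NT_def\<close>)
      then have e: "eigenvalue (map_mat to_ac (topleft m Y)) 1"
        using eigenvalue_map_conj[OF PQ topleft_carrier, of Y 1] unfolding cY by simp
      have "Y $$ (m, m) = 0 \<or> to_ac (Y $$ (m, m)) = 1"
        by (rule spec_last_entry[OF fix_last_D(1,2)[OF Y] fix_last_D(5)[OF Y] e]) auto
      moreover have "Y $$ (m, m) = MD $$ (m, m) + t * M $$ (m, m)"
        using fix_last_D(1)[OF MD(1)] fix_last_D(1)[OF M(1)] by (simp add: Y_def)
      ultimately show "MD $$ (m, m) + t * M $$ (m, m) = 0 \<or> MD $$ (m, m) + t * M $$ (m, m) = 1"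
        by (metis to_ac_1 to_ac_eq_iff)
    qed
    then show "\<exists>M\<in>fix_last. M $$ (m, m) = 0 \<and> P * topleft m M * Q = N" using M by blast
  qed
qed

text \<open>Here the top left blocks are nilpotent, and the induction hypothesis is applied to their sum
  with the scalar matrices.\<close>

lemma fix_last_nontrivial_kernel:
  assumes K: "K \<in> ker_topleft" "K \<noteq> 0\<^sub>m (Suc m) (Suc m)"
  shows "mdim (Suc m) (Suc m) fix_last \<le> (m choose 2) + 1"
    and "mdim (Suc m) (Suc m) fix_last = (m choose 2) + 1 \<Longrightarrow> \<exists>P Q. inv_pair m P Q \<and> 
      (\<forall>N\<in>NT m. \<exists>M\<in>fix_last. M $$ (m, m) = 0 \<and> P * topleft m M * Q = N)"
proof -
  let ?U = "topleft m ` fix_last"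
  have KW: "K \<in> fix_last" "topleft m K = 0\<^sub>m m m" using K(1) by (auto simp: ker_topleft_def)
  have Km: "K $$ (m, m) \<noteq> 0" using ker_topleft_zero[OF K(1)] K(2) by blast
  have tl: "topleft m (M + t \<cdot>\<^sub>m K) = topleft m M" if "M \<in> fix_last" for M t
  proof -
    have "topleft m (M + t \<cdot>\<^sub>m K) = topleft m M + t \<cdot>\<^sub>m topleft m K"
      using fix_last_D(1)[OF that] fix_last_D(1)[OF KW(1)] by (simp add: topleft_add[of _ "Suc m"] topleft_smult[of _ "Suc m"])
    then show ?thesis unfolding KW(2) using topleft_carrier[of m M] by simp
  qed
  have mm: "(M + t \<cdot>\<^sub>m K) $$ (m, m) = M $$ (m, m) + t * K $$ (m, m)" for M t
    using fix_last_D(1)[OF KW(1)] by simp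
  \<comment> \<open>Adding multiples of \<open>K\<close> moves the corner and leaves the block
    alone, while a nonzero eigenvalue \<open>x\<close> of the block would confine the corner to 0
    and \<open>x\<close>.\<close>
  have nil: "nil_mat A" if "A \<in> ?U" for A
    unfolding nil_mat_def
  proof (intro allI impI)
    fix x assume x: "eigenvalue (map_mat to_ac A) x"
    obtain M where M: "M \<in> fix_last" "A = topleft m M" using \<open>A \<in> ?U\<close> by blast
    have two': "(2 :: 'a alg_closure) \<noteq> 0" using two by (metis to_ac_eq_0_iff to_ac_numeral)
    show "x = 0"
    proof (rule ccontr)
      assume x0: "x \<noteq> 0"
      have v: "to_ac (M $$ (m, m)) + to_ac t * to_ac (K $$ (m, m)) = 0 \<or> 
          to_ac (M $$ (m, m)) + to_ac t * to_ac (K $$ (m, m)) = x" for t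
      proof -
        have Y: "M + t \<cdot>\<^sub>m K \<in> fix_last" using fix_last_D M(1) KW(1) by simp
        have "(M + t \<cdot>\<^sub>m K) $$ (m, m) = 0 \<or> to_ac ((M + t \<cdot>\<^sub>m K) $$ (m, m)) = x"
          by (rule spec_last_entry[OF fix_last_D(1,2)[OF Y] fix_last_D(5)[OF Y] _ x0]) (use x M(2) tl[OF M(1)] in auto)
        then show ?thesis unfolding mm by (metis to_ac_0 to_ac_add to_ac_mult)
      qed
      have "to_ac (K $$ (m, m)) = 0"
        by (rule affine_two_values[OF two', of "to_ac (M $$ (m, m))" _ x])
           (use v[of 0] v[of 1] v[of "- 1"] in auto)
      then show False using Km by simp
    qed
  qed
  have Um: "msub m m ?U" using topleft_fix_last_spec by (simp add: spec_space_def)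
  note U' = add_scalars[OF Um nil m]
  have dU: "mdim m m ?U \<le> m choose 2" using U'(2) IHb[OF U'(1)] by linarith
  show "mdim (Suc m) (Suc m) fix_last \<le> (m choose 2) + 1" using fix_last_dim dU ker_topleft_dim by linarith
  assume dW: "mdim (Suc m) (Suc m) fix_last = (m choose 2) + 1"
  \<comment> \<open>Equality forces \<open>?U\<close> to have dimension \<open>m choose 2\<close>,
    so adding the scalars reaches the bound.\<close>
  have d: "mdim m m (add_scalars m ?U) = (m choose 2) + 1"
    using dW fix_last_dim dU ker_topleft_dim U'(2) IHb[OF U'(1)] by linarith
  obtain P Q I where PQ: "inv_pair m P Q" and I: "I \<noteq> {}" "I \<subseteq> {0..<m}"
    and im: "(\<lambda>A. P * A * Q) ` add_scalars m ?U = V1star m I"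
    using triangularizable_conj_V1star[OF IHb two m U'(1) d IHt[OF U'(1) d]] by blast
  show "\<exists>P Q. inv_pair m P Q \<and> (\<forall>N\<in>NT m. \<exists>M\<in>fix_last. M $$ (m, m) = 0 \<and> P * topleft m M * Q = N)"
  proof (intro exI conjI ballI)
    show "inv_pair m P Q" by fact
    fix N :: "'a mat" assume N: "N \<in> NT m"
    then have "N \<in> (\<lambda>A. P * A * Q) ` add_scalars m ?U" unfolding im using NT_subset_V1star by blast
    then obtain c M where M: "M \<in> fix_last" and NM: "N = P * (c \<cdot>\<^sub>m 1\<^sub>m m + topleft m M) * Q"
      unfolding add_scalars_def by blast
    have cc: "c \<cdot>\<^sub>m 1\<^sub>m m + topleft m M \<in> carrier_mat m m" using topleft_carrier[of m M] by simp
    \<comment> \<open>\<open>N\<close> has eigenvalue 0, so the nilpotent block has eigenvalue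
      \<open>- c\<close>, whence \<open>c = 0\<close>.\<close>
    have "eigenvalue (map_mat to_ac N) 0"
      by (subst eigenvalue_upper_triangular[of _ m]) (use N m in \<open>auto simp: NT_def\<close>)
    then have "eigenvalue (map_mat to_ac (c \<cdot>\<^sub>m 1\<^sub>m m + topleft m M)) 0"
      unfolding NM using eigenvalue_map_conj[OF PQ cc] by blast
    from eigenvalue_add_scalar[OF topleft_carrier this] nil M
    have "0 - to_ac c = 0" unfolding nil_mat_def by blast
    then have "c = 0" by simp
    then have "c \<cdot>\<^sub>m 1\<^sub>m m + topleft m M = topleft m M" by (intro eq_matI) (auto simp: topleft_def)
    then have NM': "P * topleft m M * Q = N" using NM by simp
    \<comment> \<open>This multiple of \<open>K\<close> makes the corner vanish without changing the
      block.\<close>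
    define s where "s = - (M $$ (m, m) * inverse (K $$ (m, m)))"
    have "(M + s \<cdot>\<^sub>m K) $$ (m, m) = 0" unfolding mm s_def using Km by simp
    moreover have "M + s \<cdot>\<^sub>m K \<in> fix_last" using fix_last_D M KW(1) by simp
    ultimately show "\<exists>M\<in>fix_last. M $$ (m, m) = 0 \<and> P * topleft m M * Q = N"
      using NM' tl[OF M, of s] by (intro bexI[of _ "M + s \<cdot>\<^sub>m K"]) auto
  qed
qed

lemma fix_last_structure:
  shows "mdim (Suc m) (Suc m) fix_last \<le> (m choose 2) + 1"
    and "mdim (Suc m) (Suc m) fix_last = (m choose 2) + 1 \<Longrightarrow> \<exists>P Q. inv_pair m P Q \<and> 
      (\<forall>N\<in>NT m. \<exists>M\<in>fix_last. M $$ (m, m) = 0 \<and> P * topleft m M * Q = N)"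
proof -
  have "0\<^sub>m (Suc m) (Suc m) \<in> ker_topleft" using ker_topleft_msub by (simp add: msub_def)
  then have "ker_topleft = {0\<^sub>m (Suc m) (Suc m)} \<or> (\<exists>K\<in>ker_topleft. K \<noteq> 0\<^sub>m (Suc m) (Suc m))" by blast
  then show "mdim (Suc m) (Suc m) fix_last \<le> (m choose 2) + 1"
    and "mdim (Suc m) (Suc m) fix_last = (m choose 2) + 1 \<Longrightarrow> \<exists>P Q. inv_pair m P Q \<and> 
      (\<forall>N\<in>NT m. \<exists>M\<in>fix_last. M $$ (m, m) = 0 \<and> P * topleft m M * Q = N)"
    using fix_last_trivial_kernel fix_last_nontrivial_kernel by blast+
qed

text \<open>The last column contributes at most \<open>m\<close> dimensions and
  \<open>fix_last\<close> at most \<open>(m choose 2) + 1\<close>. At equality every last column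
  occurs and all of \<open>NT m\<close> lifts, which provides the hooks.\<close>

lemma adapted_step:
  assumes three: "(3 :: 'a) \<noteq> 0"
  shows "mdim (Suc m) (Suc m) V \<le> (Suc m choose 2) + 1"
    and "mdim (Suc m) (Suc m) V = (Suc m choose 2) + 1 \<Longrightarrow> triangularizable (Suc m) V"
proof -
  let ?n = "Suc m"
  note D = spec_spaceD[OF V]
  have im: "msub m 1 (last_col ` V)" by (rule mlin_image[OF D(6) last_col_mlin])
  have rn: "mdim ?n ?n V = mdim m 1 (last_col ` V) + mdim ?n ?n fix_last"
    unfolding fix_last_def by (rule rank_nullity[OF D(6) last_col_mlin])
  have le: "mdim m 1 (last_col ` V) \<le> m" using mdim_le[OF im] by simp
  show "mdim ?n ?n V \<le> (?n choose 2) + 1" unfolding Suc_choose_two using rn le fix_last_structure(1) by linarith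
  assume "mdim ?n ?n V = (?n choose 2) + 1"
  then have d1: "mdim m 1 (last_col ` V) = m" and d2: "mdim ?n ?n fix_last = (m choose 2) + 1"
    unfolding Suc_choose_two using rn le fix_last_structure(1) by linarith+
  have sub: "last_col ` V \<subseteq> carrier_mat m 1" by (auto simp: last_col_def)
  have full: "last_col ` V = carrier_mat m 1"
    by (rule mdim_eqD[OF im msub_carrier sub])
       (use mdim_mono[OF im msub_carrier sub] mdim_carrier_le[of m 1, where ?'a = 'a] d1 in simp)
  have col: "\<exists>M\<in>V. \<forall>i<m. M $$ (i, m) = c i" for c
  proof -
    have "mat m 1 (\<lambda>(i, _). c i) \<in> last_col ` V" unfolding full by simp
    then obtain M where M: "M \<in> V" "mat m 1 (\<lambda>(i, _). c i) = last_col M" by blast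
    have "M $$ (i, m) = c i" if "i < m" for i
      using arg_cong[OF M(2), of "\<lambda>A. A $$ (i, 0)"] that by (simp add: last_col_def)
    then show ?thesis using M(1) by blast
  qed
  obtain P Q where PQ: "inv_pair m P Q" 
    and nt: "\<And>N. N \<in> NT m \<Longrightarrow> \<exists>M\<in>fix_last. M $$ (m, m) = 0 \<and> P * topleft m M * Q = N"
    using fix_last_structure(2)[OF d2] by blast
  have c: "P \<in> carrier_mat m m" "Q \<in> carrier_mat m m" "P * Q = 1\<^sub>m m" using PQ by (auto simp: inv_pair_def)
  note E = inv_pair_ext[OF PQ]
  define V' where "V' = (\<lambda>A. ext m P * A * ext m Q) ` V"
  have V': "spec_space ?n V'" unfolding V'_def by (rule spec_space_conj(1)[OF E V])
  have "full_last_col m V'" unfolding full_last_col_def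
  proof
    fix b :: "nat \<Rightarrow> 'a"
    \<comment> \<open>The last column is chosen as \<open>Q\<close> times \<open>b\<close>, which
      the conjugation by \<open>ext m P\<close> turns into \<open>b\<close>.\<close>
    obtain M where M: "M \<in> V" "\<And>i. i < m \<Longrightarrow> M $$ (i, m) = (\<Sum>k<m. Q $$ (i, k) * b k)"
      using col[of "\<lambda>i. \<Sum>k<m. Q $$ (i, k) * b k"] by blast
    have "(ext m P * M * ext m Q) $$ (i, m) = b i" if i: "i < m" for i
    proof -
      have "(ext m P * M * ext m Q) $$ (i, m) = (\<Sum>s<m. P $$ (i, s) * (\<Sum>k<m. Q $$ (s, k) * b k))"
        using M(2) i by (simp add: ext_conj_index(2)[OF D(1)[OF M(1)] c(1,2)])
      also have "\<dots> = (\<Sum>s<m. \<Sum>k<m. P $$ (i, s) * Q $$ (s, k) * b k)"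
        by (simp add: sum_distrib_left mult.assoc)
      also have "\<dots> = (\<Sum>k<m. \<Sum>s<m. P $$ (i, s) * Q $$ (s, k) * b k)" by (rule sum.swap)
      also have "\<dots> = (\<Sum>k<m. (P * Q) $$ (i, k) * b k)"
        using i by (intro sum.cong refl) (simp add: index_mult_mat_sum[OF c(1,2)] sum_distrib_right)
      also have "\<dots> = (\<Sum>k<m. if k = i then b i else 0)"
        unfolding c(3) using i by (intro sum.cong refl) auto
      also have "\<dots> = b i" using i by simp
      finally show ?thesis .
    qed
    then show "\<exists>M\<in>V'. \<forall>i<m. M $$ (i, m) = b i" using M(1) unfolding V'_def by blast
  qed
  moreover have "\<exists>A\<in>V'. hook m i j A" if ij: "i < j" "j < m" for i j
  proof -
    define N :: "'a mat" where "N = mat m m (\<lambda>(k, l). if k = i \<and> l = j then 1 else 0)"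
    have "N \<in> NT m" using ij by (auto simp: N_def NT_def)
    then obtain M where M: "M \<in> fix_last" "M $$ (m, m) = 0" "P * topleft m M * Q = N" using nt by blast
    note Mc = fix_last_D(1)[OF M(1)]
    let ?A = "ext m P * M * ext m Q"
    have "?A $$ (k, l) = (if k = i \<and> l = j then 1 else 0)" if kl: "k < m" "l \<le> m" for k l
    proof (cases "l = m")
      case True
      have "(\<Sum>s<m. P $$ (k, s) * M $$ (s, m)) = 0" using fix_last_D(5)[OF M(1)] by simp
      then show ?thesis using True ij kl ext_conj_index(2)[OF Mc c(1,2), of k] by simp
    next
      case False
      then show ?thesis using kl ext_conj_index(1)[OF Mc c(1,2), of k l] M(3) by (simp add: N_def)
    qed
    moreover have "?A $$ (m, m) = 0" using ext_conj_index(4)[OF Mc c(1,2)] M(2) by simp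
    moreover have "?A \<in> carrier_mat ?n ?n" using Mc by simp
    ultimately have "hook m i j ?A" by (simp add: hook_def)
    moreover have "?A \<in> V'" using fix_last_D(6)[OF M(1)] by (auto simp: V'_def)
    ultimately show ?thesis by blast
  qed
  ultimately have "triangularizable ?n V'"
    by (intro triangularizable_of_hooks[OF V' two three m]) auto
  then show "triangularizable ?n V" unfolding V'_def
    by (rule triangularizable_conjD[OF E, rotated]) (use D(1) in blast)
qed

end

theorem spec_space_dim_triangularizable:
  fixes V :: "'a :: field mat set"
  assumes two: "(2 :: 'a) \<noteq> 0" and three: "(3 :: 'a) \<noteq> 0" and "n > 0" and "spec_space n V"
  shows spec_space_dim_le: "mdim n n V \<le> (n choose 2) + 1"
    and spec_space_triangularizable: "mdim n n V = (n choose 2) + 1 \<Longrightarrow> triangularizable n V"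
proof -
  have "\<forall>V :: 'a mat set. spec_space n V \<longrightarrow> mdim n n V \<le> (n choose 2) + 1 \<and>
     (mdim n n V = (n choose 2) + 1 \<longrightarrow> triangularizable n V)"
    using \<open>n > 0\<close>
  proof (induction n rule: nat_induct_non_zero)
    case 1
    have "mdim 1 1 V \<le> 1" if "spec_space 1 V" for V :: "'a mat set"
      using mdim_le[OF spec_spaceD(6)[OF that]] by simp
    moreover have "triangularizable 1 V" for V :: "'a mat set"
      using inv_pair_one[of 1] by (auto simp: triangularizable_def)
    ultimately show ?case by (simp add: numeral_2_eq_2)
  next
    case (Suc m)
    show ?case
    proof (intro allI impI)
      fix V :: "'a mat set" assume V: "spec_space (Suc m) V"
      \<comment> \<open>Conjugation makes the last basis vector adapted, as
        \<open>adapted_step\<close> demands.\<close>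
      obtain P Q where PQ: "inv_pair (Suc m) P Q" and ad: "\<And>M. M \<in> (\<lambda>A. P * A * Q) ` V \<Longrightarrow>
         (\<And>i j. i < m \<Longrightarrow> j < Suc m \<Longrightarrow> M $$ (i, j) = 0) \<Longrightarrow> M $$ (m, m) = 0 \<Longrightarrow> M = 0\<^sub>m (Suc m) (Suc m)"
      proof -
        obtain P Q where *: "inv_pair (Suc m) P Q" "\<forall>M\<in>(\<lambda>A. P * A * Q) ` V. (\<forall>i<m. \<forall>j<Suc m. M $$ (i, j) = 0) 
            \<longrightarrow> M $$ (m, m) = 0 \<longrightarrow> M = 0\<^sub>m (Suc m) (Suc m)"
          using ex_conj_adapted_last[OF V two] by (elim exE conjE)
        show ?thesis by (rule that[OF *(1) *(2)[rule_format]])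
      qed
      have IH: "mdim m m U \<le> (m choose 2) + 1" "mdim m m U = (m choose 2) + 1 \<Longrightarrow> triangularizable m U"
        if "spec_space m U" for U :: "'a mat set" using Suc.IH that by blast+
      note S = spec_space_conj[OF PQ V]
      note st = adapted_step[OF S(1) two Suc.hyps ad IH three]
      have "triangularizable (Suc m) V" if "mdim (Suc m) (Suc m) V = (Suc m choose 2) + 1"
      proof (rule triangularizable_conjD[OF PQ _ st(2)])
        show "V \<subseteq> carrier_mat (Suc m) (Suc m)" using spec_spaceD(1)[OF V] by blast
        show "mdim (Suc m) (Suc m) ((\<lambda>A. P * A * Q) ` V) = (Suc m choose 2) + 1" unfolding S(2) by (rule that)
      qed
      then show "mdim (Suc m) (Suc m) V \<le> (Suc m choose 2) + 1 \<and>
         (mdim (Suc m) (Suc m) V = (Suc m choose 2) + 1 \<longrightarrow> triangularizable (Suc m) V)"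
        using st(1)[unfolded S(2)] by blast
    qed
  qed
  then show "mdim n n V \<le> (n choose 2) + 1" "mdim n n V = (n choose 2) + 1 \<Longrightarrow> triangularizable n V"
    using assms(4) by blast+
qed

section \<open>The classification\<close>

lemma mat_subspace_iff_msub: "mat_subspace n V \<longleftrightarrow> msub n n V"
  by (simp add: mat_subspace_def msub_iff_subspace)

lemma mat_subspace_dim_eq_mdim: "mat_subspace_dim n V = mdim n n V"
  by (simp add: mat_subspace_dim_def mdim_def)

section \<open>Uniqueness of the index set\<close>

lemma V1star_upper_triangular:
  assumes "A \<in> V1star n I"
  shows "A \<in> carrier_mat n n" "j < i \<Longrightarrow> i < n \<Longrightarrow> A $$ (i, j) = 0"
  using assms by (auto simp: V1star_def D_mat_def NT_def)

text \<open>The coefficient \<open>c\<close> of \<open>D_mat n I\<close> is a diagonal entry at any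
  position of the nonempty \<open>I\<close>, hence an eigenvalue, hence zero.\<close>

lemma V1star_nil_in_NT:
  fixes A :: "'a :: field mat"
  assumes A: "A \<in> V1star n I" and nil: "nil_mat A" and I: "I \<noteq> {}" "I \<subseteq> {0..<n}"
  shows "A \<in> NT n"
proof -
  obtain c N where cN: "A = c \<cdot>\<^sub>m D_mat n I + N" "N \<in> NT n" using A unfolding V1star_def by blast
  obtain i where i: "i \<in> I" "i < n" using I by (metis atLeastLessThan_iff ex_in_conv subsetD)
  have Nc: "N \<in> carrier_mat n n" using cN(2) by (simp add: NT_def)
  have "A $$ (i, i) = c" unfolding cN(1) using cN(2) i Nc by (simp add: D_mat_def NT_def)
  moreover have "eigenvalue (map_mat to_ac A) (to_ac (A $$ (i, i)))"
    using V1star_upper_triangular[OF A] i by (subst eigenvalue_upper_triangular[of _ n]) auto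
  ultimately have "c = 0" using nil unfolding nil_mat_def by (metis to_ac_eq_0_iff)
  then have "A = N" unfolding cN(1) using Nc by (intro eq_matI) (auto simp: D_mat_def)
  then show ?thesis using cN(2) by simp
qed

text \<open>With the matrix unit \<open>N\<close> at \<open>(i, a)\<close> and its conjugate
  \<open>N'\<close>, compare the \<open>(i, i)\<close> entries of \<open>N P = P N'\<close>. The
  left one is \<open>P $$ (a, i)\<close>; the right one involves only entries of \<open>P\<close>
  below the diagonal in columns before \<open>i\<close>, zero by induction.\<close>

lemma conj_NT_upper_triangular:
  fixes P :: "'a :: field mat"
  assumes PQ: "inv_pair n P Q" and sub: "\<And>N. N \<in> NT n \<Longrightarrow> Q * N * P \<in> NT n"
    and "i < n" "a < n" "i < a"
  shows "P $$ (a, i) = 0"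
  using \<open>i < n\<close> \<open>a < n\<close> \<open>i < a\<close>
proof (induction i arbitrary: a rule: less_induct)
  case (less i)
  have c: "P \<in> carrier_mat n n" "Q \<in> carrier_mat n n" using PQ by (auto simp: inv_pair_def)
  define N :: "'a mat" where "N = mat n n (\<lambda>(k, l). if k = i \<and> l = a then 1 else 0)"
  have Nc: "N \<in> carrier_mat n n" by (simp add: N_def)
  have N: "N \<in> NT n" using less.prems by (auto simp: N_def NT_def)
  define N' where "N' = Q * N * P"
  have N': "N' \<in> NT n" unfolding N'_def by (rule sub[OF N])
  have Nc': "N' \<in> carrier_mat n n" using N' by (simp add: NT_def)
  have "P * N' * Q = N" unfolding N'_def using conj_cancel[OF inv_pair_sym[OF PQ] Nc] .
  then have "N * P = P * N' * Q * P" by simp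
  also have "\<dots> = P * N' * (Q * P)" using c Nc' by (intro assoc_mult_mat) auto
  also have "\<dots> = P * N'" using PQ c Nc' by (simp add: inv_pair_def)
  finally have eq: "N * P = P * N'" .
  have "(N * P) $$ (i, i) = (\<Sum>s<n. N $$ (i, s) * P $$ (s, i))"
    using less.prems by (intro index_mult_mat_sum[OF Nc c(1)])
  also have "\<dots> = (\<Sum>s<n. if s = a then P $$ (a, i) else 0)"
    using less.prems by (intro sum.cong) (auto simp: N_def)
  also have "\<dots> = P $$ (a, i)" using less.prems by simp
  finally have l: "(N * P) $$ (i, i) = P $$ (a, i)" .
  have "(P * N') $$ (i, i) = (\<Sum>s<n. P $$ (i, s) * N' $$ (s, i))"
    using less.prems by (intro index_mult_mat_sum[OF c(1) Nc'])
  also have "\<dots> = 0"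
  proof (intro sum.neutral ballI)
    fix s assume "s \<in> {..<n}"
    then show "P $$ (i, s) * N' $$ (s, i) = 0"
      using less.IH[of s i] less.prems N' by (cases "s < i") (auto simp: NT_def)
  qed
  finally show ?case using l eq by simp
qed

lemma upper_triangular_mult_diag:
  fixes A B :: "'a :: field mat"
  assumes A: "A \<in> carrier_mat n n" and B: "B \<in> carrier_mat n n" and i: "i < n"
    and Al: "\<And>a j. j < a \<Longrightarrow> a < n \<Longrightarrow> A $$ (a, j) = 0" and Bl: "\<And>a j. j < a \<Longrightarrow> a < n \<Longrightarrow> B $$ (a, j) = 0"
  shows "(A * B) $$ (i, i) = A $$ (i, i) * B $$ (i, i)"
proof -
  have "(A * B) $$ (i, i) = (\<Sum>s<n. A $$ (i, s) * B $$ (s, i))" by (rule index_mult_mat_sum[OF A B i i])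
  also have "\<dots> = (\<Sum>s<n. if s = i then A $$ (i, i) * B $$ (i, i) else 0)"
  proof (intro sum.cong refl)
    fix s assume "s \<in> {..<n}"
    then show "A $$ (i, s) * B $$ (s, i) = (if s = i then A $$ (i, i) * B $$ (i, i) else 0)"
      using Al[of s i] Bl[of i s] i by (cases s i rule: linorder_cases) auto
  qed
  also have "\<dots> = A $$ (i, i) * B $$ (i, i)" using i by simp
  finally show ?thesis .
qed

lemma V1star_similar_unique:
  fixes P :: "'a :: field mat"
  assumes PQ: "inv_pair n P Q" and I: "I \<noteq> {}" "I \<subseteq> {0..<n}" and J: "J \<noteq> {}" "J \<subseteq> {0..<n}"
    and eq: "V1star n J = (\<lambda>A. P * A * Q) ` V1star n I"
  shows "I = J"
proof -
  have c: "P \<in> carrier_mat n n" "Q \<in> carrier_mat n n" "P * Q = 1\<^sub>m n" "Q * P = 1\<^sub>m n"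
    using PQ by (auto simp: inv_pair_def)
  have NTc: "N \<in> carrier_mat n n" if "N \<in> NT n" for N :: "'a mat" using that by (simp add: NT_def)
  have fwd: "P * N * Q \<in> NT n" if N: "N \<in> NT n" for N
  proof (rule V1star_nil_in_NT[OF _ _ J])
    show "P * N * Q \<in> V1star n J" unfolding eq using N NT_subset_V1star[of n I] by blast
    show "nil_mat (P * N * Q)"
      using NT_nil[OF N] eigenvalue_map_conj[OF PQ NTc[OF N]] by (simp add: nil_mat_def)
  qed
  have bwd: "Q * N * P \<in> NT n" if N: "N \<in> NT n" for N
  proof (rule V1star_nil_in_NT[OF _ _ I])
    have "N \<in> V1star n J" using N NT_subset_V1star[of n J] by blast
    then obtain A where A: "A \<in> V1star n I" "N = P * A * Q" unfolding eq by blast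
    then show "Q * N * P \<in> V1star n I" using conj_cancel[OF PQ V1star_upper_triangular(1)[OF A(1)]] by simp
    show "nil_mat (Q * N * P)"
      using NT_nil[OF N] eigenvalue_map_conj[OF inv_pair_sym[OF PQ] NTc[OF N]] by (simp add: nil_mat_def)
  qed
  have Put: "P $$ (a, i) = 0" if "i < a" "a < n" for i a
    using conj_NT_upper_triangular[OF PQ bwd] that by auto
  have Qut: "Q $$ (a, i) = 0" if "i < a" "a < n" for i a
    using conj_NT_upper_triangular[OF inv_pair_sym[OF PQ] fwd] that by auto
  have Pii: "P $$ (i, i) \<noteq> 0" if "i < n" for i
  proof
    assume "P $$ (i, i) = 0"
    then have "(P * Q) $$ (i, i) = 0" using upper_triangular_mult_diag[OF c(1,2) that Put Qut] by simp
    then show False unfolding c(3) using that by simp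
  qed
  have Dc: "(D_mat n I :: 'a mat) \<in> carrier_mat n n" for I by (simp add: D_mat_def)
  have "P * D_mat n I * Q \<in> V1star n J" unfolding eq using D_mat_in_V1star by blast
  then obtain k N where kN: "P * D_mat n I * Q = k \<cdot>\<^sub>m D_mat n J + N" "N \<in> NT n" unfolding V1star_def by blast
  define B where "B = k \<cdot>\<^sub>m D_mat n J + N"
  have Bc: "B \<in> carrier_mat n n" using NTc[OF kN(2)] Dc by (simp add: B_def)
  \<comment> \<open>All factors are upper triangular, so diagonal entries multiply; cancelling those
    of \<open>P\<close> shows that \<open>B\<close> and \<open>D_mat n I\<close> have the same
    diagonal.\<close>
  have "B * P = P * D_mat n I * Q * P" unfolding B_def kN(1) ..
  also have "\<dots> = P * D_mat n I * (Q * P)" using c Dc by (intro assoc_mult_mat[of _ n n _ n _ n]) auto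
  also have "\<dots> = P * D_mat n I" unfolding c(4) by (rule right_mult_one_mat[OF mult_carrier_square[OF c(1) Dc]])
  finally have BP: "B * P = P * D_mat n I" .
  have "(if i \<in> I then 1 else 0) = k * (if i \<in> J then 1 else 0)" if i: "i < n" for i
  proof -
    have Bl: "B $$ (a, j) = 0" if "j < a" "a < n" for a j
      using that kN(2) NTc[OF kN(2)] by (auto simp: B_def D_mat_def NT_def)
    have Dl: "D_mat n I $$ (a, j) = 0" if "j < a" "a < n" for a j
      using that by (simp add: D_mat_def)
    have "B $$ (i, i) * P $$ (i, i) = P $$ (i, i) * D_mat n I $$ (i, i)"
      using arg_cong[OF BP, of "\<lambda>A. A $$ (i, i)"] upper_triangular_mult_diag[OF Bc c(1) i Bl Put] upper_triangular_mult_diag[OF c(1) Dc i Put Dl] by simp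
    then have "B $$ (i, i) = D_mat n I $$ (i, i)" using Pii[OF i] by simp
    then show ?thesis using i kN(2) NTc[OF kN(2)] by (auto simp: B_def D_mat_def NT_def)
  qed
  note key = this
  obtain i where i: "i \<in> I" "i < n" using I by (metis atLeastLessThan_iff ex_in_conv subsetD)
  have "k = 1" using key[OF i(2)] i(1) by (auto split: if_splits)
  then have "i \<in> I \<longleftrightarrow> i \<in> J" if "i < n" for i using key[OF that] by (auto split: if_splits)
  then show ?thesis using I(2) J(2) by (auto simp: subset_eq)
qed

theorem mainTheorem4:
  fixes V :: "'a :: field mat set" and n :: nat
  assumes "CHAR('a) \<noteq> 2" and "CHAR('a) \<noteq> 3"
    and "n \<ge> 1"
    and "mat_subspace n V"
    and "mat_subspace_dim n V = (n choose 2) + 1"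
    and "\<forall>M \<in> V. at_most_one_nonzero_eigenvalue M"
  shows "\<exists>!I. I \<noteq> {} \<and> I \<subseteq> {0..<n} \<and> similar_mat_sets n V (V1star n I)"
proof (rule ex_ex1I)
  \<comment> \<open>If \<open>p\<close> vanishes in the field, the characteristic divides
    \<open>p\<close>; not being 1, it equals the prime \<open>p\<close>.\<close>
  have nz: "(of_nat p :: 'a) \<noteq> 0" if "Factorial_Ring.prime p" "CHAR('a) \<noteq> p" for p
  proof
    assume "(of_nat p :: 'a) = 0"
    then have "CHAR('a) dvd p" by (simp only: of_nat_eq_0_iff_char_dvd)
    then have "CHAR('a) = 1 \<or> CHAR('a) = p" using that(1) unfolding prime_nat_iff by blast
    then show False using that(2) CHAR_not_1 by auto
  qed
  have two: "(2 :: 'a) \<noteq> 0" using nz[of 2] assms(1) by simp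
  have three: "(3 :: 'a) \<noteq> 0" using nz[of 3] assms(2) by simp
  have n: "n > 0" using assms(3) by simp
  have V: "spec_space n V" using assms(4,6) by (simp add: spec_space_def mat_subspace_iff_msub)
  have dim: "mdim n n V = (n choose 2) + 1" using assms(5) by (simp add: mat_subspace_dim_eq_mdim)
  obtain P Q I where "inv_pair n P Q" "I \<noteq> {}" "I \<subseteq> {0..<n}" "(\<lambda>A. P * A * Q) ` V = V1star n I"
    using triangularizable_conj_V1star[OF spec_space_dim_le[OF two three n] two n V dim
        spec_space_triangularizable[OF two three n V dim]] by blast
  then show "\<exists>I. I \<noteq> {} \<and> I \<subseteq> {0..<n} \<and> similar_mat_sets n V (V1star n I)"
    unfolding similar_mat_sets_def inv_pair_def by metis
  fix I J
  assume I: "I \<noteq> {} \<and> I \<subseteq> {0..<n} \<and> similar_mat_sets n V (V1star n I)"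
    and J: "J \<noteq> {} \<and> J \<subseteq> {0..<n} \<and> similar_mat_sets n V (V1star n J)"
  obtain P1 Q1 where 1: "inv_pair n P1 Q1" "V1star n I = (\<lambda>A. P1 * A * Q1) ` V"
    using I unfolding similar_mat_sets_def inv_pair_def by blast
  obtain P2 Q2 where 2: "inv_pair n P2 Q2" "V1star n J = (\<lambda>A. P2 * A * Q2) ` V"
    using J unfolding similar_mat_sets_def inv_pair_def by blast
  \<comment> \<open>Going back to \<open>V\<close> along the first conjugation and on along the
    second relates the two standard spaces directly.\<close>
  have "P2 * Q1 * (P1 * A * Q1) * (P1 * Q2) = P2 * A * Q2" if "A \<in> V" for A
  proof -
    have A: "A \<in> carrier_mat n n" by (rule spec_spaceD(1)[OF V that])
    have c: "P1 * A * Q1 \<in> carrier_mat n n" using 1(1) A by (simp add: inv_pair_def)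
    show ?thesis
      using conj_conj[OF inv_pair_sym[OF 1(1)] 2(1) c] conj_cancel[OF 1(1) A] by simp
  qed
  then have "V1star n J = (\<lambda>A. P2 * Q1 * A * (P1 * Q2)) ` V1star n I"
    unfolding 1(2) 2(2) image_image by (intro image_cong) auto
  then show "I = J"
    using V1star_similar_unique[OF inv_pair_mult[OF inv_pair_sym[OF 1(1)] 2(1)]] I J by blast
qed

end
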